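(* Let $\overline{R}(u)$ be either of $R^+(u)$, $R^-(u)$ and let $(W,Y_W)$ be a $V(\overline{R})$-module. Then the assignment $$\mathcal{L}(z)\mapsto L(z)=Y_W(L^+(0)\mathbf{1},z)$$ defines a structure of $\mathrm{Y}(\widehat{R})$-module on $W$ such that $$\mathcal{L}(z)\in\mathrm{End}\,\mathbb{C}^N\otimes\mathrm{Hom}(W,W((z))_h).$$ In particular, the assignment $\mathcal{L}(z)\mapsto Y(L^+(0)\mathbf{1},z)$ (the case $W=V(\overline{R})$, $Y_W=Y$) defines an action of the algebra $\mathrm{Y}(\widehat{R})$ on $V(\overline{R})$.
   Context: Fix an integer $N\geq 2$ and a formal parameter $h$. A $\mathbb{C}[[h]]$-module $V$ is topologically free if $V\cong V_0[[h]]$ for some complex vector space $V_0$. For such $V$, $V((z))_h$ denotes the module of all $a(z)=\sum_{r\in\mathbb{Z}}a_rz^{-r-1}\in V[[z^{\pm1}]]$ with $a_r\to0$ as $r\to\infty$ $h$-adically. Tensor products over $\mathbb{C}[[h]]$ are $h$-adically completed. Expansion convention: $(a_1u_1+\cdots+a_nu_n)^r$ with $r<0$, nonzero $a_i\in\mathbb{C}$, is expanded in nonnegative powers of $u_2,\ldots,u_n$ (the same if the last variable is replaced by $h$). $R$-matrices: $R(u)=I-Phu^{-1}$, with $I$ the identity and $P$ the permutation operator on $\mathbb{C}^N\otimes\mathbb{C}^N$; $\widehat{R}(u)=uR(u)=uI-hP$; $R^{\pm}(u)=u(u\mp h)^{-1}R(u)\in\mathrm{End}\,\mathbb{C}^N\otimes\mathrm{End}\,\mathbb{C}^N[[h/u]]$;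 $\overline{R}(u)$ denotes either one of $R^{\pm}(u)$. Subscripts indicate tensor factors. Put $\overline{R}_{[n]}(u_1,\ldots,u_n)=\prod_{i=1,\ldots,n-1}^{\longrightarrow}\prod_{j=i+1,\ldots,n}^{\longrightarrow}\overline{R}_{ij}(u_i-u_j)$ (factors in increasing order of indices from left to right). For $u=(u_1,\ldots,u_n)$, $v=(v_1,\ldots,v_m)$ and $\overline{R}_{ij}=\overline{R}_{ij}(z+u_i-v_{j-n})$ put $\overline{R}_{nm}^{12}(z+u-v)=\prod_{i=1,\ldots,n}^{\longrightarrow}\prod_{j=n+1,\ldots,n+m}^{\longleftarrow}\overline{R}_{ij}$ and $\overline{R}_{nm}^{\bar1\bar2}(z+u-v)=\prod_{i=1,\ldots,n}^{\longleftarrow}\prod_{j=n+1,\ldots,n+m}^{\longrightarrow}\overline{R}_{ij}$ ($\longleftarrow$: decreasing order of the index from left to right). $\mathrm{Y}(\widehat{R})$ is the associative algebra over $\mathbb{C}[[h]]$ generated by $\lambda_{ij}^{(r)}$, $r\in\mathbb{Z}$, $i,j=1,\ldots,N$, subject to $\widehat{R}(u-v)\mathcal{L}_1(u)\mathcal{L}_2(v)=\mathcal{L}_2(v)\mathcal{L}_1(u)\widehat{R}(u-v)$, where $\mathcal{L}(u)=\sum_{i,j}e_{ij}\otimes\lambda_{ij}(u)$, $\lambda_{ij}(u)=\sum_{r\in\mathbb{Z}}\lambda_{ij}^{(-r)}u^r$ and $e_{ij}$ are matrix units. $A(\overline{R})$ is the topologically free associative algebra over $\mathbb{C}[[h]]$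 generated by $l_{ij}^{(-r)}$, $r\ge1$, $i,j=1,\ldots,N$, subject to $\overline{R}(-u+v)L_1^+(u)L_2^+(v)=L_2^+(v)L_1^+(u)\overline{R}(u-v)$, where $L^+(u)=\sum_{i,j}e_{ij}\otimes l_{ij}^+(u)$, $l_{ij}^+(u)=\sum_{r\geq1}l_{ij}^{(-r)}u^{r-1}$; $L_k^+$ is the copy whose matrix part acts on the $k$-th factor. Let $L^+_{[n]}(u)=L^+_1(u_1)\cdots L^+_n(u_n)$. The quantum vertex algebra $V(\overline{R})$ has underlying $\mathbb{C}[[h]]$-module $A(\overline{R})$, vacuum vector the unit $\mathbf{1}$, vertex operator map determined by $Y(L^+_{[n]}(u)\mathbf{1},z)=L_{[n]}(z+u)$, $n\ge1$, where $L_{[n]}(u)=\overline{R}_{[n]}(u_1,\ldots,u_n)L_1(u_1)\cdots L_n(u_n)$ and the operator series $L(u)$ on $A(\overline{R})$ is given by $$L_0(u)L_1^+(v_1)\cdots L_n^+(v_n)=\overline{R}_{0n}(u-v_n)^{-1}\cdots\overline{R}_{01}(u-v_1)^{-1}L_0^+(u)L_1^+(v_1)\cdots L_n^+(v_n),\quad n\ge0,$$ and braiding $\mathcal{S}(z)\big(L_{[n]}^{+13}(u)L_{[m]}^{+24}(v)(\mathbf{1}\otimes\mathbf{1})\big)=\overline{R}_{nm}^{\bar1\bar2}(z+u-v)L_{[n]}^{+13}(u)L_{[m]}^{+24}(v)\overline{R}_{nm}^{12}(z+u-v)^{-1}(\mathbf{1}\otimes\mathbf{1})$, superscripts $1,\dots,4$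 referring to the factors of $(\mathrm{End}\,\mathbb{C}^N)^{\otimes n}\otimes(\mathrm{End}\,\mathbb{C}^N)^{\otimes m}\otimes V(\overline{R})^{\otimes2}$. Definition. For a quantum vertex algebra $(V,Y,\mathbf{1},\mathcal{S})$, a $V$-module is a pair $(W,Y_W)$, where $W$ is a topologically free $\mathbb{C}[[h]]$-module and $Y_W(z)\colon V\otimes W\to W((z))_h$, $v\otimes w\mapsto Y_W(v,z)w$, is a $\mathbb{C}[[h]]$-module map with $Y_W(\mathbf{1},z)w=w$ for all $w\in W$ and satisfying weak associativity: for any $u,v\in V$, $w\in W$, $k\in\mathbb{Z}_{\ge0}$ there is $r\in\mathbb{Z}_{\ge0}$ such that $(z_0+z_2)^rY_W(u,z_0+z_2)Y_W(v,z_2)w-(z_0+z_2)^rY_W(Y(u,z_0)v,z_2)w\in h^kW[[z_0^{\pm1},z_2^{\pm1}]]$. $Y_W(L^+(0)\mathbf{1},z)$ means that $Y_W(\cdot,z)$ is applied to the matrix entries $l_{ij}^{(-1)}$ of $L^+(0)$. *)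

theory Defs
  imports
    "HOL-Analysis.Cartesian_Space"
    "HOL-Computational_Algebra.Formal_Power_Series"
    "HOL-Library.Poly_Mapping"
begin

text \<open>
  The ring \<open>\<complex>[[h]]\<close> is the type \<^typ>\<open>complex fps\<close>, with \<open>h\<close> = \<^const>\<open>fps_X\<close>; a
  \<open>\<complex>[[h]]\<close>-module is an abelian group type with a scalar multiplication \<open>sc\<close> such that
  \<^const>\<open>module\<close> \<open>sc\<close>. A formal series is represented by its coefficient function: in
  \<open>x :: int \<Rightarrow> 'w\<close> the value \<open>x p\<close> is the coefficient of \<open>z\<close> to the power \<open>p\<close> (so the mode
  \<open>a\<^sub>r\<close> of \<open>a(z) = \<Sum> a\<^sub>r z\<^bsup>-r-1\<^esup>\<close> is \<open>x (- r - 1)\<close>).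
\<close>

section \<open>Topologically free modules and \<open>h\<close>-adic sums\<close>

definition hpow :: "(complex fps \<Rightarrow> 'w \<Rightarrow> 'w) \<Rightarrow> nat \<Rightarrow> 'w set" where
  "hpow sc k = range (sc (fps_X ^ k))"

text \<open>The action of \<open>\<complex>[[h]]\<close> on \<open>V\<^sub>0[[h]]\<close> for a complex vector space with scalar multiplication \<open>s\<close>.\<close>

definition fps_scale ::
    "(complex \<Rightarrow> 'v \<Rightarrow> 'v) \<Rightarrow> complex fps \<Rightarrow> 'v::comm_monoid_add fps \<Rightarrow> 'v fps" where
  "fps_scale s c f = Abs_fps (\<lambda>n. \<Sum>i\<le>n. s (fps_nth c i) (fps_nth f (n - i)))"

text \<open>
  \<open>W \<cong> V\<^sub>0[[h]]\<close>. The vector space \<open>V\<^sub>0\<close> may be taken to be a complex subspace of \<open>W\<close>: transport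
  the constant series along the isomorphism.
\<close>

definition topologically_free :: "(complex fps \<Rightarrow> 'w::ab_group_add \<Rightarrow> 'w) \<Rightarrow> bool" where
  "topologically_free sc \<longleftrightarrow> module sc \<and>
     (\<exists>V0 \<phi>. module.subspace (\<lambda>a. sc (fps_const a)) V0 \<and>
        bij_betw \<phi> {f :: 'w fps. \<forall>n. fps_nth f n \<in> V0} UNIV \<and>
        (\<forall>f g. (\<forall>n. fps_nth f n \<in> V0) \<and> (\<forall>n. fps_nth g n \<in> V0) \<longrightarrow> \<phi> (f + g) = \<phi> f + \<phi> g) \<and>
        (\<forall>c f. (\<forall>n. fps_nth f n \<in> V0) \<longrightarrow>
           \<phi> (fps_scale (\<lambda>a. sc (fps_const a)) c f) = sc c (\<phi> f)))"

text \<open>Unconditional \<open>h\<close>-adic sums; they are unique in \<open>h\<close>-adically separated modules.\<close>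

definition has_hsum ::
    "(complex fps \<Rightarrow> 'w \<Rightarrow> 'w) \<Rightarrow> ('i \<Rightarrow> 'w::ab_group_add) \<Rightarrow> 'i set \<Rightarrow> 'w \<Rightarrow> bool" where
  "has_hsum sc f S s \<longleftrightarrow>
     (\<forall>k. \<exists>F. finite F \<and> F \<subseteq> S \<and>
        (\<forall>G. finite G \<and> F \<subseteq> G \<and> G \<subseteq> S \<longrightarrow> s - sum f G \<in> hpow sc k))"

definition hsum ::
    "(complex fps \<Rightarrow> 'w \<Rightarrow> 'w) \<Rightarrow> ('i \<Rightarrow> 'w::ab_group_add) \<Rightarrow> 'i set \<Rightarrow> 'w" where
  "hsum sc f S = (THE s. has_hsum sc f S s)"

text \<open>\<open>W((z))\<^sub>h\<close>\<close>

definition laurent_h :: "(complex fps \<Rightarrow> 'w \<Rightarrow> 'w) \<Rightarrow> (int \<Rightarrow> 'w) set" where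
  "laurent_h sc = {x. \<forall>k. \<exists>M. \<forall>p<M. x p \<in> hpow sc k}"

definition in_Hom_laurent_h ::
    "(complex fps \<Rightarrow> 'w::ab_group_add \<Rightarrow> 'w) \<Rightarrow> (int \<Rightarrow> 'w \<Rightarrow> 'w) \<Rightarrow> bool" where
  "in_Hom_laurent_h sc A \<longleftrightarrow>
     (\<forall>p. module_hom sc sc (A p)) \<and> (\<forall>w. (\<lambda>p. A p w) \<in> laurent_h sc)"

section \<open>Algebras given by generators and relations\<close>

datatype 'g free_word = Free_Word (letters: "'g list")

instantiation free_word :: (type) monoid_add
begin

definition "0 = Free_Word []"
definition "v + w = Free_Word (letters v @ letters w)"

instance
  by standard (simp_all add: zero_free_word_def plus_free_word_def)

end

text \<open>
  The free associative algebra \<open>\<complex>[[h]]\<langle>g\<rangle>\<close>, and its topologically free analogue \<open>\<complex>\<langle>g\<rangle>[[h]]\<close>.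
\<close>

type_synonym 'g free_alg = "'g free_word \<Rightarrow>\<^sub>0 complex fps"
type_synonym 'g tfree_alg = "('g free_word \<Rightarrow>\<^sub>0 complex) fps"

definition free_gen :: "'g \<Rightarrow> 'g free_alg" where
  "free_gen g = Poly_Mapping.single (Free_Word [g]) 1"

definition tfree_gen :: "'g \<Rightarrow> 'g tfree_alg" where
  "tfree_gen g = fps_const (Poly_Mapping.single (Free_Word [g]) 1)"

definition free_scale :: "complex fps \<Rightarrow> 'g free_alg \<Rightarrow> 'g free_alg" where
  "free_scale c x = Poly_Mapping.single 0 c * x"

definition tfree_scale :: "complex fps \<Rightarrow> 'g tfree_alg \<Rightarrow> 'g tfree_alg" where
  "tfree_scale = fps_scale (\<lambda>a x. Poly_Mapping.single 0 a * x)"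

definition algebra_h :: "(complex fps \<Rightarrow> 'b::ring_1 \<Rightarrow> 'b) \<Rightarrow> bool" where
  "algebra_h sc \<longleftrightarrow> module sc \<and>
     (\<forall>c x y. sc c (x * y) = sc c x * y \<and> sc c (x * y) = x * sc c y)"

definition two_sided_ideal :: "'b::ring_1 set \<Rightarrow> bool" where
  "two_sided_ideal J \<longleftrightarrow> 0 \<in> J \<and> (\<forall>x\<in>J. \<forall>y\<in>J. x + y \<in> J) \<and>
     (\<forall>x\<in>J. \<forall>r. r * x \<in> J \<and> x * r \<in> J)"

definition hclosed :: "(complex fps \<Rightarrow> 'b::ab_group_add \<Rightarrow> 'b) \<Rightarrow> 'b set \<Rightarrow> bool" where
  "hclosed sc J \<longleftrightarrow> (\<forall>x. (\<forall>k. \<exists>y\<in>J. x - y \<in> hpow sc k) \<longrightarrow> x \<in> J)"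

definition hsaturated :: "(complex fps \<Rightarrow> 'b \<Rightarrow> 'b) \<Rightarrow> 'b set \<Rightarrow> bool" where
  "hsaturated sc J \<longleftrightarrow> (\<forall>x. sc fps_X x \<in> J \<longrightarrow> x \<in> J)"

definition ideal_gen :: "'b::ring_1 set \<Rightarrow> 'b set" where
  "ideal_gen X = \<Inter>{J. two_sided_ideal J \<and> X \<subseteq> J}"

text \<open>
  A quotient of \<open>\<complex>\<langle>g\<rangle>[[h]]\<close> by an ideal is topologically free iff the ideal is \<open>h\<close>-adically closed
  and the quotient has no \<open>h\<close>-torsion. Hence dividing by the following ideal gives the universal
  topologically free algebra in which the relations \<open>X\<close> hold.
\<close>

definition tfree_ideal_gen :: "'g tfree_alg set \<Rightarrow> 'g tfree_alg set" where
  "tfree_ideal_gen X = \<Inter>{J. two_sided_ideal J \<and> hclosed tfree_scale J \<and>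
     hsaturated tfree_scale J \<and> X \<subseteq> J}"

text \<open>\<open>\<pi>\<close> identifies its codomain with the quotient of its domain by \<open>I\<close>.\<close>

definition quotient_alg ::
    "(complex fps \<Rightarrow> 'f::ring_1 \<Rightarrow> 'f) \<Rightarrow> (complex fps \<Rightarrow> 'b::ring_1 \<Rightarrow> 'b) \<Rightarrow> ('f \<Rightarrow> 'b) \<Rightarrow> 'f set \<Rightarrow> bool"
  where
  "quotient_alg scaleF sc \<pi> I \<longleftrightarrow> algebra_h sc \<and> module_hom scaleF sc \<pi> \<and>
     \<pi> 1 = 1 \<and> (\<forall>x y. \<pi> (x * y) = \<pi> x * \<pi> y) \<and> surj \<pi> \<and> {x. \<pi> x = 0} = I"

text \<open>Module structures over an associative \<open>\<complex>[[h]]\<close>-algebra.\<close>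

definition representation ::
    "(complex fps \<Rightarrow> 'b::ring_1 \<Rightarrow> 'b) \<Rightarrow> (complex fps \<Rightarrow> 'w::ab_group_add \<Rightarrow> 'w) \<Rightarrow> ('b \<Rightarrow> 'w \<Rightarrow> 'w) \<Rightarrow> bool"
  where
  "representation sc scaleW \<rho> \<longleftrightarrow>
     (\<forall>x. module_hom scaleW scaleW (\<rho> x)) \<and> (\<forall>w. module_hom sc scaleW (\<lambda>x. \<rho> x w)) \<and>
     (\<forall>w. \<rho> 1 w = w) \<and> (\<forall>x y w. \<rho> (x * y) w = \<rho> x (\<rho> y w))"

section \<open>Matrix-valued series in several variables\<close>

text \<open>
  Elements of \<open>(End \<complex>\<^sup>N)\<^bsup>\<otimes>n\<^esup> \<otimes> X\<close> with coefficients depending on \<open>n\<close> variables: \<open>M I J e\<close> is the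
  coefficient of \<open>x\<^sub>0\<^bsup>e!0\<^esup> \<dots> x\<^bsub>n-1\<^esub>\<^bsup>e!(n-1)\<^esup>\<close> in the \<open>(I, J)\<close> matrix entry. Only lists \<open>I, J, e\<close> of
  length \<open>n\<close> matter. Tensor factors and variables are numbered from \<open>0\<close>.
\<close>

type_synonym ('n, 'x) mser = "'n list \<Rightarrow> 'n list \<Rightarrow> int list \<Rightarrow> 'x"

definition mser_one :: "nat \<Rightarrow> ('n, complex fps) mser" where
  "mser_one n I J e = of_bool (I = J \<and> e = replicate n 0)"

definition mser_lmul ::
    "(complex fps \<Rightarrow> 'x \<Rightarrow> 'x) \<Rightarrow> nat \<Rightarrow> ('n, complex fps) mser \<Rightarrow> ('n, 'x::ab_group_add) mser \<Rightarrow> ('n, 'x) mser"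
  where
  "mser_lmul sc n M X I J e =
     hsum sc (\<lambda>(K, d). sc (M I K d) (X K J (map2 (-) e d))) {(K, d). length K = n \<and> length d = n}"

definition mser_rmul ::
    "(complex fps \<Rightarrow> 'x \<Rightarrow> 'x) \<Rightarrow> nat \<Rightarrow> ('n, 'x::ab_group_add) mser \<Rightarrow> ('n, complex fps) mser \<Rightarrow> ('n, 'x) mser"
  where
  "mser_rmul sc n X M I J e =
     hsum sc (\<lambda>(K, d). sc (M K J d) (X I K (map2 (-) e d))) {(K, d). length K = n \<and> length d = n}"

definition mser_prod ::
    "nat \<Rightarrow> ('n, complex fps) mser list \<Rightarrow> ('n, complex fps) mser" where
  "mser_prod n Ms = foldr (mser_lmul (*) n) Ms (mser_one n)"

text \<open>
  The coefficient of \<open>u\<^sup>a v\<^sup>b\<close> in \<open>(s u + t v)\<^sup>m\<close>, expanded in nonnegative powers of \<open>v\<close>.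
\<close>

definition binexp :: "complex \<Rightarrow> complex \<Rightarrow> int \<Rightarrow> int \<Rightarrow> int \<Rightarrow> complex" where
  "binexp s t m a b =
     (if 0 \<le> b \<and> a + b = m then (of_int m gchoose nat b) * s powi a * t ^ nat b else 0)"

section \<open>\<open>R\<close>-matrices\<close>

text \<open>
  An element of \<open>End \<complex>\<^sup>N \<otimes> End \<complex>\<^sup>N [[h/u]]\<close> is a matrix of power series in the variable \<open>h/u\<close>
  (in this section \<^const>\<open>fps_X\<close> stands for \<open>h/u\<close>), with \<open>N = CARD('n)\<close>.
\<close>

type_synonym 'n rmat = "complex fps ^ ('n \<times> 'n) ^ ('n \<times> 'n)"

definition Pmat :: "'n::finite rmat" where
  "Pmat = (\<chi> p q. of_bool (p = prod.swap q))"

definition Rmat :: "'n::finite rmat" where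
  "Rmat = (\<chi> p q. vec_nth (vec_nth (mat 1) p) q - fps_X * vec_nth (vec_nth Pmat p) q)"

text \<open>\<open>u (u \<mp> h)\<^sup>-\<^sup>1 = (1 \<mp> h/u)\<^sup>-\<^sup>1\<close>\<close>

definition Rplus :: "'n::finite rmat" where
  "Rplus = (\<chi> p q. inverse (1 - fps_X) * vec_nth (vec_nth Rmat p) q)"

definition Rminus :: "'n::finite rmat" where
  "Rminus = (\<chi> p q. inverse (1 + fps_X) * vec_nth (vec_nth Rmat p) q)"

text \<open>
  The coefficient of \<open>x\<^sup>a y\<^sup>b\<close> in the \<open>(p, q)\<close> entry of \<open>R(s x + t y)\<close>: it comes from
  \<open>h\<^sup>k (s x + t y)\<^bsup>-k\<^esup>\<close> with \<open>k = - (a + b)\<close>.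
\<close>

definition R_coeff ::
    "'n::finite rmat \<Rightarrow> complex \<Rightarrow> complex \<Rightarrow> int \<Rightarrow> int \<Rightarrow> 'n \<times> 'n \<Rightarrow> 'n \<times> 'n \<Rightarrow> complex fps" where
  "R_coeff R s t a b p q =
     (if a + b \<le> 0
      then fps_const (fps_nth (vec_nth (vec_nth R p) q) (nat (- (a + b))) * binexp s t (a + b) a b)
             * fps_X ^ nat (- (a + b))
      else 0)"

text \<open>\<open>R\<^bsub>ij\<^esub>(s x\<^sub>i + t x\<^sub>j)\<close> in \<open>n\<close> tensor factors and \<open>n\<close> variables.\<close>

definition R_at ::
    "'n::finite rmat \<Rightarrow> complex \<Rightarrow> complex \<Rightarrow> nat \<Rightarrow> nat \<Rightarrow> nat \<Rightarrow> ('n, complex fps) mser" where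
  "R_at R s t n i j I J e =
     (if \<forall>m<n. m \<noteq> i \<and> m \<noteq> j \<longrightarrow> I ! m = J ! m \<and> e ! m = 0
      then R_coeff R s t (e ! i) (e ! j) (I ! i, I ! j) (J ! i, J ! j) else 0)"

text \<open>The product of \<open>R\<^bsub>ij\<^esub>(x\<^sub>i - x\<^sub>j)\<close> over \<open>i < j\<close> in lexicographic order.\<close>

definition R_bracket :: "'n::finite rmat \<Rightarrow> nat \<Rightarrow> ('n, complex fps) mser" where
  "R_bracket R n =
     mser_prod n (concat (map (\<lambda>i. map (\<lambda>j. R_at R 1 (-1) n i j) [Suc i..<n]) [0..<n]))"

text \<open>\<open>A\<^sub>1(x\<^sub>0) A\<^sub>2(x\<^sub>1)\<close> and \<open>A\<^sub>2(x\<^sub>1) A\<^sub>1(x\<^sub>0)\<close> for a matrix \<open>A\<close> of series with coefficients \<open>a i j p\<close>.\<close>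

definition prod12 :: "('n \<Rightarrow> 'n \<Rightarrow> int \<Rightarrow> 'b::times) \<Rightarrow> ('n, 'b) mser" where
  "prod12 a I J e = a (I ! 0) (J ! 0) (e ! 0) * a (I ! 1) (J ! 1) (e ! 1)"

definition prod21 :: "('n \<Rightarrow> 'n \<Rightarrow> int \<Rightarrow> 'b::times) \<Rightarrow> ('n, 'b) mser" where
  "prod21 a I J e = a (I ! 1) (J ! 1) (e ! 1) * a (I ! 0) (J ! 0) (e ! 0)"

section \<open>The algebra \<open>Y(Rhat)\<close>\<close>

text \<open>\<open>(i, j, r)\<close> is the index of the generator \<open>\<lambda>\<^sub>i\<^sub>j\<^bsup>(r)\<^esup>\<close>, the coefficient of \<open>u\<^bsup>-r\<^esup>\<close> in \<open>\<lambda>\<^sub>i\<^sub>j(u)\<close>.\<close>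

type_synonym 'n yang_free = "('n \<times> 'n \<times> int) free_alg"

definition lambda_series :: "'n \<Rightarrow> 'n \<Rightarrow> int \<Rightarrow> 'n yang_free" where
  "lambda_series i j p = free_gen (i, j, - p)"

text \<open>\<open>u R(u) = u I - h P\<close> at \<open>u = x\<^sub>0 - x\<^sub>1\<close>\<close>

definition Rhat :: "('n::finite, complex fps) mser" where
  "Rhat I J e =
     (of_bool (e = [1, 0]) - of_bool (e = [0, 1])) * of_bool (I = J)
     - fps_X * of_bool (e = [0, 0]) * vec_nth (vec_nth Pmat (I ! 0, I ! 1)) (J ! 0, J ! 1)"

definition yangian_relations :: "'n::finite yang_free set" where
  "yangian_relations =
     {mser_lmul free_scale 2 Rhat (prod12 lambda_series) I J e
      - mser_rmul free_scale 2 (prod21 lambda_series) Rhat I J e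
      | I J e. length I = 2 \<and> length J = 2 \<and> length e = 2}"

definition is_yangian ::
    "(complex fps \<Rightarrow> 'y::ring_1 \<Rightarrow> 'y) \<Rightarrow> ('n::finite yang_free \<Rightarrow> 'y) \<Rightarrow> bool" where
  "is_yangian scaleY \<pi>Y \<longleftrightarrow> quotient_alg free_scale scaleY \<pi>Y (ideal_gen yangian_relations)"

definition yangian_gen :: "('n yang_free \<Rightarrow> 'y) \<Rightarrow> 'n \<Rightarrow> 'n \<Rightarrow> int \<Rightarrow> 'y" where
  "yangian_gen \<pi>Y i j r = \<pi>Y (free_gen (i, j, r))"

section \<open>The algebra \<open>A(Rbar)\<close>\<close>

text \<open>
  \<open>(i, j, m)\<close> is the index of the generator \<open>l\<^sub>i\<^sub>j\<^bsup>(-m-1)\<^esup>\<close>, the coefficient of \<open>u\<^sup>m\<close> in the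
  matrix entry \<open>l\<^sub>i\<^sub>j\<^sup>+(u)\<close> of \<open>L\<^sup>+(u)\<close>.
\<close>

type_synonym 'n A_free = "('n \<times> 'n \<times> nat) tfree_alg"

definition lplus_series :: "('n A_free \<Rightarrow> 'a::zero) \<Rightarrow> 'n \<Rightarrow> 'n \<Rightarrow> int \<Rightarrow> 'a" where
  "lplus_series \<pi> i j p = (if 0 \<le> p then \<pi> (tfree_gen (i, j, nat p)) else 0)"

text \<open>\<open>R(-u + v) L\<^sub>1\<^sup>+(u) L\<^sub>2\<^sup>+(v) = L\<^sub>2\<^sup>+(v) L\<^sub>1\<^sup>+(u) R(u - v)\<close>\<close>

definition A_relations :: "'n::finite rmat \<Rightarrow> 'n A_free set" where
  "A_relations R =
     {mser_lmul tfree_scale 2 (R_at R (-1) 1 2 0 1) (prod12 (lplus_series id)) I J e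
      - mser_rmul tfree_scale 2 (prod21 (lplus_series id)) (R_at R 1 (-1) 2 0 1) I J e
      | I J e. length I = 2 \<and> length J = 2 \<and> length e = 2}"

definition is_A ::
    "'n::finite rmat \<Rightarrow> (complex fps \<Rightarrow> 'a::ring_1 \<Rightarrow> 'a) \<Rightarrow> ('n A_free \<Rightarrow> 'a) \<Rightarrow> bool" where
  "is_A R scaleA \<pi>A \<longleftrightarrow> topologically_free scaleA \<and>
     quotient_alg tfree_scale scaleA \<pi>A (tfree_ideal_gen (A_relations R))"

section \<open>The quantum vertex algebra \<open>V(Rbar)\<close>\<close>

text \<open>The entries of \<open>L\<^sub>1\<^sup>+(x\<^sub>0) \<dots> L\<^sub>n\<^sup>+(x\<^bsub>n-1\<^esub>)\<close>.\<close>

definition Lplus :: "('n A_free \<Rightarrow> 'a::ring_1) \<Rightarrow> ('n, 'a) mser" where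
  "Lplus \<pi> I J e = prod_list (map (\<lambda>m. lplus_series \<pi> (I ! m) (J ! m) (e ! m)) [0..<length e])"

text \<open>
  The operator series \<open>L(u)\<close>: \<open>L i j p\<close> is the coefficient of \<open>u\<^sup>p\<close> in its \<open>(i, j)\<close> entry. In the
  displayed formula the tensor factors are \<open>0, 1, \<dots>, n\<close> and the variables \<open>u, v\<^sub>1, \<dots>, v\<^sub>n\<close>.
\<close>

definition is_L_operator ::
    "'n::finite rmat \<Rightarrow> (complex fps \<Rightarrow> 'a::ring_1 \<Rightarrow> 'a) \<Rightarrow> ('n A_free \<Rightarrow> 'a)
       \<Rightarrow> ('n \<Rightarrow> 'n \<Rightarrow> int \<Rightarrow> 'a \<Rightarrow> 'a) \<Rightarrow> bool" where
  "is_L_operator R scaleA \<pi>A L \<longleftrightarrow>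
     (\<forall>i j p. module_hom scaleA scaleA (L i j p)) \<and>
     (\<forall>n I J e. length I = Suc n \<and> length J = Suc n \<and> length e = Suc n \<longrightarrow>
        L (hd I) (hd J) (hd e) (Lplus \<pi>A (tl I) (tl J) (tl e)) =
        mser_lmul scaleA (Suc n)
          (mser_prod (Suc n)
             (map (\<lambda>j. R_at (matrix_inv R) 1 (-1) (Suc n) 0 j) (rev [1..<Suc n])))
          (Lplus \<pi>A) I J e)"

text \<open>\<open>L\<^bsub>[n]\<^esub>(x\<^sub>0, \<dots>, x\<^bsub>n-1\<^esub>) w\<close> with its \<open>R\<close>-matrix prefactor.\<close>

definition L_bracket ::
    "'n::finite rmat \<Rightarrow> (complex fps \<Rightarrow> 'a::ring_1 \<Rightarrow> 'a) \<Rightarrow> ('n \<Rightarrow> 'n \<Rightarrow> int \<Rightarrow> 'a \<Rightarrow> 'a)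
       \<Rightarrow> nat \<Rightarrow> 'a \<Rightarrow> ('n, 'a) mser" where
  "L_bracket R scaleA L n w =
     mser_lmul scaleA n (R_bracket R n)
       (\<lambda>I J e. foldr (\<lambda>m. L (I ! m) (J ! m) (e ! m)) [0..<n] w)"

text \<open>
  A bilinear map with values in \<open>W((z))\<^sub>h\<close>; as \<open>W((z))\<^sub>h\<close> is \<open>h\<close>-adically complete, these are the
  \<open>\<complex>[[h]]\<close>-module maps from the completed tensor product \<open>V \<otimes> W\<close> to \<open>W((z))\<^sub>h\<close>.
\<close>

definition field_map ::
    "(complex fps \<Rightarrow> 'v::ab_group_add \<Rightarrow> 'v) \<Rightarrow> (complex fps \<Rightarrow> 'w::ab_group_add \<Rightarrow> 'w)
       \<Rightarrow> ('v \<Rightarrow> int \<Rightarrow> 'w \<Rightarrow> 'w) \<Rightarrow> bool" where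
  "field_map scaleV scaleW Y \<longleftrightarrow>
     (\<forall>v p. module_hom scaleW scaleW (Y v p)) \<and>
     (\<forall>p w. module_hom scaleV scaleW (\<lambda>v. Y v p w)) \<and>
     (\<forall>v w. (\<lambda>p. Y v p w) \<in> laurent_h scaleW)"

definition vacuum_acts_trivially :: "('v \<Rightarrow> int \<Rightarrow> 'w::zero \<Rightarrow> 'w) \<Rightarrow> 'v \<Rightarrow> bool" where
  "vacuum_acts_trivially Y vac \<longleftrightarrow> (\<forall>p w. Y vac p w = (if p = 0 then w else 0))"

text \<open>
  \<open>(A, Y, 1)\<close> is the quantum vertex algebra \<open>V(Rbar)\<close>. Both sides of
  \<open>Y(L\<^sup>+\<^bsub>[n]\<^esub>(x) 1, z) w = L\<^bsub>[n]\<^esub>(z + x) w\<close> are compared at \<open>x\<^sub>0\<^bsup>b!0\<^esup> \<dots> x\<^bsub>n-1\<^esub>\<^bsup>b!(n-1)\<^esup> z\<^sup>c\<close>. On the right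
  \<open>z + x\<^sub>m\<close> is substituted into the series \<open>L\<^bsub>[n]\<^esub>(x) w\<close> (and not into its factors separately,
  whose product would not exist), each \<open>(z + x\<^sub>m)\<^bsup>p!m\<^esup>\<close> being expanded in powers of \<open>x\<^sub>m\<close>.
  The braiding is left out, since modules over a quantum vertex algebra do not involve it.
\<close>

definition is_V ::
    "'n::finite rmat \<Rightarrow> (complex fps \<Rightarrow> 'a::ring_1 \<Rightarrow> 'a) \<Rightarrow> ('n A_free \<Rightarrow> 'a)
       \<Rightarrow> ('a \<Rightarrow> int \<Rightarrow> 'a \<Rightarrow> 'a) \<Rightarrow> bool" where
  "is_V R scaleA \<pi>A Y \<longleftrightarrow> is_A R scaleA \<pi>A \<and>
     field_map scaleA scaleA Y \<and> vacuum_acts_trivially Y 1 \<and>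
     (\<exists>L. is_L_operator R scaleA \<pi>A L \<and>
       (\<forall>n\<ge>1. \<forall>I J b c w. length I = n \<and> length J = n \<and> length b = n \<longrightarrow>
          Y (Lplus \<pi>A I J b) c w =
          hsum scaleA
            (\<lambda>p. scaleA (fps_const (\<Prod>m<n. binexp 1 1 (p ! m) (p ! m - b ! m) (b ! m)))
                   (L_bracket R scaleA L n w I J p))
            {p. length p = n \<and> (\<Sum>m<n. p ! m - b ! m) = c}))"

section \<open>Modules over quantum vertex algebras\<close>

text \<open>\<open>Y\<^sub>W(u, z\<^sub>0 + z\<^sub>2) Y\<^sub>W(v, z\<^sub>2) w\<close>, coefficient of \<open>z\<^sub>0\<^sup>a z\<^sub>2\<^sup>b\<close>\<close>

definition assoc_product ::
    "(complex fps \<Rightarrow> 'w \<Rightarrow> 'w) \<Rightarrow> ('v \<Rightarrow> int \<Rightarrow> 'w \<Rightarrow> 'w) \<Rightarrow> 'v \<Rightarrow> 'v \<Rightarrow> 'w \<Rightarrow> int \<Rightarrow> int \<Rightarrow> 'w::ab_group_add" where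
  "assoc_product scaleW YW u v w a b =
     hsum scaleW (\<lambda>j. scaleW (fps_const (binexp 1 1 (a + j) a j)) (YW u (a + j) (YW v (b - j) w))) {0..}"

text \<open>Multiplication by \<open>(z\<^sub>0 + z\<^sub>2)\<^sup>r\<close>\<close>

definition mult_binomial ::
    "(complex fps \<Rightarrow> 'w \<Rightarrow> 'w) \<Rightarrow> nat \<Rightarrow> (int \<Rightarrow> int \<Rightarrow> 'w) \<Rightarrow> int \<Rightarrow> int \<Rightarrow> 'w::ab_group_add" where
  "mult_binomial scaleW r F a b =
     (\<Sum>i\<le>r. scaleW (of_nat (r choose i)) (F (a - int (r - i)) (b - int i)))"

definition qva_module ::
    "(complex fps \<Rightarrow> 'v::ab_group_add \<Rightarrow> 'v) \<Rightarrow> ('v \<Rightarrow> int \<Rightarrow> 'v \<Rightarrow> 'v) \<Rightarrow> 'v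
       \<Rightarrow> (complex fps \<Rightarrow> 'w::ab_group_add \<Rightarrow> 'w) \<Rightarrow> ('v \<Rightarrow> int \<Rightarrow> 'w \<Rightarrow> 'w) \<Rightarrow> bool" where
  "qva_module scaleV Y vac scaleW YW \<longleftrightarrow>
     topologically_free scaleW \<and> field_map scaleV scaleW YW \<and> vacuum_acts_trivially YW vac \<and>
     (\<forall>u v w k. \<exists>r. \<forall>a b.
        mult_binomial scaleW r (assoc_product scaleW YW u v w) a b
        - mult_binomial scaleW r (\<lambda>a b. YW (Y u a v) b w) a b \<in> hpow scaleW k)"

text \<open>
  The coefficient of \<open>z\<^sup>p\<close> in the \<open>(i, j)\<close> entry of \<open>Y\<^sub>W(L\<^sup>+(0) 1, z)\<close>.
\<close>

definition L_of_module ::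
    "('n A_free \<Rightarrow> 'a::ring_1) \<Rightarrow> ('a \<Rightarrow> int \<Rightarrow> 'w \<Rightarrow> 'w) \<Rightarrow> 'n \<Rightarrow> 'n \<Rightarrow> int \<Rightarrow> 'w \<Rightarrow> 'w" where
  "L_of_module \<pi>A YW i j = YW (lplus_series \<pi>A i j 0)"

text \<open>
  The assignment of the operator series \<open>A i j\<close> to \<open>\<lambda>\<^sub>i\<^sub>j(z)\<close> defines a structure of
  \<open>Y(Rhat)\<close>-module; \<open>\<lambda>\<^sub>i\<^sub>j\<^bsup>(r)\<^esup>\<close> is the coefficient of \<open>z\<^bsup>-r\<^esup>\<close>.
\<close>

definition defines_yangian_action ::
    "(complex fps \<Rightarrow> 'y::ring_1 \<Rightarrow> 'y) \<Rightarrow> ('n::finite yang_free \<Rightarrow> 'y)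
       \<Rightarrow> (complex fps \<Rightarrow> 'w::ab_group_add \<Rightarrow> 'w) \<Rightarrow> ('n \<Rightarrow> 'n \<Rightarrow> int \<Rightarrow> 'w \<Rightarrow> 'w) \<Rightarrow> bool" where
  "defines_yangian_action scaleY \<pi>Y scaleW A \<longleftrightarrow>
     (\<exists>!\<rho>. representation scaleY scaleW \<rho> \<and>
        (\<forall>i j r. \<rho> (yangian_gen \<pi>Y i j r) = A i j (- r)))"

end

theory Submission
  imports Defs
begin

text \<open>
  Write \<open>x = u - v\<close>, let \<open>P\<close> be the permutation operator, and let \<open>\<epsilon> = 1\<close> for \<open>R\<^sup>+\<close> and \<open>\<epsilon> = -1\<close> for \<open>R\<^sup>-\<close>,
  so that \<open>(x - \<epsilon> h) R(x) = x - h P\<close> and \<open>(x + \<epsilon> h) R(x)\<^bsup>-1\<^esup> = x + h P\<close>. Expansions of \<open>R\<close> in different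
  regions disagree, but these polynomial identities do not depend on a region. Hence every relation
  is first multiplied by its denominator, and denominators are cancelled at the end, which is
  possible on series that have no negative powers of \<open>u\<close> or none of \<open>v\<close> (\<open>cancel_right\<close>, \<open>cancel_left\<close>).

  The operator \<open>L(u)\<close> on the algebra \<open>A(R)\<close> satisfies
  \<open>(x + \<epsilon> h) L\<^sub>1(u) (X L\<^sub>2\<^sup>+(v)) = (x + h P) (L\<^sub>1(u) X) L\<^sub>2\<^sup>+(v)\<close> (\<open>L_snoc\<close>). With the Yang-Baxter equation
  this carries the RTT relation from \<open>X\<close> to \<open>X L\<^sup>+(y)\<close>. On the vacuum vector both sides of the RTT
  relation equal \<open>(x - \<epsilon> h) L\<^sub>1\<^sup>+(u) L\<^sub>2\<^sup>+(v)\<close> (\<open>vacuum_left\<close>, \<open>vacuum_right\<close>), by the defining relation and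
  \<open>P\<^sup>2 = 1\<close>. As monomials span a dense subspace, \<open>L(u)\<close> satisfies the RTT relation (\<open>RTT\<close>), and it is
  the vertex operator of \<open>L\<^sup>+(0) 1\<close>.

  For a module \<open>W\<close>, let \<open>B(u, v)\<close> and \<open>B'(u, v)\<close> be the two sides of the RTT relation for
  \<open>Y\<^sub>W(L\<^sup>+(0) 1, z)\<close>, applied to \<open>w \<in> W\<close>, and let
  \<open>G(x\<^sub>1, x\<^sub>2, z) = (x\<^sub>1 - x\<^sub>2 - \<epsilon> h) Y\<^sub>W(L\<^sub>1\<^sup>+(x\<^sub>1) L\<^sub>2\<^sup>+(x\<^sub>2) 1, z) w\<close>. Weak associativity and the relations on the
  vacuum vector show that, modulo \<open>h\<^sup>k\<close>, \<open>B\<close> and \<open>B'\<close> are Laurent polynomials in each total degree and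
  that \<open>G(x, 0, z) = B(z + x, z)\<close> and \<open>G(0, x, z) = B'(z, z + x)\<close>, expanded in powers of \<open>x\<close>. Weak
  associativity with the vacuum vector in the second place shows that \<open>G\<close> depends only on
  \<open>z + x\<^sub>1\<close> and \<open>z + x\<^sub>2\<close>, so \<open>G\<close> is determined by \<open>G(x, 0, z)\<close> and \<open>B = B'\<close> (\<open>module_RTT\<close>). Complex
  linear functionals on \<open>W/h\<^sup>kW\<close> reduce all this to identities between complex sequences
  (\<open>ascending_expansion\<close>, \<open>translation_determines\<close>).
\<close>

section \<open>Separated and complete modules over \<open>\<complex>[[h]]\<close>\<close>

locale hseparated = module sc for sc :: "complex fps \<Rightarrow> 'w::ab_group_add \<Rightarrow> 'w" +
  assumes separated: "(\<And>k. x \<in> hpow sc k) \<Longrightarrow> x = 0"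
begin

abbreviation hp :: "nat \<Rightarrow> 'w set" where "hp \<equiv> hpow sc"

lemma hp_iff: "x \<in> hp k \<longleftrightarrow> (\<exists>y. x = sc (fps_X ^ k) y)"
  by (auto simp: hpow_def)

lemma hp_0 [simp]: "x \<in> hp 0"
  by (auto simp: hp_iff intro: exI [of _ x])

lemma hp_zero [simp]: "0 \<in> hp k"
  unfolding hp_iff by (rule exI [of _ 0]) simp

lemma hp_add: "x \<in> hp k \<Longrightarrow> y \<in> hp k \<Longrightarrow> x + y \<in> hp k"
  unfolding hp_iff by (metis scale_right_distrib)

lemma hp_uminus: "x \<in> hp k \<Longrightarrow> - x \<in> hp k"
  unfolding hp_iff by (metis scale_minus_right)

lemma hp_diff: "x \<in> hp k \<Longrightarrow> y \<in> hp k \<Longrightarrow> x - y \<in> hp k"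
  unfolding hp_iff by (metis scale_right_diff_distrib)

lemma hp_sum: "(\<And>i. i \<in> A \<Longrightarrow> f i \<in> hp k) \<Longrightarrow> sum f A \<in> hp k"
  by (induction A rule: infinite_finite_induct) (auto intro: hp_add)

lemma hp_scale: "x \<in> hp k \<Longrightarrow> sc c x \<in> hp k"
  unfolding hp_iff by (metis scale_left_commute)

lemma hp_scale_dvd: "fps_X ^ k dvd c \<Longrightarrow> sc c x \<in> hp k"
  unfolding hp_iff by (metis dvd_def scale_scale)

lemma hp_scale_X: "x \<in> hp k \<Longrightarrow> sc fps_X x \<in> hp (Suc k)"
  unfolding hp_iff by (metis power_Suc scale_scale)

lemma hp_antimono: "j \<le> k \<Longrightarrow> x \<in> hp k \<Longrightarrow> x \<in> hp j"
  unfolding hp_iff by (metis le_add_diff_inverse power_add scale_scale)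

lemma has_hsumD:
  assumes "has_hsum sc f S s"
  obtains F where "finite F" "F \<subseteq> S"
    "\<And>G. finite G \<Longrightarrow> F \<subseteq> G \<Longrightarrow> G \<subseteq> S \<Longrightarrow> s - sum f G \<in> hp k"
  using assms unfolding has_hsum_def by meson

lemma has_hsum_unique:
  assumes "has_hsum sc f S s" "has_hsum sc f S t"
  shows "s = t"
proof -
  have "s - t \<in> hp k" for k
  proof -
    obtain F where F: "finite F" "F \<subseteq> S" "\<And>G. finite G \<Longrightarrow> F \<subseteq> G \<Longrightarrow> G \<subseteq> S \<Longrightarrow> s - sum f G \<in> hp k"
      using has_hsumD [OF assms(1)] by blast
    obtain F' where F': "finite F'" "F' \<subseteq> S" "\<And>G. finite G \<Longrightarrow> F' \<subseteq> G \<Longrightarrow> G \<subseteq> S \<Longrightarrow> t - sum f G \<in> hp k"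
      using has_hsumD [OF assms(2)] by blast
    have "(s - sum f (F \<union> F')) - (t - sum f (F \<union> F')) \<in> hp k"
      by (intro hp_diff F F') (use F F' in auto)
    then show ?thesis by simp
  qed
  then have "s - t = 0" by (rule separated)
  then show ?thesis by simp
qed

lemma hsum_eq: "has_hsum sc f S s \<Longrightarrow> hsum sc f S = s"
  unfolding hsum_def by (blast intro: the_equality has_hsum_unique)

lemma has_hsum_finite:
  assumes "finite F" "F \<subseteq> S" "\<And>i. i \<in> S - F \<Longrightarrow> f i = 0"
  shows "has_hsum sc f S (sum f F)"
  unfolding has_hsum_def
proof (intro allI exI [of _ F] conjI impI)
  fix k G assume "finite G \<and> F \<subseteq> G \<and> G \<subseteq> S"
  then have "sum f F = sum f G"
    using assms by (intro sum.mono_neutral_left) auto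
  then show "sum f F - sum f G \<in> hp k" by simp
qed (use assms in auto)

lemma has_hsum_tail:
  assumes "has_hsum sc f S s" "finite F" "F \<subseteq> S" "\<And>i. i \<in> S - F \<Longrightarrow> f i \<in> hp k"
  shows "s - sum f F \<in> hp k"
proof -
  obtain F' where F': "finite F'" "F' \<subseteq> S" "\<And>G. finite G \<Longrightarrow> F' \<subseteq> G \<Longrightarrow> G \<subseteq> S \<Longrightarrow> s - sum f G \<in> hp k"
    using has_hsumD [OF assms(1)] by blast
  have "sum f (F \<union> F') = sum f F + sum f (F' - F)"
    using assms(2) F'(1) by (metis Un_Diff_cancel finite_Diff sum.union_disjoint Diff_disjoint)
  moreover have "sum f (F' - F) \<in> hp k"
    using F'(2) assms(4) by (intro hp_sum) auto
  moreover have "s - sum f (F \<union> F') \<in> hp k"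
    using F' assms by (intro F'(3)) auto
  ultimately have "(s - (sum f F + sum f (F' - F))) + sum f (F' - F) \<in> hp k"
    by (intro hp_add) simp_all
  then show ?thesis by (simp add: algebra_simps)
qed

lemma has_hsum_closed:
  assumes "has_hsum sc f S s" "\<And>i. i \<in> S \<Longrightarrow> f i \<in> hp k"
  shows "s \<in> hp k"
  using has_hsum_tail [OF assms(1), of "{}" k] assms(2) by simp

lemma has_hsum_zero: "(\<And>i. i \<in> S \<Longrightarrow> f i = 0) \<Longrightarrow> has_hsum sc f S 0"
  using has_hsum_finite [of "{}" S f] by simp

lemma has_hsum_add:
  assumes "has_hsum sc f S s" "has_hsum sc g S t"
  shows "has_hsum sc (\<lambda>i. f i + g i) S (s + t)"
  unfolding has_hsum_def
proof
  fix k
  obtain F where F: "finite F" "F \<subseteq> S" "\<And>G. finite G \<Longrightarrow> F \<subseteq> G \<Longrightarrow> G \<subseteq> S \<Longrightarrow> s - sum f G \<in> hp k"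
    using has_hsumD [OF assms(1)] by blast
  obtain F' where F': "finite F'" "F' \<subseteq> S" "\<And>G. finite G \<Longrightarrow> F' \<subseteq> G \<Longrightarrow> G \<subseteq> S \<Longrightarrow> t - sum g G \<in> hp k"
    using has_hsumD [OF assms(2)] by blast
  show "\<exists>F. finite F \<and> F \<subseteq> S \<and> (\<forall>G. finite G \<and> F \<subseteq> G \<and> G \<subseteq> S \<longrightarrow> s + t - (\<Sum>i\<in>G. f i + g i) \<in> hp k)"
  proof (intro exI [of _ "F \<union> F'"] conjI allI impI)
    fix G assume G: "finite G \<and> F \<union> F' \<subseteq> G \<and> G \<subseteq> S"
    then have "(s - sum f G) + (t - sum g G) \<in> hp k"
      by (intro hp_add F F') auto
    then show "s + t - (\<Sum>i\<in>G. f i + g i) \<in> hp k"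
      by (simp add: sum.distrib algebra_simps)
  qed (use F F' in auto)
qed

end

text \<open>A linear map is \<open>h\<close>-adically continuous, so it commutes with \<open>h\<close>-adic sums.\<close>

lemma module_hom_hpow: "module_hom sc sc' \<psi> \<Longrightarrow> x \<in> hpow sc k \<Longrightarrow> \<psi> x \<in> hpow sc' k"
  by (auto simp: hpow_def module_hom.scale)

lemma has_hsum_hom:
  assumes "module_hom sc sc' \<psi>" "has_hsum sc f S s"
  shows "has_hsum sc' (\<lambda>i. \<psi> (f i)) S (\<psi> s)"
proof -
  interpret module_hom sc sc' \<psi> by fact
  show ?thesis
    unfolding has_hsum_def
  proof
    fix k
    obtain F where F: "finite F" "F \<subseteq> S" "\<And>G. finite G \<Longrightarrow> F \<subseteq> G \<Longrightarrow> G \<subseteq> S \<Longrightarrow> s - sum f G \<in> hpow sc k"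
      using assms(2) unfolding has_hsum_def by meson
    show "\<exists>F. finite F \<and> F \<subseteq> S \<and> (\<forall>G. finite G \<and> F \<subseteq> G \<and> G \<subseteq> S \<longrightarrow> \<psi> s - (\<Sum>i\<in>G. \<psi> (f i)) \<in> hpow sc' k)"
    proof (intro exI [of _ F] conjI allI impI)
      fix G assume "finite G \<and> F \<subseteq> G \<and> G \<subseteq> S"
      then have "s - sum f G \<in> hpow sc k" by (intro F) auto
      then have "\<psi> (s - sum f G) \<in> hpow sc' k" by (rule module_hom_hpow [OF assms(1)])
      then show "\<psi> s - (\<Sum>i\<in>G. \<psi> (f i)) \<in> hpow sc' k" by (simp add: diff sum)
    qed (use F in auto)
  qed
qed

lemma has_hsum_reindex_aux:
  assumes bij: "bij_betw g S T" and "has_hsum sc f T s"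
  shows "has_hsum sc (\<lambda>i. f (g i)) S s"
  unfolding has_hsum_def
proof
    fix k
    obtain F where F: "finite F" "F \<subseteq> T" "\<And>G. finite G \<Longrightarrow> F \<subseteq> G \<Longrightarrow> G \<subseteq> T \<Longrightarrow> s - sum f G \<in> hpow sc k"
      using assms(2) unfolding has_hsum_def by meson
    obtain F' where F': "F' \<subseteq> S" "F = g ` F'" "inj_on g F'"
      using F(2) bij unfolding bij_betw_def by (metis inj_on_subset subset_imageE)
    show "\<exists>F. finite F \<and> F \<subseteq> S \<and> (\<forall>G. finite G \<and> F \<subseteq> G \<and> G \<subseteq> S \<longrightarrow> s - (\<Sum>i\<in>G. f (g i)) \<in> hpow sc k)"
    proof (intro exI [of _ F'] conjI allI impI)
      show "finite F'" using F(1) F' by (simp add: finite_image_iff)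
      fix G assume G: "finite G \<and> F' \<subseteq> G \<and> G \<subseteq> S"
      have "inj_on g G" using bij G unfolding bij_betw_def by (meson inj_on_subset)
      then have "(\<Sum>i\<in>G. f (g i)) = sum f (g ` G)" by (simp add: sum.reindex)
      moreover have "s - sum f (g ` G) \<in> hpow sc k"
        using G F'(2) bij by (intro F(3)) (auto simp: bij_betw_def)
      ultimately show "s - (\<Sum>i\<in>G. f (g i)) \<in> hpow sc k" by simp
    qed (use F' in auto)
qed

lemma has_hsum_cong:
  assumes "\<And>i. i \<in> S \<Longrightarrow> f i = g i"
  shows "has_hsum sc f S s \<longleftrightarrow> has_hsum sc g S s"
proof -
  have "sum f G = sum g G" if "G \<subseteq> S" for G
    using assms that by (intro sum.cong) auto
  then show ?thesis unfolding has_hsum_def by metis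
qed

lemma has_hsum_reindex:
  assumes "bij_betw g S T"
  shows "has_hsum sc f T s \<longleftrightarrow> has_hsum sc (\<lambda>i. f (g i)) S s"
proof
  assume "has_hsum sc (\<lambda>i. f (g i)) S s"
  from has_hsum_reindex_aux [OF bij_betw_inv_into [OF assms] this]
  have "has_hsum sc (\<lambda>i. f (g (inv_into S g i))) T s" .
  moreover have "f (g (inv_into S g i)) = f i" if "i \<in> T" for i
    using assms that by (metis bij_betw_inv_into_right)
  ultimately show "has_hsum sc f T s"
    by (simp cong: has_hsum_cong)
qed (rule has_hsum_reindex_aux [OF assms])

lemma has_hsum_neutral:
  assumes "T \<subseteq> S" "\<And>i. i \<in> S - T \<Longrightarrow> f i = 0"
  shows "has_hsum sc f S s \<longleftrightarrow> has_hsum sc f T s"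
proof
  assume *: "has_hsum sc f S s"
  show "has_hsum sc f T s"
    unfolding has_hsum_def
  proof
    fix k
    obtain F where F: "finite F" "F \<subseteq> S" "\<And>G. finite G \<Longrightarrow> F \<subseteq> G \<Longrightarrow> G \<subseteq> S \<Longrightarrow> s - sum f G \<in> hpow sc k"
      using * unfolding has_hsum_def by meson
    show "\<exists>F. finite F \<and> F \<subseteq> T \<and> (\<forall>G. finite G \<and> F \<subseteq> G \<and> G \<subseteq> T \<longrightarrow> s - sum f G \<in> hpow sc k)"
    proof (intro exI [of _ "F \<inter> T"] conjI allI impI)
      fix G assume G: "finite G \<and> F \<inter> T \<subseteq> G \<and> G \<subseteq> T"
      have "sum f (G \<union> F) = sum f G"
        using G F assms by (intro sum.mono_neutral_right ballI assms(2)) auto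
      moreover have "s - sum f (G \<union> F) \<in> hpow sc k"
        using G F assms by (intro F(3)) auto
      ultimately show "s - sum f G \<in> hpow sc k" by simp
    qed (use F in auto)
  qed
next
  assume *: "has_hsum sc f T s"
  show "has_hsum sc f S s"
    unfolding has_hsum_def
  proof
    fix k
    obtain F where F: "finite F" "F \<subseteq> T" "\<And>G. finite G \<Longrightarrow> F \<subseteq> G \<Longrightarrow> G \<subseteq> T \<Longrightarrow> s - sum f G \<in> hpow sc k"
      using * unfolding has_hsum_def by meson
    show "\<exists>F. finite F \<and> F \<subseteq> S \<and> (\<forall>G. finite G \<and> F \<subseteq> G \<and> G \<subseteq> S \<longrightarrow> s - sum f G \<in> hpow sc k)"
    proof (intro exI [of _ F] conjI allI impI)
      fix G assume G: "finite G \<and> F \<subseteq> G \<and> G \<subseteq> S"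
      have "sum f G = sum f (G \<inter> T)"
        using G F assms by (intro sum.mono_neutral_right ballI assms(2)) auto
      moreover have "s - sum f (G \<inter> T) \<in> hpow sc k"
        using G F assms by (intro F(3)) auto
      ultimately show "s - sum f G \<in> hpow sc k" by simp
    qed (use F assms in auto)
  qed
qed

lemma hsum_reindex: "bij_betw g S T \<Longrightarrow> hsum sc f T = hsum sc (\<lambda>i. f (g i)) S"
  unfolding hsum_def by (intro arg_cong [where f = The] ext has_hsum_reindex)

lemma hsum_cong: "(\<And>i. i \<in> S \<Longrightarrow> f i = g i) \<Longrightarrow> hsum sc f S = hsum sc g S"
  unfolding hsum_def by (intro arg_cong [where f = The] ext has_hsum_cong)

lemma hsum_neutral:
  assumes "T \<subseteq> S" "\<And>i. i \<in> S - T \<Longrightarrow> f i = 0"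
  shows "hsum sc f S = hsum sc f T"
  unfolding hsum_def by (intro arg_cong [where f = The] ext has_hsum_neutral assms)

locale hcomplete = hseparated sc for sc :: "complex fps \<Rightarrow> 'w::ab_group_add \<Rightarrow> 'w" +
  assumes complete: "(\<And>k. s (Suc k) - s k \<in> hpow sc k) \<Longrightarrow> \<exists>x. \<forall>k. x - s k \<in> hpow sc k"
begin

text \<open>
  The partial sums over the finitely many terms outside \<open>h\<^sup>kW\<close>, for \<open>k = 0, 1, \<dots>\<close>, form a Cauchy
  sequence.
\<close>

lemma has_hsum_exists:
  assumes "\<And>k. finite {i \<in> S. f i \<notin> hp k}"
  obtains s where "has_hsum sc f S s"
proof -
  define F where "F k = {i \<in> S. f i \<notin> hp k}" for k
  have fin: "finite (F k)" for k using assms by (simp add: F_def)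
  have mono: "F k \<subseteq> F (Suc k)" for k
    unfolding F_def using hp_antimono [of k "Suc k"] by auto
  have "sum f (F (Suc k)) - sum f (F k) \<in> hp k" for k
  proof -
    have "sum f (F (Suc k)) - sum f (F k) = sum f (F (Suc k) - F k)"
      using fin mono by (simp add: sum_diff)
    also have "\<dots> \<in> hp k" by (intro hp_sum) (auto simp: F_def)
    finally show ?thesis .
  qed
  then obtain x where x: "\<And>k. x - sum f (F k) \<in> hp k"
    using complete [of "\<lambda>k. sum f (F k)"] by auto
  have "has_hsum sc f S x"
    unfolding has_hsum_def
  proof (intro allI exI conjI impI)
    fix k G
    show "finite (F k)" by (rule fin)
    show "F k \<subseteq> S" by (auto simp: F_def)
    assume G: "finite G \<and> F k \<subseteq> G \<and> G \<subseteq> S"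
    then have "sum f G = sum f (F k) + sum f (G - F k)"
      by (metis sum.subset_diff add.commute)
    moreover have "sum f (G - F k) \<in> hp k"
      using G by (intro hp_sum) (auto simp: F_def)
    ultimately have "(x - sum f (F k)) - sum f (G - F k) \<in> hp k" "sum f G = sum f (F k) + sum f (G - F k)"
      using x by (auto intro: hp_diff)
    then show "x - sum f G \<in> hp k" by (simp add: algebra_simps)
  qed
  then show ?thesis by (rule that)
qed

end

subsection \<open>Modules of power series\<close>

lemma module_fps_scale:
  assumes "module (s :: complex \<Rightarrow> 'v::ab_group_add \<Rightarrow> 'v)"
  shows "module (fps_scale s)"
proof -
  interpret m: module s by fact
  show ?thesis
  proof
    fix a b :: "complex fps" and x y :: "'v fps"
    show "fps_scale s a (x + y) = fps_scale s a x + fps_scale s a y"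
      by (simp add: fps_scale_def fps_eq_iff m.scale_right_distrib sum.distrib)
    show "fps_scale s (a + b) x = fps_scale s a x + fps_scale s b x"
      by (simp add: fps_scale_def fps_eq_iff m.scale_left_distrib sum.distrib)
    show "fps_scale s 1 x = x"
    proof (rule fps_ext)
      fix n
      have "(\<Sum>i\<le>n. s (fps_nth 1 i) (fps_nth x (n - i))) = (\<Sum>i\<in>{0}. s (fps_nth 1 i) (fps_nth x (n - i)))"
        by (intro sum.mono_neutral_right) auto
      then show "fps_nth (fps_scale s 1 x) n = fps_nth x n"
        by (simp add: fps_scale_def)
    qed
    show "fps_scale s a (fps_scale s b x) = fps_scale s (a * b) x"
    proof (rule fps_ext)
      fix n
      have "fps_nth (fps_scale s a (fps_scale s b x)) n
          = (\<Sum>i\<le>n. \<Sum>j\<le>n - i. s (fps_nth a i * fps_nth b j) (fps_nth x (n - (i + j))))"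
        by (simp add: fps_scale_def m.scale_sum_right diff_diff_left)
      also have "\<dots> = (\<Sum>(i, j)\<in>Sigma {..n} (\<lambda>i. {..n - i}). s (fps_nth a i * fps_nth b j) (fps_nth x (n - (i + j))))"
        by (simp add: sum.Sigma)
      also have "\<dots> = (\<Sum>(k, i)\<in>Sigma {..n} (\<lambda>k. {..k}). s (fps_nth a i * fps_nth b (k - i)) (fps_nth x (n - k)))"
        by (rule sum.reindex_bij_witness [where i = "\<lambda>(k, i). (i, k - i)" and j = "\<lambda>(i, j). (i + j, i)"]) auto
      also have "\<dots> = fps_nth (fps_scale s (a * b) x) n"
        by (simp add: fps_scale_def fps_mult_nth m.scale_sum_left sum.Sigma [symmetric] atMost_atLeast0)
      finally show "fps_nth (fps_scale s a (fps_scale s b x)) n = fps_nth (fps_scale s (a * b) x) n" .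
    qed
  qed
qed

lemma fps_scale_X_power_nth:
  assumes "module (s :: complex \<Rightarrow> 'v::ab_group_add \<Rightarrow> 'v)"
  shows "fps_nth (fps_scale s (fps_X ^ k) f) n = (if n < k then 0 else fps_nth f (n - k))"
proof -
  interpret m: module s by fact
  have "fps_nth (fps_scale s (fps_X ^ k) f) n = (\<Sum>i\<le>n. s (of_bool (i = k)) (fps_nth f (n - i)))"
    by (simp add: fps_scale_def fps_X_power_nth of_bool_def)
  also have "\<dots> = (\<Sum>i\<in>{..n} \<inter> {k}. s (of_bool (i = k)) (fps_nth f (n - i)))"
    by (intro sum.mono_neutral_right) auto
  also have "\<dots> = (if n < k then 0 else fps_nth f (n - k))"
    by (cases "n < k") auto
  finally show ?thesis .
qed

lemma hpow_fps_scale: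
  assumes "module (s :: complex \<Rightarrow> 'v::ab_group_add \<Rightarrow> 'v)"
  shows "f \<in> hpow (fps_scale s) k \<longleftrightarrow> (\<forall>n<k. fps_nth f n = 0)"
proof
  assume "\<forall>n<k. fps_nth f n = 0"
  then have "f = fps_scale s (fps_X ^ k) (Abs_fps (\<lambda>n. fps_nth f (n + k)))"
    by (auto simp: fps_eq_iff fps_scale_X_power_nth [OF assms])
  then show "f \<in> hpow (fps_scale s) k" unfolding hpow_def by blast
qed (auto simp: hpow_def fps_scale_X_power_nth [OF assms])

lemma hcomplete_fps_scale:
  assumes "module (s :: complex \<Rightarrow> 'v::ab_group_add \<Rightarrow> 'v)"
  shows "hcomplete (fps_scale s)"
proof -
  interpret module "fps_scale s" by (rule module_fps_scale) fact
  show ?thesis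
  proof
    fix x assume "\<And>k. x \<in> hpow (fps_scale s) k"
    then have "fps_nth x n = 0" for n
      unfolding hpow_fps_scale [OF assms] by blast
    then show "x = 0" by (simp add: fps_eq_iff)
  next
    fix f assume f: "\<And>k. f (Suc k) - f k \<in> hpow (fps_scale s) k"
    have eq: "fps_nth (f (k + j)) n = fps_nth (f k) n" if "n < k" for k j n
      using f that by (induction j) (auto simp: hpow_fps_scale [OF assms])
    have "fps_nth (f k) n = fps_nth (f (Suc n)) n" if "n < k" for k n
      using eq [of n "Suc n" "k - Suc n"] that by simp
    then have "Abs_fps (\<lambda>n. fps_nth (f (Suc n)) n) - f k \<in> hpow (fps_scale s) k" for k
      unfolding hpow_fps_scale [OF assms] fps_sub_nth fps_nth_Abs_fps by (metis eq_iff_diff_eq_0)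
    then show "\<exists>x. \<forall>k. x - f k \<in> hpow (fps_scale s) k" by blast
  qed
qed

lemma fps_scale_times: "fps_scale (*) = ((*) :: complex fps \<Rightarrow> _)"
  by (intro ext fps_ext) (simp add: fps_scale_def fps_mult_nth atMost_atLeast0)

interpretation series: hcomplete "(*) :: complex fps \<Rightarrow> complex fps \<Rightarrow> complex fps"
proof -
  have "module ((*) :: complex \<Rightarrow> complex \<Rightarrow> complex)"
    by standard (simp_all add: algebra_simps)
  from hcomplete_fps_scale [OF this] show "hcomplete ((*) :: complex fps \<Rightarrow> complex fps \<Rightarrow> complex fps)"
    by (simp add: fps_scale_times)
qed

text \<open>The isomorphism \<open>W \<cong> V\<^sub>0[[h]]\<close> turns \<open>h\<^sup>kW\<close> into the series that start in degree \<open>k\<close>.\<close>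

lemma hcomplete_topologically_free:
  assumes "topologically_free sc"
  shows "hcomplete sc"
proof -
  let ?s = "\<lambda>a. sc (fps_const a)"
  obtain V0 \<phi> where mod: "module sc" and sub: "module.subspace ?s V0"
    and bij: "bij_betw \<phi> {f. \<forall>n. fps_nth f n \<in> V0} UNIV"
    and add: "\<And>f g. (\<forall>n. fps_nth f n \<in> V0) \<Longrightarrow> (\<forall>n. fps_nth g n \<in> V0) \<Longrightarrow> \<phi> (f + g) = \<phi> f + \<phi> g"
    and sca: "\<And>c f. (\<forall>n. fps_nth f n \<in> V0) \<Longrightarrow> \<phi> (fps_scale ?s c f) = sc c (\<phi> f)"
    using assms unfolding topologically_free_def by blast
  interpret module sc by (rule mod)
  have smod: "module ?s"
    by standard (simp_all add: scale_right_distrib scale_left_distrib flip: fps_const_add)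
  interpret s: module ?s by (rule smod)
  define P where "P = {f. \<forall>n. fps_nth f n \<in> V0}"
  have P0: "0 \<in> P" using s.subspace_0 [OF sub] by (simp add: P_def)
  have Pdiff: "f - g \<in> P" if "f \<in> P" "g \<in> P" for f g
    using that s.subspace_diff [OF sub] by (simp add: P_def)
  have \<phi>diff: "\<phi> (f - g) = \<phi> f - \<phi> g" if "f \<in> P" "g \<in> P" for f g
    using add [of "f - g" g] that Pdiff [OF that] by (simp add: P_def)
  have \<phi>0: "\<phi> 0 = 0" using \<phi>diff [OF P0 P0] by simp
  have inj: "inj_on \<phi> P" using bij by (simp add: bij_betw_def P_def)
  have surj: "\<exists>f\<in>P. \<phi> f = x" for x
    using bij unfolding bij_betw_def P_def by (metis (no_types, lifting) UNIV_I imageE)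
  have hp: "\<phi> f \<in> hpow sc k \<longleftrightarrow> (\<forall>n<k. fps_nth f n = 0)" if f: "f \<in> P" for f k
  proof
    assume "\<phi> f \<in> hpow sc k"
    then obtain y where y: "\<phi> f = sc (fps_X ^ k) y" by (auto simp: hpow_def)
    obtain g where g: "g \<in> P" "\<phi> g = y" using surj by blast
    have "fps_scale ?s (fps_X ^ k) g \<in> P"
      using g s.subspace_0 [OF sub] by (auto simp: P_def fps_scale_X_power_nth [OF smod])
    moreover have "\<phi> f = \<phi> (fps_scale ?s (fps_X ^ k) g)"
      using y g sca by (simp add: P_def)
    ultimately have "f = fps_scale ?s (fps_X ^ k) g" using inj f by (metis inj_onD)
    then show "\<forall>n<k. fps_nth f n = 0" by (simp add: fps_scale_X_power_nth [OF smod])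
  next
    assume *: "\<forall>n<k. fps_nth f n = 0"
    define g where "g = Abs_fps (\<lambda>n. fps_nth f (n + k))"
    have "g \<in> P" using f by (simp add: g_def P_def)
    moreover have "f = fps_scale ?s (fps_X ^ k) g"
      using * by (auto simp: fps_eq_iff fps_scale_X_power_nth [OF smod] g_def)
    ultimately show "\<phi> f \<in> hpow sc k" using sca by (auto simp: P_def hpow_def)
  qed
  show ?thesis
  proof
    fix x assume x: "\<And>k. x \<in> hpow sc k"
    obtain f where "f \<in> P" "\<phi> f = x" using surj by blast
    then have "fps_nth f n = 0" for n using hp x by blast
    then have "f = 0" by (simp add: fps_eq_iff)
    then show "x = 0" using \<open>\<phi> f = x\<close> \<phi>0 by simp
  next
    fix x assume x: "\<And>k. x (Suc k) - x k \<in> hpow sc k"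
    have "\<exists>f. \<forall>k. f k \<in> P \<and> \<phi> (f k) = x k" using surj by (intro choice) blast
    then obtain f where f: "\<And>k. f k \<in> P" "\<And>k. \<phi> (f k) = x k" by blast
    have "f (Suc k) - f k \<in> hpow (fps_scale ?s) k" for k
      using hp [OF Pdiff [OF f(1) f(1)]] x f \<phi>diff by (simp add: hpow_fps_scale [OF smod])
    then obtain y where y: "\<And>k. y - f k \<in> hpow (fps_scale ?s) k"
      using hcomplete.complete [OF hcomplete_fps_scale [OF smod]] by blast
    have "fps_nth y n = fps_nth (f (Suc n)) n" for n
      using y [of "Suc n"] by (simp add: hpow_fps_scale [OF smod])
    then have yP: "y \<in> P" using f(1) by (simp add: P_def)
    have "\<phi> y - x k \<in> hpow sc k" for k
      using y [of k] hp [OF Pdiff [OF yP f(1)]] \<phi>diff [OF yP f(1)] f(2)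
      by (simp add: hpow_fps_scale [OF smod])
    then show "\<exists>z. \<forall>k. z - x k \<in> hpow sc k" by blast
  qed
qed

section \<open>Matrix-valued series in \<open>h/u\<close> acting on Taylor series\<close>

abbreviation ix :: "nat \<Rightarrow> ('n list \<times> int list) set" where
  "ix n \<equiv> {(K, d). length K = n \<and> length d = n}"

text \<open>
  A product of factors \<open>R\<^bsub>0j\<^esub>(x\<^sub>0 - x\<^sub>j)\<close> is a series in \<open>h/x\<^sub>0\<close> and \<open>x\<^sub>m/x\<^sub>0\<close>, \<open>m \<ge> 1\<close>: its terms of
  total degree \<open>-k\<close> carry the factor \<open>h\<^sup>k\<close>. Such a series may be multiplied by any series without
  negative powers of the \<open>x\<^sub>m\<close>, \<open>m \<ge> 1\<close>: modulo \<open>h\<^sup>k\<close> only finitely many terms contribute to a given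
  coefficient.
\<close>

definition tame :: "nat \<Rightarrow> ('n, complex fps) mser \<Rightarrow> bool" where
  "tame n M \<longleftrightarrow> (\<forall>I J d. length d = n \<longrightarrow>
     (M I J d \<noteq> 0 \<longrightarrow> (\<forall>m\<in>{1..<n}. 0 \<le> d ! m) \<and> sum_list d \<le> 0) \<and>
     fps_X ^ nat (- sum_list d) dvd M I J d)"

definition taylor :: "nat \<Rightarrow> ('n, 'x::zero) mser \<Rightarrow> bool" where
  "taylor n X \<longleftrightarrow> (\<forall>I J e. length e = n \<longrightarrow> (\<exists>m\<in>{1..<n}. e ! m < 0) \<longrightarrow> X I J e = 0)"

lemma tame_support:
  "tame n M \<Longrightarrow> length d = n \<Longrightarrow> M I J d \<noteq> 0 \<Longrightarrow> (\<forall>m\<in>{1..<n}. 0 \<le> d ! m) \<and> sum_list d \<le> 0"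
  unfolding tame_def by blast

lemma tame_dvd: "tame n M \<Longrightarrow> length d = n \<Longrightarrow> fps_X ^ nat (- sum_list d) dvd M I J d"
  unfolding tame_def by blast

lemma tame_taylor: "tame n M \<Longrightarrow> taylor n M"
  unfolding tame_def taylor_def by force

lemma sum_list_split_first:
  fixes d :: "int list"
  assumes "length d = n" "0 < n"
  shows "sum_list d = d ! 0 + (\<Sum>m = 1..<n. d ! m)"
  using assms by (simp add: sum_list_sum_nth sum.atLeast_Suc_lessThan)

lemma sum_list_map2_minus:
  fixes e d :: "int list"
  assumes "length e = length d"
  shows "sum_list (map2 (-) e d) = sum_list e - sum_list d"
  using assms by (induction e d rule: list_induct2) auto

text \<open>
  The exponents of \<open>x\<^sub>m\<close>, \<open>m \<ge> 1\<close>, and the total degree are bounded, hence so is the exponent of \<open>x\<^sub>0\<close>.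
\<close>

lemma finite_degree_window:
  fixes e :: "int list" and k :: nat
  assumes "0 < n"
  shows "finite {(K :: 'n::finite list, d). length K = n \<and> length d = n \<and>
      (\<forall>m\<in>{1..<n}. 0 \<le> d ! m \<and> d ! m \<le> e ! m) \<and> sum_list d \<le> 0 \<and> - int k < sum_list d}"
    (is "finite ?A")
proof -
  define B where "B = int k + (\<Sum>m = 1..<n. \<bar>e ! m\<bar>)"
  have "set d \<subseteq> {- B..B}"
    if d: "length d = n" "\<forall>m\<in>{1..<n}. 0 \<le> d ! m \<and> d ! m \<le> e ! m" "sum_list d \<le> 0" "- int k < sum_list d" for d
  proof
    fix x assume "x \<in> set d"
    then obtain m where m: "m < n" "x = d ! m" using d(1) by (auto simp: in_set_conv_nth)
    have s: "d ! 0 = sum_list d - (\<Sum>m = 1..<n. d ! m)"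
      using sum_list_split_first [OF d(1) assms] by simp
    have "(\<Sum>m = 1..<n. d ! m) \<le> (\<Sum>m = 1..<n. \<bar>e ! m\<bar>)" "0 \<le> (\<Sum>m = 1..<n. d ! m)"
      using d(2) by (auto intro!: sum_mono sum_nonneg dest: bspec)
    then have "d ! 0 \<in> {- B..B}" using s d(3,4) by (auto simp: B_def)
    moreover have "d ! m \<in> {- B..B}" if "m \<noteq> 0"
    proof -
      have "\<bar>e ! m\<bar> \<le> (\<Sum>m = 1..<n. \<bar>e ! m\<bar>)"
        using that m by (intro member_le_sum) auto
      moreover have "0 \<le> d ! m" "d ! m \<le> e ! m" using that m d(2) by auto
      ultimately show ?thesis by (auto simp: B_def)
    qed
    ultimately show "x \<in> {- B..B}" using m by (cases "m = 0") auto
  qed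
  then have "?A \<subseteq> {K. set K \<subseteq> UNIV \<and> length K = n} \<times> {d. set d \<subseteq> {- B..B} \<and> length d = n}"
    by auto
  moreover have "finite \<dots>" by (intro finite_cartesian_product finite_lists_length_eq) auto
  ultimately show ?thesis by (rule finite_subset)
qed

context hcomplete
begin

lemma lmul_has_hsum:
  fixes M :: "('n::finite, complex fps) mser"
  assumes M: "tame n M" and X: "taylor n X" and n: "0 < n" and e: "length e = n"
  shows "has_hsum sc (\<lambda>(K, d). sc (M I K d) (X K J (map2 (-) e d))) (ix n) (mser_lmul sc n M X I J e)"
proof -
  let ?f = "\<lambda>(K, d). sc (M I K d) (X K J (map2 (-) e d))"
  have "finite {i \<in> ix n. ?f i \<notin> hp k}" for k
  proof (rule finite_subset [OF _ finite_degree_window [OF n, of e k]], rule subsetI)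
    fix p assume p: "p \<in> {i \<in> ix n. ?f i \<notin> hp k}"
    then obtain K d where Kd: "p = (K, d)" "length K = n" and len: "length d = n"
      and f: "sc (M I K d) (X K J (map2 (-) e d)) \<notin> hp k" by auto
    then have nz: "M I K d \<noteq> 0" "X K J (map2 (-) e d) \<noteq> 0" by auto
    note supp = tame_support [OF M len nz(1)]
    have "- int k < sum_list d"
    proof (rule ccontr)
      assume "\<not> - int k < sum_list d"
      then have "k \<le> nat (- sum_list d)" by simp
      then have "fps_X ^ k dvd M I K d"
        using tame_dvd [OF M len] by (meson dvd_trans le_imp_power_dvd)
      then show False using f hp_scale_dvd by blast
    qed
    moreover have "d ! m \<le> e ! m" if m: "m \<in> {1..<n}" for m
    proof -
      have "\<not> map2 (-) e d ! m < 0"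
        using nz(2) X m e len unfolding taylor_def by (metis length_map length_zip min.idem)
      then show ?thesis using len m e by simp
    qed
    ultimately show "p \<in> {(K, d). length K = n \<and> length d = n \<and>
      (\<forall>m\<in>{1..<n}. 0 \<le> d ! m \<and> d ! m \<le> e ! m) \<and> sum_list d \<le> 0 \<and> - int k < sum_list d}"
      using supp Kd len by auto
  qed
  then obtain s where s: "has_hsum sc ?f (ix n) s" using has_hsum_exists by blast
  show ?thesis unfolding mser_lmul_def hsum_eq [OF s] by (rule s)
qed

end

lemma tame_mser_lmul:
  fixes M N :: "('n::finite, complex fps) mser"
  assumes M: "tame n M" and N: "tame n N" and n: "0 < n"
  shows "tame n (mser_lmul (*) n M N)"
  unfolding tame_def
proof (intro allI impI conjI)
  fix I J :: "'n list" and e :: "int list" assume e: "length e = n"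
  note sum = series.lmul_has_hsum [OF M tame_taylor [OF N] n e, of I J]
  have "series.hp (nat (- sum_list e)) = {x. fps_X ^ nat (- sum_list e) dvd x}" for e
    by (auto simp: series.hp_iff dvd_def)
  moreover have "fps_X ^ nat (- sum_list e) dvd M I K d * N K J (map2 (-) e d)"
    if "length d = n" for K d
  proof (cases "M I K d = 0 \<or> N K J (map2 (-) e d) = 0")
    case False
    have len: "length (map2 (-) e d) = n" using e that by simp
    have sl: "sum_list (map2 (-) e d) = sum_list e - sum_list d"
      using e that by (simp add: sum_list_map2_minus)
    have "sum_list d \<le> 0" "sum_list e - sum_list d \<le> 0"
      using False tame_support [OF M that, of I K] tame_support [OF N len, of K J] sl by simp_all
    then have "nat (- sum_list e) = nat (- sum_list d) + nat (- sum_list (map2 (-) e d))"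
      using sl by (simp add: nat_add_distrib [symmetric])
    then show ?thesis
      using tame_dvd [OF M that] tame_dvd [OF N len] by (simp add: power_add mult_dvd_mono)
  qed auto
  ultimately show "fps_X ^ nat (- sum_list e) dvd mser_lmul (*) n M N I J e"
    using series.has_hsum_closed [OF sum, of "nat (- sum_list e)"] by auto
  have "mser_lmul (*) n M N I J e = 0" if no: "\<not> ((\<forall>m\<in>{1..<n}. 0 \<le> e ! m) \<and> sum_list e \<le> 0)"
  proof -
    have "M I K d * N K J (map2 (-) e d) = 0" if d: "length d = n" for K d
    proof (rule ccontr)
      assume "M I K d * N K J (map2 (-) e d) \<noteq> 0"
      moreover have len: "length (map2 (-) e d) = n" using e d by simp
      ultimately have *: "(\<forall>m\<in>{1..<n}. 0 \<le> d ! m) \<and> sum_list d \<le> 0"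
        "(\<forall>m\<in>{1..<n}. 0 \<le> map2 (-) e d ! m) \<and> sum_list (map2 (-) e d) \<le> 0"
        using tame_support [OF M d, of I K] tame_support [OF N len, of K J] by auto
      have "0 \<le> e ! m" if "m \<in> {1..<n}" for m
        using bspec [OF conjunct1 [OF *(1)] that] bspec [OF conjunct1 [OF *(2)] that] e d that by simp
      then have "(\<forall>m\<in>{1..<n}. 0 \<le> e ! m) \<and> sum_list e \<le> 0"
        using * e d by (simp add: sum_list_map2_minus)
      then show False using no by blast
    qed
    then have "has_hsum (*) (\<lambda>(K, d). M I K d * N K J (map2 (-) e d)) (ix n) 0"
      by (intro series.has_hsum_zero) auto
    then show ?thesis using sum series.has_hsum_unique by blast
  qed
  then show "mser_lmul (*) n M N I J e \<noteq> 0 \<Longrightarrow> \<forall>m\<in>{1..<n}. 0 \<le> e ! m"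
    "mser_lmul (*) n M N I J e \<noteq> 0 \<Longrightarrow> sum_list e \<le> 0"
    by blast+
qed

lemma (in hseparated) mser_lmul_one:
  assumes "length I = n" "length e = n"
  shows "mser_lmul sc n (mser_one n) X I J e = X I J e"
proof -
  have "has_hsum sc (\<lambda>(K, d). sc (mser_one n I K d) (X K J (map2 (-) e d))) (ix n)
      (sum (\<lambda>(K, d). sc (mser_one n I K d) (X K J (map2 (-) e d))) {(I, replicate n 0)})"
  proof (rule has_hsum_finite)
    fix p assume "p \<in> ix n - {(I, replicate n 0)}"
    then obtain K d where "p = (K, d)" "\<not> (I = K \<and> d = replicate n 0)" by auto
    then show "(case p of (K, d) \<Rightarrow> sc (mser_one n I K d) (X K J (map2 (-) e d))) = 0"
      by (simp only: mser_one_def of_bool_eq scale_zero_left split_conv)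
  qed (use assms in auto)
  moreover have "map2 (-) e (replicate n 0) = e"
    using assms by (auto intro: nth_equalityI)
  ultimately show ?thesis
    unfolding mser_lmul_def using hsum_eq by (simp add: mser_one_def)
qed

lemma mser_mult_one:
  assumes "length J = n" "length e = n"
  shows "mser_lmul (*) n M (mser_one n) I J e = M I J e"
proof -
  have *: "map2 (-) e d = replicate n 0 \<longleftrightarrow> d = e" if "length d = n" for d
    using assms that by (auto simp: list_eq_iff_nth_eq)
  have "has_hsum (*) (\<lambda>(K, d). M I K d * mser_one n K J (map2 (-) e d)) (ix n)
      (sum (\<lambda>(K, d). M I K d * mser_one n K J (map2 (-) e d)) {(J, e)})"
    using assms * by (intro series.has_hsum_finite) (auto simp: mser_one_def)
  moreover have "map2 (-) e e = replicate n 0" using * assms by blast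
  ultimately show ?thesis
    unfolding mser_lmul_def using series.hsum_eq by (simp add: mser_one_def)
qed

lemma tame_mser_one: "tame n (mser_one n)"
  by (auto simp: tame_def mser_one_def sum_list_replicate)

text \<open>
  Transposition reduces multiplication from the right to multiplication from the left.
\<close>

lemma mser_rmul_transpose:
  "mser_rmul sc n X M I J e = mser_lmul sc n (\<lambda>I J. M J I) (\<lambda>I J. X J I) J I e"
  unfolding mser_lmul_def mser_rmul_def ..

subsection \<open>Multiplication by linear forms\<close>

text \<open>Multiplication of a series by \<open>s x\<^sub>i + t x\<^sub>j + c\<close>.\<close>

definition lin_mult ::
    "(complex fps \<Rightarrow> 'x \<Rightarrow> 'x) \<Rightarrow> complex \<Rightarrow> complex \<Rightarrow> complex fps \<Rightarrow> nat \<Rightarrow> nat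
      \<Rightarrow> ('n, 'x::ab_group_add) mser \<Rightarrow> ('n, 'x) mser" where
  "lin_mult sc s t c i j X I J e =
     sc (fps_const s) (X I J (e[i := e ! i - 1])) + sc (fps_const t) (X I J (e[j := e ! j - 1]))
     + sc c (X I J e)"

lemma bij_betw_shift:
  "i < n \<Longrightarrow> bij_betw (\<lambda>(K, d). (K, d[i := d ! i + (1::int)])) (ix n) (ix n)"
  by (rule bij_betw_byWitness [where f' = "\<lambda>(K, d). (K, d[i := d ! i - 1])"]) auto

lemma map2_minus_shift:
  fixes e d :: "int list"
  assumes "length e = n" "length d = n" "i < n"
  shows "map2 (-) e (d[i := d ! i + 1]) = map2 (-) (e[i := e ! i - 1]) d"
  using assms by (intro nth_equalityI) (auto simp: nth_list_update)

context hcomplete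
begin

lemma module_hom_scale: "module_hom sc sc (sc c)"
  by (simp add: module_hom_def module_hom_axioms_def module_axioms scale_right_distrib mult.commute)

lemma has_hsum_scale: "has_hsum sc f S s \<Longrightarrow> has_hsum sc (\<lambda>i. sc c (f i)) S (sc c s)"
  by (rule has_hsum_hom [OF module_hom_scale])

lemma shift_has_hsum:
  fixes M :: "('n::finite, complex fps) mser"
  assumes M: "tame n M" and X: "taylor n X" and n: "i < n" and e: "length e = n"
  shows "has_hsum sc (\<lambda>(K, d). sc (M I K (d[i := d ! i - 1])) (X K J (map2 (-) e d))) (ix n)
      (mser_lmul sc n M X I J (e[i := e ! i - 1]))"
proof -
  have "has_hsum sc (\<lambda>(K, d). sc (M I K d) (X K J (map2 (-) (e[i := e ! i - 1]) d))) (ix n)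
      (mser_lmul sc n M X I J (e[i := e ! i - 1]))"
    using n e by (intro lmul_has_hsum M X) auto
  then show ?thesis
    unfolding has_hsum_reindex [OF bij_betw_shift [OF n], of sc "\<lambda>(K, d). sc (M I K (d[i := d ! i - 1])) (X K J (map2 (-) e d))"]
    by (rule iffD1 [OF has_hsum_cong, rotated]) (use e n in \<open>auto simp: map2_minus_shift\<close>)
qed

lemma lin_mult_has_hsum:
  fixes M :: "('n::finite, complex fps) mser"
  assumes M: "tame n M" and X: "taylor n X" and n: "i < n" "j < n" and e: "length e = n"
  shows "has_hsum sc (\<lambda>(K, d). sc (lin_mult (*) s t c i j M I K d) (X K J (map2 (-) e d))) (ix n)
    (lin_mult sc s t c i j (mser_lmul sc n M X) I J e)"
proof -
  have "has_hsum sc (\<lambda>p. sc (fps_const s) (case p of (K, d) \<Rightarrow> sc (M I K (d[i := d ! i - 1])) (X K J (map2 (-) e d)))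
        + sc (fps_const t) (case p of (K, d) \<Rightarrow> sc (M I K (d[j := d ! j - 1])) (X K J (map2 (-) e d)))
        + sc c (case p of (K, d) \<Rightarrow> sc (M I K d) (X K J (map2 (-) e d)))) (ix n)
      (lin_mult sc s t c i j (mser_lmul sc n M X) I J e)"
    unfolding lin_mult_def
    using n e by (intro has_hsum_add has_hsum_scale shift_has_hsum lmul_has_hsum M X) auto
  then show ?thesis
    by (rule iffD1 [OF has_hsum_cong, rotated]) (auto simp: lin_mult_def scale_left_distrib)
qed

lemma lin_mult_lmul:
  fixes M :: "('n::finite, complex fps) mser"
  assumes "tame n M" "taylor n X" "i < n" "j < n" "length e = n"
  shows "lin_mult sc s t c i j (mser_lmul sc n M X) I J e = mser_lmul sc n (lin_mult (*) s t c i j M) X I J e"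
  using hsum_eq [OF lin_mult_has_hsum [OF assms]]
  unfolding mser_lmul_def [of sc n "lin_mult (*) s t c i j M"] by (rule sym)

lemma lmul_add:
  fixes M N :: "('n::finite, complex fps) mser"
  assumes "has_hsum sc (\<lambda>(K, d). sc (M I K d) (X K J (map2 (-) e d))) (ix n) x"
    "has_hsum sc (\<lambda>(K, d). sc (N I K d) (X K J (map2 (-) e d))) (ix n) y"
  shows "mser_lmul sc n (\<lambda>I K d. M I K d + N I K d) X I J e = x + y"
proof -
  have "has_hsum sc (\<lambda>(K, d). sc (M I K d + N I K d) (X K J (map2 (-) e d))) (ix n) (x + y)"
    using has_hsum_add [OF assms]
    by (rule iffD1 [OF has_hsum_cong, rotated]) (auto simp: scale_left_distrib)
  then show ?thesis unfolding mser_lmul_def using hsum_eq by auto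
qed

end

subsection \<open>The factors \<open>R\<^bsub>ij\<^esub>\<close>\<close>

text \<open>
  \<open>(s x + t y) (s x + t y)\<^sup>m = (s x + t y)\<^bsup>m+1\<^esup>\<close>, where both powers are expanded in the same region.
\<close>

lemma binexp_Pascal:
  assumes "s \<noteq> 0"
  shows "s * binexp s t m (a - 1) b + t * binexp s t m a (b - 1) = binexp s t (m + 1) a b"
proof (cases "a + b = m + 1 \<and> 0 \<le> b")
  case True
  have powi: "s * s powi (a - 1) = s powi a"
    using assms power_int_add [of s 1 "a - 1"] by simp
  show ?thesis
  proof (cases "b = 0")
    case True
    then show ?thesis using \<open>a + b = m + 1 \<and> 0 \<le> b\<close> powi by (simp add: binexp_def)
  next
    case False
    then obtain k where k: "b = int (Suc k)"
      using True by (metis gr0_implies_Suc int_nat_eq nonneg_int_cases of_nat_0_less_iff order_le_less zero_less_imp_eq_int)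
    have "(of_int (m + 1) :: complex) gchoose Suc k = (of_int m gchoose k) + (of_int m gchoose Suc k)"
      using gbinomial_Suc_Suc [of "of_int m :: complex" k] by simp
    moreover have "nat (b - 1) = k" "nat b = Suc k" using k by auto
    ultimately show ?thesis
      using True k powi by (simp add: binexp_def algebra_simps flip: powi)
  qed
qed (auto simp: binexp_def)

lemma binexp_0: "binexp s t 0 a b = of_bool (a = 0 \<and> b = 0)"
proof (cases "b = 0")
  case False
  then have "0 < b \<Longrightarrow> (0 :: complex) gchoose nat b = 0"
    by (cases "nat b") auto
  then show ?thesis using False by (auto simp: binexp_def)
qed (auto simp: binexp_def)

lemma binexp_1: "s \<noteq> 0 \<Longrightarrow> binexp s t 1 a b = s * of_bool (a = 1 \<and> b = 0) + t * of_bool (a = 0 \<and> b = 1)"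
  using binexp_Pascal [of s t 0 a b] by (simp add: binexp_0)

lemma fps_const_combine:
  "fps_const s * (fps_const u * Z) + fps_const t * (fps_const v * Z) = fps_const (s * u + t * v) * Z"
  for Z :: "complex fps"
  by (rule fps_ext) (simp only: fps_add_nth fps_mult_left_const_nth distrib_right mult.assoc)

lemma fps_of_bool_split:
  fixes D E :: "complex fps"
  assumes "\<not> (A \<and> B)"
  shows "fps_const (s * of_bool A + t * of_bool B) * of_bool C + of_bool Z * D * E * of_bool S
    = fps_const s * of_bool (C \<and> A) + fps_const t * of_bool (C \<and> B) + D * E * of_bool (S \<and> Z)"
  using assms by (cases A; cases B; cases C; cases Z; cases S) simp_all

text \<open>
  If \<open>c\<^sub>k\<close> are the coefficients of the series \<open>R\<close> in \<open>h/u\<close>, then multiplication by \<open>s x + t y + \<kappa> h\<close>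
  replaces \<open>c\<^sub>k\<close> by \<open>c\<^sub>k + \<kappa> c\<^bsub>k-1\<^esub>\<close> and raises the power of \<open>s x + t y\<close> by one. By assumption only the terms
  with \<open>k \<le> 1\<close> remain.
\<close>

lemma R_coeff_linear:
  fixes Rm :: "'n::finite rmat"
  assumes s: "s \<noteq> 0"
    and Rm: "(1 + fps_const \<kappa> * fps_X) * Rm $ p $ q = of_bool (p = q) + fps_const \<delta> * fps_X * Pmat $ p $ q"
  shows "fps_const s * R_coeff Rm s t (a - 1) b p q + fps_const t * R_coeff Rm s t a (b - 1) p q
      + fps_const \<kappa> * fps_X * R_coeff Rm s t a b p q
    = fps_const (s * of_bool (a = 1 \<and> b = 0) + t * of_bool (a = 0 \<and> b = 1)) * of_bool (p = q)
      + of_bool (a = 0 \<and> b = 0) * fps_const \<delta> * fps_X * Pmat $ p $ q"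
proof -
  define c where "c k = fps_nth (Rm $ p $ q) k" for k
  have P01: "Pmat $ p $ q = fps_const (of_bool (p = prod.swap q))"
    by (simp add: Pmat_def)
  have "fps_nth ((1 + fps_const \<kappa> * fps_X) * Rm $ p $ q) k = c k + (if k = 0 then 0 else \<kappa> * c (k - 1))" for k
    unfolding distrib_right mult.assoc fps_add_nth fps_mult_left_const_nth fps_X_mult_nth mult_1_left c_def
    by simp
  moreover have "fps_nth (of_bool (p = q) + fps_const \<delta> * fps_X * Pmat $ p $ q) k
      = of_bool (k = 0 \<and> p = q) + \<delta> * of_bool (k = 1 \<and> p = prod.swap q)" for k
    unfolding P01 mult.assoc fps_add_nth fps_mult_left_const_nth fps_X_mult_nth fps_nth_fps_const
    by (cases "p = q"; cases "p = prod.swap q"; cases k) auto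
  ultimately have c: "c k + (if k = 0 then 0 else \<kappa> * c (k - 1))
      = of_bool (k = 0 \<and> p = q) + \<delta> * of_bool (k = 1 \<and> p = prod.swap q)" for k
    using Rm by metis
  consider "a + b > 1" | "a + b = 1" | "a + b < 1" by linarith
  then show ?thesis
  proof cases
    case 1
    then show ?thesis by (auto simp: R_coeff_def)
  next
    case 2
    have n: "a - 1 + b = 0" "a + (b - 1) = 0" using 2 by auto
    have R: "R_coeff Rm s t (a - 1) b p q = fps_const (c 0 * binexp s t 0 (a - 1) b) * 1"
      "R_coeff Rm s t a (b - 1) p q = fps_const (c 0 * binexp s t 0 a (b - 1)) * 1"
      "R_coeff Rm s t a b p q = 0"
      using 2 unfolding R_coeff_def n by (simp_all add: c_def)
    have "s * (c 0 * binexp s t 0 (a - 1) b) + t * (c 0 * binexp s t 0 a (b - 1)) = c 0 * binexp s t 1 a b"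
      using arg_cong [where f = "(*) (c 0)", OF binexp_Pascal [OF s, of t 0 a b]]
      by (simp only: distrib_left mult.left_commute add_0)
    moreover have "c 0 = of_bool (p = q)" using c [of 0] by simp
    moreover have "\<not> (a = 0 \<and> b = 0)" using 2 by auto
    ultimately show ?thesis
      unfolding R fps_const_combine by (simp add: binexp_1 [OF s])
  next
    case 3
    define k where "k = nat (1 - (a + b))"
    have k: "a + b = 1 - int k" "0 < k" using 3 by (auto simp: k_def)
    have R: "R_coeff Rm s t (a - 1) b p q = fps_const (c k * binexp s t (- int k) (a - 1) b) * fps_X ^ k"
      "R_coeff Rm s t a (b - 1) p q = fps_const (c k * binexp s t (- int k) a (b - 1)) * fps_X ^ k"
      "R_coeff Rm s t a b p q = fps_const (c (k - 1) * binexp s t (1 - int k) a b) * fps_X ^ (k - 1)"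
    proof -
      have n: "nat (- (a - 1 + b)) = k" "nat (- (a + (b - 1))) = k" "nat (- (a + b)) = k - 1"
        "a - 1 + b = - int k" "a + (b - 1) = - int k" using k by auto
      show "R_coeff Rm s t (a - 1) b p q = fps_const (c k * binexp s t (- int k) (a - 1) b) * fps_X ^ k"
        unfolding R_coeff_def n(1) c_def unfolding n(4) by simp
      show "R_coeff Rm s t a (b - 1) p q = fps_const (c k * binexp s t (- int k) a (b - 1)) * fps_X ^ k"
        unfolding R_coeff_def n(2) c_def unfolding n(5) by simp
      show "R_coeff Rm s t a b p q = fps_const (c (k - 1) * binexp s t (1 - int k) a b) * fps_X ^ (k - 1)"
        unfolding R_coeff_def n(3) c_def unfolding k(1) using k(2) by simp
    qed
    have X: "fps_X * (u * fps_X ^ (k - 1)) = u * fps_X ^ k" for u :: "complex fps"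
      using k(2) by (cases k) (simp_all add: mult.left_commute)
    have "s * (c k * binexp s t (- int k) (a - 1) b) + t * (c k * binexp s t (- int k) a (b - 1))
        = c k * binexp s t (1 - int k) a b"
      using arg_cong [where f = "(*) (c k)", OF binexp_Pascal [OF s, of t "- int k" a b]]
      by (simp only: distrib_left mult.left_commute uminus_add_conv_diff)
    then have "fps_const s * R_coeff Rm s t (a - 1) b p q + fps_const t * R_coeff Rm s t a (b - 1) p q
        + fps_const \<kappa> * fps_X * R_coeff Rm s t a b p q
      = fps_const (c k * binexp s t (1 - int k) a b) * fps_X ^ k
        + fps_const \<kappa> * (fps_const (c (k - 1) * binexp s t (1 - int k) a b) * fps_X ^ k)"
      unfolding R fps_const_combine mult.assoc X by simp
    also have "\<dots> = fps_const ((c k + \<kappa> * c (k - 1)) * binexp s t (1 - int k) a b) * fps_X ^ k"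
      using fps_const_combine [of 1 "c k * binexp s t (1 - int k) a b" "fps_X ^ k" \<kappa>]
      by (simp only: distrib_right mult.assoc mult_1_left fps_const_1_eq_1)
    also have "c k + \<kappa> * c (k - 1) = \<delta> * of_bool (k = 1 \<and> p = prod.swap q)"
      using c [of k] k(2) by simp
    also have "fps_const (\<delta> * of_bool (k = 1 \<and> p = prod.swap q) * binexp s t (1 - int k) a b) * fps_X ^ k
      = of_bool (a = 0 \<and> b = 0) * fps_const \<delta> * fps_X * Pmat $ p $ q"
    proof (cases "k = 1")
      case True
      then show ?thesis
        unfolding P01 by (cases "p = prod.swap q"; cases "a = 0 \<and> b = 0") (simp_all add: binexp_0)
    next
      case False
      then have "\<not> (a = 0 \<and> b = 0)" using k by auto
      then show ?thesis using False by auto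
    qed
    finally show ?thesis using 3 by auto
  qed
qed

definition unit_exp :: "nat \<Rightarrow> nat \<Rightarrow> int list" where
  "unit_exp n i = (replicate n 0)[i := 1]"

definition swap_at :: "nat \<Rightarrow> nat \<Rightarrow> 'a list \<Rightarrow> 'a list" where
  "swap_at i j I = I[i := I ! j, j := I ! i]"

lemma lin_mult_R_at:
  fixes Rm :: "'n::finite rmat"
  assumes s: "s \<noteq> 0"
    and Rm: "\<And>p q. (1 + fps_const \<kappa> * fps_X) * Rm $ p $ q = of_bool (p = q) + fps_const \<delta> * fps_X * Pmat $ p $ q"
    and ij: "i < n" "j < n" "i \<noteq> j" and len: "length I = n" "length K = n" "length d = n"
  shows "lin_mult (*) s t (fps_const \<kappa> * fps_X) i j (R_at Rm s t n i j) I K d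
    = fps_const s * of_bool (K = I \<and> d = unit_exp n i) + fps_const t * of_bool (K = I \<and> d = unit_exp n j)
      + fps_const \<delta> * fps_X * of_bool (K = swap_at i j I \<and> d = replicate n 0)"
proof -
  define off where "off \<longleftrightarrow> (\<forall>m<n. m \<noteq> i \<and> m \<noteq> j \<longrightarrow> I ! m = K ! m \<and> d ! m = 0)"
  have d: "d = unit_exp n i \<longleftrightarrow> (\<forall>m<n. m \<noteq> i \<and> m \<noteq> j \<longrightarrow> d ! m = 0) \<and> d ! i = 1 \<and> d ! j = 0"
    "d = unit_exp n j \<longleftrightarrow> (\<forall>m<n. m \<noteq> i \<and> m \<noteq> j \<longrightarrow> d ! m = 0) \<and> d ! i = 0 \<and> d ! j = 1"
    "d = replicate n 0 \<longleftrightarrow> (\<forall>m<n. m \<noteq> i \<and> m \<noteq> j \<longrightarrow> d ! m = 0) \<and> d ! i = 0 \<and> d ! j = 0"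
    using ij len by (auto simp: unit_exp_def list_eq_iff_nth_eq nth_list_update)
  have K: "K = I \<longleftrightarrow> (\<forall>m<n. m \<noteq> i \<and> m \<noteq> j \<longrightarrow> I ! m = K ! m) \<and> I ! i = K ! i \<and> I ! j = K ! j"
    "K = swap_at i j I \<longleftrightarrow> (\<forall>m<n. m \<noteq> i \<and> m \<noteq> j \<longrightarrow> I ! m = K ! m) \<and> I ! i = K ! j \<and> I ! j = K ! i"
    using ij len by (auto simp: swap_at_def list_eq_iff_nth_eq nth_list_update)
  show ?thesis
  proof (cases off)
    case False
    then have "\<not> (K = I \<and> d = unit_exp n i)" "\<not> (K = I \<and> d = unit_exp n j)" "\<not> (K = swap_at i j I \<and> d = replicate n 0)"
      unfolding off_def d K by blast+
    moreover have "lin_mult (*) s t (fps_const \<kappa> * fps_X) i j (R_at Rm s t n i j) I K d = 0"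
    proof -
      obtain m where "m < n" "m \<noteq> i" "m \<noteq> j" "\<not> (I ! m = K ! m \<and> d ! m = 0)"
        using False by (auto simp: off_def)
      then have "R_at Rm s t n i j I K (d[i := x]) = 0" "R_at Rm s t n i j I K (d[j := x]) = 0" "R_at Rm s t n i j I K d = 0" for x
        unfolding R_at_def by auto
      then show ?thesis by (simp add: lin_mult_def)
    qed
    ultimately show ?thesis by auto
  next
    case True
    have R: "R_at Rm s t n i j I K (d[i := d ! i - 1]) = R_coeff Rm s t (d ! i - 1) (d ! j) (I ! i, I ! j) (K ! i, K ! j)"
      "R_at Rm s t n i j I K (d[j := d ! j - 1]) = R_coeff Rm s t (d ! i) (d ! j - 1) (I ! i, I ! j) (K ! i, K ! j)"
      "R_at Rm s t n i j I K d = R_coeff Rm s t (d ! i) (d ! j) (I ! i, I ! j) (K ! i, K ! j)"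
      using True ij len unfolding off_def R_at_def by (auto simp: nth_list_update)
    have P: "Pmat $ (I ! i, I ! j) $ (K ! i, K ! j) = of_bool (I ! i = K ! j \<and> I ! j = K ! i)"
      by (simp add: Pmat_def)
    have "K = I \<and> d = unit_exp n i \<longleftrightarrow> (I ! i, I ! j) = (K ! i, K ! j) \<and> d ! i = 1 \<and> d ! j = 0"
      "K = I \<and> d = unit_exp n j \<longleftrightarrow> (I ! i, I ! j) = (K ! i, K ! j) \<and> d ! i = 0 \<and> d ! j = 1"
      "K = swap_at i j I \<and> d = replicate n 0 \<longleftrightarrow> I ! i = K ! j \<and> I ! j = K ! i \<and> d ! i = 0 \<and> d ! j = 0"
      using True unfolding off_def d K by auto
    then show ?thesis
      unfolding lin_mult_def R R_coeff_linear [OF s Rm] P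
      by (subst fps_of_bool_split) simp_all
  qed
qed

text \<open>
  The heart of the matter: after multiplication by the denominator, \<open>R\<^bsub>ij\<^esub>(s x\<^sub>i + t x\<^sub>j)\<close> acts as
  the polynomial \<open>s x\<^sub>i + t x\<^sub>j + \<delta> h P\<^bsub>ij\<^esub>\<close>, whatever the direction of expansion.
\<close>

lemma (in hseparated) lmul_lin_mult_R_at:
  fixes Rm :: "'n::finite rmat" and X :: "('n, 'w) mser"
  assumes s: "s \<noteq> 0"
    and Rm: "\<And>p q. (1 + fps_const \<kappa> * fps_X) * Rm $ p $ q = of_bool (p = q) + fps_const \<delta> * fps_X * Pmat $ p $ q"
    and ij: "i < n" "j < n" "i \<noteq> j" and len: "length I = n" "length e = n"
  shows "mser_lmul sc n (lin_mult (*) s t (fps_const \<kappa> * fps_X) i j (R_at Rm s t n i j)) X I J e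
    = lin_mult sc s t 0 i j X I J e + sc (fps_const \<delta> * fps_X) (X (swap_at i j I) J e)"
proof -
  let ?Z = "lin_mult (*) s t (fps_const \<kappa> * fps_X) i j (R_at Rm s t n i j)"
  let ?f = "\<lambda>(K, d). sc (?Z I K d) (X K J (map2 (-) e d))"
  let ?F = "{(I, unit_exp n i), (I, unit_exp n j), (swap_at i j I, replicate n 0)}"
  have ne: "unit_exp n i \<noteq> unit_exp n j" "unit_exp n i \<noteq> replicate n 0" "unit_exp n j \<noteq> replicate n 0"
    using ij by (auto simp: unit_exp_def list_eq_iff_nth_eq nth_list_update)
  have lu: "length (unit_exp n i) = n" "length (unit_exp n j) = n" "length (swap_at i j I) = n"
    using len by (auto simp: unit_exp_def swap_at_def)
  note Z = lin_mult_R_at [OF s Rm ij len(1)]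
  have "has_hsum sc ?f (ix n) (sum ?f ?F)"
  proof (rule has_hsum_finite)
    show "?F \<subseteq> ix n" using lu len by auto
    fix p assume "p \<in> ix n - ?F"
    then obtain K d where Kd: "p = (K, d)" "length K = n" "length d = n"
      "\<not> (K = I \<and> d = unit_exp n i)" "\<not> (K = I \<and> d = unit_exp n j)" "\<not> (K = swap_at i j I \<and> d = replicate n 0)"
      by auto
    have "?Z I K d = 0" unfolding Z [OF Kd(2,3)]
      using Kd(4,5,6) by (simp only: of_bool_eq mult_zero_right add_0)
    then show "?f p = 0" by (simp add: Kd(1))
  qed auto
  moreover have "sum ?f ?F = lin_mult sc s t 0 i j X I J e + sc (fps_const \<delta> * fps_X) (X (swap_at i j I) J e)"
  proof -
    have m: "map2 (-) e (unit_exp n i) = e[i := e ! i - 1]" "map2 (-) e (unit_exp n j) = e[j := e ! j - 1]"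
      "map2 (-) e (replicate n 0) = e"
      using len ij by (auto simp: unit_exp_def nth_list_update intro!: nth_equalityI)
    have "?Z I I (unit_exp n i) = fps_const s" "?Z I I (unit_exp n j) = fps_const t"
      "?Z I (swap_at i j I) (replicate n 0) = fps_const \<delta> * fps_X"
      using ne ne [symmetric] len lu
      by (simp_all only: Z length_replicate simp_thms of_bool_eq mult_zero_right mult_1_right add_0 add_0_right)
    then show ?thesis
      using ne ne [symmetric] by (simp add: m lin_mult_def [where X = X] add.assoc)
  qed
  ultimately show ?thesis unfolding mser_lmul_def using hsum_eq by simp
qed

lemma tame_R_at:
  fixes Rm :: "'n::finite rmat"
  assumes j: "0 < j" "j < n"
  shows "tame n (R_at Rm s t n 0 j)"
  unfolding tame_def
proof (intro allI impI)
  fix I J :: "'n list" and d :: "int list" assume d: "length d = n"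
  let ?M = "R_at Rm s t n 0 j I J d"
  show "(?M \<noteq> 0 \<longrightarrow> (\<forall>m\<in>{1..<n}. 0 \<le> d ! m) \<and> sum_list d \<le> 0) \<and> fps_X ^ nat (- sum_list d) dvd ?M"
  proof (cases "?M = 0")
    case False
    then have off: "\<forall>m<n. m \<noteq> 0 \<and> m \<noteq> j \<longrightarrow> d ! m = 0"
      and M: "?M = R_coeff Rm s t (d ! 0) (d ! j) (I ! 0, I ! j) (J ! 0, J ! j)"
      by (auto simp: R_at_def split: if_splits)
    have "sum_list d = (\<Sum>m\<in>{0, j}. d ! m)"
      unfolding sum_list_sum_nth using d j off by (intro sum.mono_neutral_right) auto
    then have sum: "sum_list d = d ! 0 + d ! j" using j by simp
    have "0 \<le> d ! j" "d ! 0 + d ! j \<le> 0"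
      using False unfolding M R_coeff_def by (auto simp: binexp_def split: if_splits)
    moreover have "0 \<le> d ! m" if "m \<in> {1..<n}" for m
      using that off \<open>0 \<le> d ! j\<close> by (cases "m = j") auto
    moreover have "fps_X ^ nat (- sum_list d) dvd ?M"
      unfolding M sum R_coeff_def by auto
    ultimately show ?thesis using sum by auto
  qed auto
qed

lemma (in hcomplete) R_at_mult:
  fixes Rm :: "'n::finite rmat" and X :: "('n, 'w) mser"
  assumes s: "s \<noteq> 0"
    and Rm: "\<And>p q. (1 + fps_const \<kappa> * fps_X) * Rm $ p $ q = of_bool (p = q) + fps_const \<delta> * fps_X * Pmat $ p $ q"
    and j: "0 < j" "j < n" and X: "taylor n X" and len: "length I = n" "length e = n"
  shows "lin_mult sc s t (fps_const \<kappa> * fps_X) 0 j (mser_lmul sc n (R_at Rm s t n 0 j) X) I J e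
    = lin_mult sc s t 0 0 j X I J e + sc (fps_const \<delta> * fps_X) (X (swap_at 0 j I) J e)"
  using j len by (simp add: lin_mult_lmul [OF tame_R_at X] lmul_lin_mult_R_at [OF s Rm])

section \<open>The \<open>R\<close>-matrices and their inverses\<close>

text \<open>
  The sign \<open>\<epsilon>\<close> allows one to treat \<open>R\<^sup>+\<close> and \<open>R\<^sup>-\<close> simultaneously.
\<close>

definition signed_R :: "complex \<Rightarrow> 'n::finite rmat \<Rightarrow> bool" where
  "signed_R \<epsilon> R \<longleftrightarrow> \<epsilon> = 1 \<and> R = Rplus \<or> \<epsilon> = - 1 \<and> R = Rminus"

lemma one_sub_X_unit: "(1 - fps_const \<epsilon> * fps_X) * inverse (1 - fps_const \<epsilon> * fps_X) = (1 :: complex fps)"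
  by (rule inverse_mult_eq_1') simp

lemma signed_R_entry:
  assumes "signed_R \<epsilon> R"
  shows "R $ p $ q = inverse (1 - fps_const \<epsilon> * fps_X) * (of_bool (p = q) - fps_X * of_bool (p = prod.swap q))"
proof -
  have minus: "1 - fps_const (- 1) * fps_X = (1 + fps_X :: complex fps)" by (simp flip: fps_const_neg)
  from assms consider "\<epsilon> = 1" "R = Rplus" | "\<epsilon> = - 1" "R = Rminus"
    unfolding signed_R_def by blast
  then show ?thesis
  proof cases
    case 1
    then show ?thesis by (simp add: Rplus_def Rmat_def Pmat_def mat_def)
  next
    case 2
    show ?thesis unfolding 2 minus by (simp add: Rminus_def Rmat_def Pmat_def mat_def)
  qed
qed

lemma signed_R_denominator:
  assumes "signed_R \<epsilon> R"
  shows "(1 + fps_const (- \<epsilon>) * fps_X) * R $ p $ q = of_bool (p = q) + fps_const (- 1) * fps_X * Pmat $ p $ q"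
proof -
  have "(1 + fps_const (- \<epsilon>) * fps_X) = 1 - fps_const \<epsilon> * fps_X"
    by (simp add: flip: fps_const_neg)
  then have "(1 + fps_const (- \<epsilon>) * fps_X) * R $ p $ q = of_bool (p = q) - fps_X * of_bool (p = prod.swap q)"
    unfolding signed_R_entry [OF assms] mult.assoc [symmetric] using one_sub_X_unit by simp
  then show ?thesis by (simp add: Pmat_def flip: fps_const_neg)
qed

text \<open>Unitarity: \<open>(1 - P h/u) (1 + P h/u) = 1 - (h/u)\<^sup>2\<close>, as \<open>P\<^sup>2 = 1\<close>.\<close>

lemma swap_matrix_mult:
  fixes a b c :: "'r::comm_ring_1"
  shows "(\<chi> p q. a * (of_bool (p = q) + c * of_bool (p = prod.swap q)))
      ** (\<chi> p q. b * (of_bool (p = q) - c * of_bool (p = prod.swap q)))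
    = (\<chi> p q. a * b * (1 - c * c) * of_bool (p = (q :: 'n::finite \<times> 'n)))"
    (is "?A ** ?B = ?C")
proof (simp only: vec_eq_iff, intro allI)
  fix p q :: "'n \<times> 'n"
  have "(?A ** ?B) $ p $ q
      = (\<Sum>k\<in>UNIV. if p = k then a * ?B $ k $ q else 0) + (\<Sum>k\<in>UNIV. if k = prod.swap p then a * c * ?B $ k $ q else 0)"
    unfolding matrix_matrix_mult_def sum.distrib [symmetric]
    by (simp, intro sum.cong) (auto simp: algebra_simps)
  also have "\<dots> = a * ?B $ p $ q + a * c * ?B $ prod.swap p $ q"
    by simp
  also have "\<dots> = ?C $ p $ q"
    using inj_eq [OF inj_swap [of UNIV], of p q]
    by (cases "p = q"; cases "p = prod.swap q") (auto simp: algebra_simps)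
  finally show "(?A ** ?B) $ p $ q = ?C $ p $ q" .
qed

lemma matrix_inv_unique:
  fixes A B :: "'r::semiring_1 ^ 'm ^ 'm"
  assumes "A ** B = mat 1" "B ** A = mat 1"
  shows "matrix_inv A = B"
proof -
  have "A ** matrix_inv A = mat 1"
    unfolding matrix_inv_def by (rule someI2 [of _ B]) (use assms in auto)
  then have "B ** (A ** matrix_inv A) = B" by simp
  then show ?thesis by (simp add: matrix_mul_assoc assms)
qed

lemma difference_of_squares: "a * b * (1 - e * e) = ((1 - e) * a) * ((1 + e) * b)" for a b e :: "'r::comm_ring_1"
  by (simp add: algebra_simps)

lemma signed_R_inverse_denominator:
  fixes R :: "'n::finite rmat"
  assumes "signed_R \<epsilon> R"
  shows "(1 + fps_const \<epsilon> * fps_X) * matrix_inv R $ p $ q = of_bool (p = q) + fps_const 1 * fps_X * Pmat $ p $ q"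
proof -
  define E where "E = fps_const \<epsilon> * (fps_X :: complex fps)"
  define a where "a = inverse (1 - E)"
  define b where "b = inverse (1 + E)"
  define x where "x = (fps_X :: complex fps)"
  have nE: "fps_const (- \<epsilon>) * fps_X = - E" by (simp add: E_def flip: fps_const_neg)
  have "\<epsilon> * \<epsilon> = 1" using assms by (auto simp: signed_R_def)
  then have EE: "E * E = x * x"
    unfolding E_def x_def
    by (metis (no_types, opaque_lifting) fps_const_1_eq_1 fps_const_mult mult.assoc mult.commute mult_1_left)
  have aE: "(1 - E) * a = 1" unfolding E_def a_def by (rule one_sub_X_unit)
  have bE: "(1 + E) * b = 1" using one_sub_X_unit [of "- \<epsilon>"] unfolding nE diff_minus_eq_add b_def .
  have "a * b * (1 - x * x) = ((1 - E) * a) * ((1 + E) * b)"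
    unfolding EE [symmetric] by (rule difference_of_squares)
  then have ab: "a * b * (1 - x * x) = 1" unfolding aE bE by simp
  have R: "R = (\<chi> p q. a * (of_bool (p = q) - x * of_bool (p = prod.swap q)))"
    by (simp only: vec_eq_iff vec_lambda_beta signed_R_entry [OF assms] a_def E_def x_def simp_thms)
  let ?Q = "(\<chi> p q. b * (of_bool (p = q) + x * of_bool (p = prod.swap q))) :: 'n rmat"
  have one: "(\<chi> p q. of_bool (p = q)) = (mat 1 :: 'n rmat)"
    by (simp add: vec_eq_iff mat_def)
  have "matrix_inv R = ?Q"
  proof (rule matrix_inv_unique)
    show "R ** ?Q = mat 1"
      using swap_matrix_mult [where 'n = 'n, of a "- x" b] unfolding R by (simp add: one ab)
    show "?Q ** R = mat 1"
      using swap_matrix_mult [where 'n = 'n, of b x a] ab unfolding R by (simp add: one mult.commute [of b a])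
  qed
  then have "(1 + E) * matrix_inv R $ p $ q = of_bool (p = q) + x * of_bool (p = prod.swap q)"
    using bE by (simp add: mult.assoc [symmetric])
  then show ?thesis by (simp add: Pmat_def E_def x_def)
qed

lemma R_at_transpose: "R_at R s t n i j J I = R_at (transpose R) s t n i j I J"
  by (auto simp: R_at_def R_coeff_def transpose_def fun_eq_iff)

section \<open>Adding a tensor factor\<close>

lemma hsum_snoc:
  assumes "\<And>K x d y. length K = n \<Longrightarrow> length d = n \<Longrightarrow> \<not> (x = k \<and> y = 0) \<Longrightarrow> f (K @ [x], d @ [y]) = 0"
  shows "hsum sc f (ix (Suc n)) = hsum sc (\<lambda>(K, d). f (K @ [k], d @ [0])) (ix n)"
proof -
  let ?g = "\<lambda>(K, d). (K @ [k], d @ [0::int])"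
  have "hsum sc f (ix (Suc n)) = hsum sc f (?g ` ix n)"
  proof (rule hsum_neutral)
    show "?g ` ix n \<subseteq> ix (Suc n)" by auto
    fix p assume p: "p \<in> ix (Suc n) - ?g ` ix n"
    then obtain K' d' where Kd: "p = (K', d')" "length K' = Suc n" "length d' = Suc n" by auto
    obtain K x where K: "K' = K @ [x]" "length K = n" using Kd(2) by (metis length_Suc_conv_rev)
    obtain d y where d: "d' = d @ [y]" "length d = n" using Kd(3) by (metis length_Suc_conv_rev)
    have "\<not> (x = k \<and> y = 0)" using p K d Kd(1) by force
    then show "f p = 0" using assms [of K d x y] K d Kd(1) by simp
  qed
  also have "\<dots> = hsum sc (\<lambda>p. f (?g p)) (ix n)"
    by (rule hsum_reindex) (auto simp: bij_betw_def inj_on_def)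
  finally show ?thesis by (simp add: case_prod_unfold)
qed

definition R0_prod :: "'n::finite rmat \<Rightarrow> nat \<Rightarrow> nat list \<Rightarrow> ('n, complex fps) mser" where
  "R0_prod R n js = mser_prod n (map (\<lambda>j. R_at R 1 (-1) n 0 j) js)"

lemma R0_prod_Nil: "R0_prod R n [] = mser_one n"
  by (simp add: R0_prod_def mser_prod_def)

lemma R0_prod_Cons: "R0_prod R n (j # js) = mser_lmul (*) n (R_at R 1 (-1) n 0 j) (R0_prod R n js)"
  by (simp add: R0_prod_def mser_prod_def)

lemma tame_R0_prod: "0 < n \<Longrightarrow> set js \<subseteq> {1..<n} \<Longrightarrow> tame n (R0_prod R n js)"
  by (induction js) (auto simp: R0_prod_Nil R0_prod_Cons tame_mser_one intro!: tame_mser_lmul tame_R_at)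

lemma R_at_snoc:
  assumes "i < n" "j < n" "length I = n" "length J = n" "length d = n"
  shows "R_at R s t (Suc n) i j (I @ [k]) (J @ [l]) (d @ [c]) = (if k = l \<and> c = 0 then R_at R s t n i j I J d else 0)"
proof -
  have C: "(\<forall>m<Suc n. m \<noteq> i \<and> m \<noteq> j \<longrightarrow> (I @ [k]) ! m = (J @ [l]) ! m \<and> (d @ [c]) ! m = 0)
    \<longleftrightarrow> (k = l \<and> c = 0) \<and> (\<forall>m<n. m \<noteq> i \<and> m \<noteq> j \<longrightarrow> I ! m = J ! m \<and> d ! m = 0)"
    using assms by (auto simp: less_Suc_eq nth_append)
  show ?thesis
    unfolding R_at_def C using assms by (auto simp: nth_append)
qed

text \<open>
  A product that does not involve the last of \<open>n + 1\<close> tensor factors acts on it as the identity.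
\<close>

lemma R0_prod_snoc:
  fixes R :: "'n::finite rmat"
  assumes n: "0 < n" and "set js \<subseteq> {1..<n}" "length I = n" "length J = n" "length e = n"
  shows "R0_prod R (Suc n) js (I @ [k]) (J @ [l]) (e @ [c]) = (if k = l \<and> c = 0 then R0_prod R n js I J e else 0)"
  using assms(2-)
proof (induction js arbitrary: I e k c)
  case Nil
  then show ?case
    by (auto simp: R0_prod_Nil mser_one_def simp flip: replicate_append_same)
next
  case (Cons j js)
  let ?f = "\<lambda>(K, d). R_at R 1 (-1) (Suc n) 0 j (I @ [k]) K d * R0_prod R (Suc n) js K (J @ [l]) (map2 (-) (e @ [c]) d)"
  have f: "?f (K @ [x], d @ [y]) = (if k = x \<and> y = 0 then R_at R 1 (-1) n 0 j I K d else 0)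
      * (if x = l \<and> c - y = 0 then R0_prod R n js K J (map2 (-) e d) else 0)"
    if "length K = n" "length d = n" for K d x y
    using that Cons.prems n by (simp add: R_at_snoc Cons.IH)
  show ?case
  proof (cases "k = l \<and> c = 0")
    case True
    have "hsum (*) ?f (ix (Suc n)) = hsum (*) (\<lambda>(K, d). ?f (K @ [k], d @ [0])) (ix n)"
    proof (rule hsum_snoc)
      fix K :: "'n list" and d :: "int list" and x :: 'n and y :: int assume *: "length K = n" "length d = n" and "\<not> (x = k \<and> y = 0)"
      then show "?f (K @ [x], d @ [y]) = 0" unfolding f [OF *] by auto
    qed
    also have "\<dots> = hsum (*) (\<lambda>(K, d). R_at R 1 (-1) n 0 j I K d * R0_prod R n js K J (map2 (-) e d)) (ix n)"
    proof (rule hsum_cong)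
      fix p :: "'n list \<times> int list" assume "p \<in> ix n"
      then obtain K d where *: "p = (K, d)" "length K = n" "length d = n" by auto
      show "(case p of (K, d) \<Rightarrow> ?f (K @ [k], d @ [0])) = (case p of (K, d) \<Rightarrow> R_at R 1 (-1) n 0 j I K d * R0_prod R n js K J (map2 (-) e d))"
        unfolding *(1) prod.case unfolding f [OF *(2,3), unfolded prod.case] using True by simp
    qed
    finally show ?thesis using True by (simp add: R0_prod_Cons mser_lmul_def)
  next
    case False
    have "has_hsum (*) ?f (ix (Suc n)) 0"
    proof (rule series.has_hsum_zero)
      fix p :: "'n list \<times> int list" assume "p \<in> ix (Suc n)"
      then obtain K' d' where Kd: "p = (K', d')" "length K' = Suc n" "length d' = Suc n" by auto
      obtain K x where K: "K' = K @ [x]" "length K = n" using Kd(2) by (metis length_Suc_conv_rev)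
      obtain d y where d: "d' = d @ [y]" "length d = n" using Kd(3) by (metis length_Suc_conv_rev)
      show "?f p = 0" unfolding Kd(1) K(1) d(1) f [OF K(2) d(2)] using False by auto
    qed
    from series.hsum_eq [OF this] show ?thesis
      unfolding R0_prod_Cons mser_lmul_def if_not_P [OF False] .
  qed
qed

section \<open>Monomials span the algebra densely\<close>

lemma lplus_negative: "p < 0 \<Longrightarrow> lplus_series \<pi> i j p = 0"
  by (simp add: lplus_series_def)

lemma prod_list_eq_0: "0 \<in> set xs \<Longrightarrow> prod_list xs = (0 :: 'b::ring_1)"
  by (induction xs) auto

lemma taylor_Lplus: "taylor n (Lplus \<pi>)"
  unfolding taylor_def Lplus_def by (force intro: prod_list_eq_0 simp: lplus_negative image_iff)

lemma Lplus_Nil: "Lplus \<pi> [] [] [] = 1"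
  by (simp add: Lplus_def)

lemma Lplus_single: "Lplus \<pi> [i] [j] [p] = lplus_series \<pi> i j p"
  by (simp add: Lplus_def)

lemma Lplus_snoc:
  assumes "length I = n" "length J = n" "length e = n"
  shows "Lplus \<pi> (I @ [k]) (J @ [l]) (e @ [b]) = Lplus \<pi> I J e * lplus_series \<pi> k l b"
proof -
  let ?F = "\<lambda>m. lplus_series \<pi> ((I @ [k]) ! m) ((J @ [l]) ! m) ((e @ [b]) ! m)"
  have "map ?F [0..<n] = map (\<lambda>m. lplus_series \<pi> (I ! m) (J ! m) (e ! m)) [0..<n]"
    using assms by (intro map_cong) (auto simp: nth_append)
  moreover have "?F n = lplus_series \<pi> k l b" using assms by (simp add: nth_append)
  moreover have "Lplus \<pi> (I @ [k]) (J @ [l]) (e @ [b]) = prod_list (map ?F [0..<n]) * ?F n"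
    unfolding Lplus_def using assms(3) by (simp only: length_append list.size add_0 add_Suc_right add_0_right upt_Suc_append le0 map_append prod_list.append list.map prod_list.Cons prod_list.Nil mult_1_right One_nat_def plus_1_eq_Suc)
  ultimately have "Lplus \<pi> (I @ [k]) (J @ [l]) (e @ [b])
      = prod_list (map (\<lambda>m. lplus_series \<pi> (I ! m) (J ! m) (e ! m)) [0..<n]) * lplus_series \<pi> k l b"
    by (simp only:)
  then show ?thesis by (simp only: Lplus_def [of \<pi> I] assms(3))
qed

lemma poly_mapping_single_induct [case_names zero add]:
  assumes "P 0" "\<And>a b f. P f \<Longrightarrow> P (Poly_Mapping.single a b + f)"
  shows "P f"
proof (induction f rule: update_induct)
  case (update f a b)
  have "Poly_Mapping.update a b f = Poly_Mapping.single a b + f"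
    using update(1)
    by (intro poly_mapping_eqI) (auto simp: lookup_update lookup_add lookup_single when_def in_keys_iff)
  then show ?case using assms(2) update by simp
qed (rule assms(1))

lemma module_tfree: "module (\<lambda>a (x :: 'g free_word \<Rightarrow>\<^sub>0 complex). Poly_Mapping.single 0 a * x)"
  by standard (simp_all add: distrib_left distrib_right single_add mult.assoc [symmetric] mult_single)

lemma hcomplete_tfree: "hcomplete tfree_scale"
  unfolding tfree_scale_def by (rule hcomplete_fps_scale [OF module_tfree])

lemma tfree_scale_const:
  "tfree_scale (fps_const a) (fps_const x) = fps_const (Poly_Mapping.single 0 a * x)"
proof (rule fps_ext)
  interpret m: module "\<lambda>a (x :: 'a free_word \<Rightarrow>\<^sub>0 complex). Poly_Mapping.single 0 a * x" by (rule module_tfree)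
  fix n
  have "fps_nth (tfree_scale (fps_const a) (fps_const x)) n
    = (\<Sum>i\<le>n. if i = 0 \<and> n = 0 then Poly_Mapping.single 0 a * x else 0)"
    unfolding tfree_scale_def fps_scale_def fps_nth_Abs_fps by (intro sum.cong) auto
  also have "\<dots> = fps_nth (fps_const (Poly_Mapping.single 0 a * x)) n"
    by (cases n) auto
  finally show "fps_nth (tfree_scale (fps_const a) (fps_const x)) n = fps_nth (fps_const (Poly_Mapping.single 0 a * x)) n" .
qed

locale A_algebra = hcomplete sc for sc :: "complex fps \<Rightarrow> 'a::ring_1 \<Rightarrow> 'a" +
  fixes \<pi> :: "'n::finite A_free \<Rightarrow> 'a" and R :: "'n rmat" and \<epsilon> :: complex
  assumes algebra: "algebra_h sc"
    and \<pi>_hom: "module_hom tfree_scale sc \<pi>" and \<pi>_one: "\<pi> 1 = 1" and \<pi>_mult: "\<pi> (x * y) = \<pi> x * \<pi> y"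
    and \<pi>_surj: "surj \<pi>" and \<pi>_relation: "x \<in> A_relations R \<Longrightarrow> \<pi> x = 0"
    and signed: "signed_R \<epsilon> R"
begin

abbreviation l :: "'n \<Rightarrow> 'n \<Rightarrow> int \<Rightarrow> 'a" where "l \<equiv> lplus_series \<pi>"

lemma scale_mult_left: "sc c x * y = sc c (x * y)"
  using algebra unfolding algebra_h_def by metis

lemma \<epsilon>_cases: "\<epsilon> = 1 \<or> \<epsilon> = - 1"
  using signed by (auto simp: signed_R_def)

text \<open>
  Modulo \<open>h\<^sup>k\<close> every element is a polynomial in \<open>h\<close> whose coefficients are combinations of monomials, and
  \<open>T\<close> maps multiples of \<open>h\<^sup>k\<close> to multiples of \<open>h\<^sup>k\<close>.
\<close>

lemma monomials_dense:
  assumes hom: "module_hom sc sc' T" and sep: "hseparated sc'"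
    and mono: "\<And>I J e n. length I = n \<Longrightarrow> length J = n \<Longrightarrow> length e = n \<Longrightarrow> T (Lplus \<pi> I J e) = 0"
  shows "T x = 0"
proof -
  interpret T: module_hom sc sc' T by (rule hom)
  interpret p: module_hom tfree_scale sc \<pi> by (rule \<pi>_hom)
  interpret t: hcomplete "tfree_scale :: _ \<Rightarrow> 'n A_free \<Rightarrow> _" by (rule hcomplete_tfree)
  interpret s: hseparated sc' by (rule sep)
  have word: "\<exists>I J e. length J = length I \<and> length e = length I \<and>
      \<pi> (fps_const (Poly_Mapping.single (Free_Word gs) 1)) = Lplus \<pi> I J e" for gs
  proof (induction gs rule: rev_induct)
    case Nil
    have "fps_const (Poly_Mapping.single (Free_Word []) 1) = (1 :: 'n A_free)"
      by (simp flip: zero_free_word_def)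
    then show ?case
      using \<pi>_one Lplus_Nil [of \<pi>] by (intro exI [of _ "[]"]) simp
  next
    case (snoc g gs)
    obtain k l m where g: "g = (k, l, m)" by (cases g)
    obtain I J e where IH: "length J = length I" "length e = length I"
      "\<pi> (fps_const (Poly_Mapping.single (Free_Word gs) 1)) = Lplus \<pi> I J e" using snoc by blast
    have "fps_const (Poly_Mapping.single (Free_Word (gs @ [g])) 1)
        = fps_const (Poly_Mapping.single (Free_Word gs) 1) * tfree_gen g"
      by (simp add: tfree_gen_def mult_single plus_free_word_def)
    then have "\<pi> (fps_const (Poly_Mapping.single (Free_Word (gs @ [g])) 1)) = Lplus \<pi> (I @ [k]) (J @ [l]) (e @ [int m])"
      using IH by (subst Lplus_snoc [of I "length I"]) (simp_all add: \<pi>_mult g lplus_series_def)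
    then show ?case using IH by (intro exI [of _ "I @ [k]"] exI [of _ "J @ [l]"] exI [of _ "e @ [int m]"]) simp
  qed
  have const: "T (\<pi> (fps_const f)) = 0" for f
  proof (induction f rule: poly_mapping_single_induct)
    case (add w a f)
    obtain gs where w: "w = Free_Word gs" by (cases w)
    have "fps_const (Poly_Mapping.single w a + f)
        = tfree_scale (fps_const a) (fps_const (Poly_Mapping.single w 1)) + fps_const f"
      by (simp add: tfree_scale_const mult_single)
    moreover obtain I J e where "length J = length I" "length e = length I"
        "\<pi> (fps_const (Poly_Mapping.single w 1)) = Lplus \<pi> I J e" using word w by blast
    ultimately show ?case using add mono by (simp add: p.add p.scale T.add T.scale)
  qed simp
  have "T (\<pi> f) \<in> hpow sc' k" for f k
  proof -
    define g where "g = (\<Sum>i<k. tfree_scale (fps_X ^ i) (fps_const (fps_nth f i)))"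
    have "f - g \<in> hpow tfree_scale k"
      unfolding tfree_scale_def hpow_fps_scale [OF module_tfree]
    proof (intro allI impI)
      fix n assume n: "n < k"
      have "fps_nth g n = (\<Sum>i<k. if i = n then fps_nth f i else 0)"
        unfolding g_def tfree_scale_def fps_sum_nth fps_scale_X_power_nth [OF module_tfree]
        by (intro sum.cong) auto
      then show "fps_nth (f - g) n = 0" using n by simp
    qed
    then have "T (\<pi> (f - g)) \<in> hpow sc' k"
      using module_hom_hpow \<pi>_hom hom by metis
    moreover have "T (\<pi> g) = 0"
      by (simp add: g_def p.sum p.scale T.sum T.scale const)
    ultimately show ?thesis by (simp add: p.diff T.diff)
  qed
  then have "T (\<pi> f) = 0" for f by (intro s.separated)
  then show ?thesis using \<pi>_surj by (metis surjD)
qed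

subsection \<open>The defining relation in polynomial form\<close>

lemma \<pi>_lmul:
  fixes M :: "('m::finite, complex fps) mser"
  assumes M: "tame n M" and X: "taylor n X" and n: "0 < n" and e: "length e = n"
  shows "\<pi> (mser_lmul tfree_scale n M X I J e) = mser_lmul sc n M (\<lambda>I J e. \<pi> (X I J e)) I J e"
proof -
  interpret p: module_hom tfree_scale sc \<pi> by (rule \<pi>_hom)
  interpret t: hcomplete "tfree_scale :: _ \<Rightarrow> 'n A_free \<Rightarrow> _" by (rule hcomplete_tfree)
  have "has_hsum sc (\<lambda>p. \<pi> (case p of (K, d) \<Rightarrow> tfree_scale (M I K d) (X K J (map2 (-) e d)))) (ix n)
      (\<pi> (mser_lmul tfree_scale n M X I J e))"
    by (rule has_hsum_hom [OF \<pi>_hom t.lmul_has_hsum [OF M X n e]])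
  then have "has_hsum sc (\<lambda>(K, d). sc (M I K d) (\<pi> (X K J (map2 (-) e d)))) (ix n)
      (\<pi> (mser_lmul tfree_scale n M X I J e))"
    by (rule iffD1 [OF has_hsum_cong, rotated]) (auto simp: p.scale)
  from hsum_eq [OF this] show ?thesis
    unfolding mser_lmul_def [of sc] by (rule sym)
qed

lemma taylor_prod12: "taylor 2 (prod12 (lplus_series (\<pi>' :: 'n A_free \<Rightarrow> 'c::ring_1)))"
  and taylor_prod21: "taylor 2 (\<lambda>I J. prod21 (lplus_series (\<pi>' :: 'n A_free \<Rightarrow> 'c::ring_1)) J I)"
  by (auto simp: taylor_def prod12_def prod21_def lplus_negative less_2_cases_iff)

text \<open>
  \<open>Q\<close> is the common value of the two sides of the defining relation. Multiplying either side by the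
  denominator of its \<open>R\<close>-matrix gives \<open>(u - v + \<epsilon> h) Q = (u - v + h P) L\<^sub>1\<^sup>+(u) L\<^sub>2\<^sup>+(v)\<close> (stated with the
  opposite sign) and \<open>(u - v - \<epsilon> h) Q = L\<^sub>2\<^sup>+(v) L\<^sub>1\<^sup>+(u) (u - v - h P)\<close>.
\<close>

lemma defining_relation:
  obtains Q where
    "\<And>i j k m p q. - Q i j k m (p - 1) q + Q i j k m p (q - 1) - sc (fps_const \<epsilon> * fps_X) (Q i j k m p q)
      = - (l i j (p - 1) * l k m q) + l i j p * l k m (q - 1) - sc fps_X (l k j p * l i m q)"
    "\<And>i j k m p q. Q i j k m (p - 1) q - Q i j k m p (q - 1) - sc (fps_const \<epsilon> * fps_X) (Q i j k m p q)
      = l k m q * l i j (p - 1) - l k m (q - 1) * l i j p - sc fps_X (l k j q * l i m p)"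
proof -
  define X where "X = prod12 l"
  define X' where "X' = (\<lambda>I J. prod21 l J I)"
  have tX: "taylor 2 X" "taylor 2 X'" unfolding X_def X'_def by (rule taylor_prod12 taylor_prod21)+
  have tR: "tame 2 (R_at M s t 2 0 1)" for M :: "'n rmat" and s t by (rule tame_R_at) auto
  define Q where "Q i j k m p q = mser_lmul sc 2 (R_at R (-1) 1 2 0 1) X [i, k] [j, m] [p, q]" for i j k m p q
  interpret p: module_hom tfree_scale sc \<pi> by (rule \<pi>_hom)
  have \<pi>_gen: "\<pi> (lplus_series id i j p) = l i j p" for i j p by (simp add: lplus_series_def p.zero)
  have \<pi>X: "X = (\<lambda>I J e. \<pi> (prod12 (lplus_series id) I J e))" "X' = (\<lambda>I J e. \<pi> (prod21 (lplus_series id) J I e))"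
    by (simp_all add: X_def X'_def prod12_def prod21_def \<pi>_mult \<pi>_gen fun_eq_iff)
  have Q': "Q i j k m p q = mser_lmul sc 2 (R_at (transpose R) 1 (-1) 2 0 1) X' [j, m] [i, k] [p, q]" for i j k m p q
  proof -
    have "mser_lmul tfree_scale 2 (R_at R (-1) 1 2 0 1) (prod12 (lplus_series id)) [i, k] [j, m] [p, q]
      - mser_rmul tfree_scale 2 (prod21 (lplus_series id)) (R_at R 1 (-1) 2 0 1) [i, k] [j, m] [p, q] \<in> A_relations R"
      unfolding A_relations_def mem_Collect_eq
      by (rule exI [of _ "[i, k]"], rule exI [of _ "[j, m]"], rule exI [of _ "[p, q]"]) simp
    then have "\<pi> (mser_lmul tfree_scale 2 (R_at R (-1) 1 2 0 1) (prod12 (lplus_series id)) [i, k] [j, m] [p, q])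
      = \<pi> (mser_rmul tfree_scale 2 (prod21 (lplus_series id)) (R_at R 1 (-1) 2 0 1) [i, k] [j, m] [p, q])"
      using \<pi>_relation p.diff by fastforce
    moreover have "\<pi> (mser_lmul tfree_scale 2 (R_at R (-1) 1 2 0 1) (prod12 (lplus_series id)) [i, k] [j, m] [p, q]) = Q i j k m p q"
      unfolding Q_def \<pi>X(1) by (rule \<pi>_lmul [OF tR taylor_prod12]) auto
    moreover have "\<pi> (mser_rmul tfree_scale 2 (prod21 (lplus_series id)) (R_at R 1 (-1) 2 0 1) [i, k] [j, m] [p, q])
      = mser_lmul sc 2 (R_at (transpose R) 1 (-1) 2 0 1) X' [j, m] [i, k] [p, q]"
      unfolding mser_rmul_transpose R_at_transpose [of R 1 "-1"] \<pi>X(2)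
      by (rule \<pi>_lmul [OF tR taylor_prod21]) auto
    ultimately show ?thesis by simp
  qed
  note den = signed_R_denominator [OF signed]
  have den': "(1 + fps_const (- \<epsilon>) * fps_X) * transpose R $ p $ q = of_bool (p = q) + fps_const (- 1) * fps_X * Pmat $ p $ q" for p q
    using den [of q p] by (auto simp: transpose_def Pmat_def)
  show ?thesis
  proof (rule that)
    fix i j k m p q
    have "lin_mult sc (-1) 1 (fps_const (- \<epsilon>) * fps_X) 0 1 (mser_lmul sc 2 (R_at R (-1) 1 2 0 1) X) [i, k] [j, m] [p, q]
      = lin_mult sc (-1) 1 0 0 1 X [i, k] [j, m] [p, q] + sc (fps_const (-1) * fps_X) (X (swap_at 0 1 [i, k]) [j, m] [p, q])"
      by (rule R_at_mult [OF _ den]) (auto simp: tX)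
    then show "- Q i j k m (p - 1) q + Q i j k m p (q - 1) - sc (fps_const \<epsilon> * fps_X) (Q i j k m p q)
      = - (l i j (p - 1) * l k m q) + l i j p * l k m (q - 1) - sc fps_X (l k j p * l i m q)"
      by (simp add: lin_mult_def Q_def X_def prod12_def swap_at_def flip: fps_const_neg)
    have "lin_mult sc 1 (-1) (fps_const (- \<epsilon>) * fps_X) 0 1 (mser_lmul sc 2 (R_at (transpose R) 1 (-1) 2 0 1) X') [j, m] [i, k] [p, q]
      = lin_mult sc 1 (-1) 0 0 1 X' [j, m] [i, k] [p, q] + sc (fps_const (-1) * fps_X) (X' (swap_at 0 1 [j, m]) [i, k] [p, q])"
      by (rule R_at_mult [OF _ den']) (auto simp: tX)
    then show "Q i j k m (p - 1) q - Q i j k m p (q - 1) - sc (fps_const \<epsilon> * fps_X) (Q i j k m p q)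
      = l k m q * l i j (p - 1) - l k m (q - 1) * l i j p - sc fps_X (l k j q * l i m p)"
      by (simp add: lin_mult_def Q' X'_def prod21_def swap_at_def flip: fps_const_neg)
  qed
qed

end

section \<open>Polynomials in the spectral parameters and the permutation operator\<close>

context hseparated
begin

definition hs :: "complex \<Rightarrow> 'w \<Rightarrow> 'w" where "hs c x = sc (fps_const c * fps_X) x"

lemma hs_add: "hs c (x + y) = hs c x + hs c y"
  and hs_diff: "hs c (x - y) = hs c x - hs c y"
  and hs_uminus: "hs c (- x) = - hs c x"
  and hs_zero: "hs c 0 = 0"
  and hs_zero_left: "hs 0 x = 0"
  and hs_one: "hs 1 x = sc fps_X x"
  by (simp_all add: hs_def scale_right_distrib scale_right_diff_distrib)

lemma hs_neg: "hs (- c) x = - hs c x"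
  by (simp add: hs_def flip: fps_const_neg)

lemma hs_commute: "hs c (hs d x) = hs d (hs c x)"
  unfolding hs_def by (rule scale_left_commute)

lemma hs_hp: "x \<in> hp k \<Longrightarrow> hs c x \<in> hp (Suc k)"
  unfolding hs_def scale_scale [symmetric] by (intro hp_scale hp_scale_X)

lemmas hs_simps = hs_add hs_diff hs_uminus hs_zero hs_zero_left

text \<open>
  \<open>u - v + c h\<close> is not a zero divisor on series with no negative powers of \<open>v\<close>: if it kills \<open>D\<close>, then the
  coefficient of the lowest power of \<open>v\<close> in \<open>D\<close> satisfies \<open>D\<^bsub>p-1\<^esub> = - c h D\<^sub>p\<close> for all \<open>p\<close>, so it is divisible by
  every power of \<open>h\<close>.
\<close>

lemma cancel_right:
  fixes D :: "int \<Rightarrow> int \<Rightarrow> 'w"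
  assumes eq: "\<And>p q. D (p - 1) q - D p (q - 1) + hs c (D p q) = 0"
    and supp: "\<And>p q. q < 0 \<Longrightarrow> D p q = 0"
  shows "D p q = 0"
proof (cases "q < 0")
  case False
  have "D p (int n) = 0" for n and p :: int
  proof (induction n arbitrary: p)
    case n: 0
    have step: "D (p - 1) 0 = - hs c (D p 0)" for p
      using eq [of p 0] supp [of "-1" p] by (simp add: eq_neg_iff_add_eq_0)
    have "D p 0 \<in> hp k" for k p
    proof (induction k arbitrary: p)
      case (Suc k)
      show ?case using step [of "p + 1"] Suc by (simp add: hp_uminus hs_hp)
    qed simp
    then show ?case using separated by simp
  next
    case (Suc n)
    have step: "D (p - 1) (int (Suc n)) = - hs c (D p (int (Suc n)))" for p
      using eq [of p "int (Suc n)"] Suc by (simp add: eq_neg_iff_add_eq_0)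
    have "D p (int (Suc n)) \<in> hp k" for k p
    proof (induction k arbitrary: p)
      case (Suc k)
      show ?case using step [of "p + 1"] Suc by (simp add: hp_uminus hs_hp)
    qed simp
    then show ?case using separated by blast
  qed
  from this [of p "nat q"] show ?thesis using False by simp
qed (rule supp)

lemma cancel_left:
  fixes D :: "int \<Rightarrow> int \<Rightarrow> 'w"
  assumes eq: "\<And>p q. D (p - 1) q - D p (q - 1) + hs c (D p q) = 0"
    and supp: "\<And>p q. p < 0 \<Longrightarrow> D p q = 0"
  shows "D p q = 0"
proof -
  have "D (p - 1) q - D p (q - 1) - hs (- c) (D p q) = 0" for p q
    using eq [of p q] by (simp add: hs_neg)
  then have "D p (q - 1) - D (p - 1) q + hs (- c) (D p q) = 0" for p q
    by (metis (no_types, opaque_lifting) add.inverse_neutral minus_add_distrib minus_diff_eq uminus_add_conv_diff)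
  then show ?thesis
    using cancel_right [of "\<lambda>q p. D p q" "- c" q p] supp by blast
qed

text \<open>Multiplication by \<open>u - v + c h + d h P\<close>, where \<open>P\<close> acts on the rows.\<close>

definition lin2 :: "complex \<Rightarrow> complex \<Rightarrow> ('i \<Rightarrow> 'j \<Rightarrow> 'i \<Rightarrow> 'j \<Rightarrow> int \<Rightarrow> int \<Rightarrow> 'w) \<Rightarrow> 'i \<Rightarrow> 'j \<Rightarrow> 'i \<Rightarrow> 'j \<Rightarrow> int \<Rightarrow> int \<Rightarrow> 'w" where
  "lin2 c d F i j k m p q =
     F i j k m (p - 1) q - F i j k m p (q - 1) + hs c (F i j k m p q) + hs d (F k j i m p q)"

text \<open>Multiplication by \<open>u - v - h P\<close> from the right, so that \<open>P\<close> acts on the columns.\<close>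

definition rlin2 :: "('i \<Rightarrow> 'j \<Rightarrow> 'i \<Rightarrow> 'j \<Rightarrow> int \<Rightarrow> int \<Rightarrow> 'w) \<Rightarrow> 'i \<Rightarrow> 'j \<Rightarrow> 'i \<Rightarrow> 'j \<Rightarrow> int \<Rightarrow> int \<Rightarrow> 'w" where
  "rlin2 F i j k m p q = F i j k m (p - 1) q - F i j k m p (q - 1) - hs 1 (F i m k j p q)"

lemma lin2_commute: "lin2 c d (lin2 c' d' F) = lin2 c' d' (lin2 c d F)"
  by (intro ext) (simp add: lin2_def hs_simps hs_commute algebra_simps)

lemma lin2_rlin2: "lin2 c d (rlin2 F) = rlin2 (lin2 c d F)"
  by (intro ext) (simp add: lin2_def rlin2_def hs_simps hs_commute [of 1] algebra_simps)

text \<open>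
  \<open>(x - h P) (x + h P) = x\<^sup>2 - h\<^sup>2 = (x + \<epsilon> h) (x - \<epsilon> h)\<close> with \<open>x = u - v\<close>, as \<open>P\<^sup>2 = 1\<close>.
\<close>

lemma lin2_P_squared:
  assumes "\<epsilon> = 1 \<or> \<epsilon> = - 1"
  shows "lin2 0 (- 1) (lin2 0 1 F) = lin2 \<epsilon> 0 (lin2 (- \<epsilon>) 0 F)"
proof -
  have "lin2 0 (- 1) (lin2 0 1 F) = lin2 1 0 (lin2 (- 1) 0 F)"
    by (intro ext) (simp add: lin2_def hs_simps hs_neg algebra_simps)
  moreover have "lin2 1 0 (lin2 (- 1) 0 F) = lin2 (- 1) 0 (lin2 1 0 F)" by (rule lin2_commute)
  ultimately show ?thesis using assms by (elim disjE) simp_all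
qed

lemma lin2_cancel_right:
  assumes "lin2 c 0 F = lin2 c 0 G"
    and "\<And>i j k m p q. q < 0 \<Longrightarrow> F i j k m p q = 0" "\<And>i j k m p q. q < 0 \<Longrightarrow> G i j k m p q = 0"
  shows "F = G"
proof (intro ext)
  fix i j k m p q
  have eq: "lin2 c 0 F i j k m p q = lin2 c 0 G i j k m p q" for p q using assms(1) by simp
  have "F i j k m p q - G i j k m p q = 0"
  proof (rule cancel_right [where c = c and D = "\<lambda>p q. F i j k m p q - G i j k m p q"])
    fix p q
    show "(F i j k m (p - 1) q - G i j k m (p - 1) q) - (F i j k m p (q - 1) - G i j k m p (q - 1)) + hs c (F i j k m p q - G i j k m p q) = 0"
      using eq [of p q] by (simp add: lin2_def hs_simps algebra_simps)
  qed (simp add: assms(2,3))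
  then show "F i j k m p q = G i j k m p q" by simp
qed

lemma lin2_cancel_left:
  assumes "lin2 c 0 F = lin2 c 0 G"
    and "\<And>i j k m p q. p < 0 \<Longrightarrow> F i j k m p q = 0" "\<And>i j k m p q. p < 0 \<Longrightarrow> G i j k m p q = 0"
  shows "F = G"
proof (intro ext)
  fix i j k m p q
  have eq: "lin2 c 0 F i j k m p q = lin2 c 0 G i j k m p q" for p q using assms(1) by simp
  have "F i j k m p q - G i j k m p q = 0"
  proof (rule cancel_left [where c = c and D = "\<lambda>p q. F i j k m p q - G i j k m p q"])
    fix p q
    show "(F i j k m (p - 1) q - G i j k m (p - 1) q) - (F i j k m p (q - 1) - G i j k m p (q - 1)) + hs c (F i j k m p q - G i j k m p q) = 0"
      using eq [of p q] by (simp add: lin2_def hs_simps algebra_simps)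
  qed (simp add: assms(2,3))
  then show "F i j k m p q = G i j k m p q" by simp
qed

text \<open>The same operators for three rows and three variables.\<close>

definition lin12 :: "complex \<Rightarrow> complex \<Rightarrow> ('i \<Rightarrow> 'i \<Rightarrow> 'i \<Rightarrow> int \<Rightarrow> int \<Rightarrow> int \<Rightarrow> 'w) \<Rightarrow> 'i \<Rightarrow> 'i \<Rightarrow> 'i \<Rightarrow> int \<Rightarrow> int \<Rightarrow> int \<Rightarrow> 'w" where
  "lin12 c d F i k a p q b = F i k a (p - 1) q b - F i k a p (q - 1) b + hs c (F i k a p q b) + hs d (F k i a p q b)"

definition lin13 :: "complex \<Rightarrow> complex \<Rightarrow> ('i \<Rightarrow> 'i \<Rightarrow> 'i \<Rightarrow> int \<Rightarrow> int \<Rightarrow> int \<Rightarrow> 'w) \<Rightarrow> 'i \<Rightarrow> 'i \<Rightarrow> 'i \<Rightarrow> int \<Rightarrow> int \<Rightarrow> int \<Rightarrow> 'w" where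
  "lin13 c d F i k a p q b = F i k a (p - 1) q b - F i k a p q (b - 1) + hs c (F i k a p q b) + hs d (F a k i p q b)"

definition lin23 :: "complex \<Rightarrow> complex \<Rightarrow> ('i \<Rightarrow> 'i \<Rightarrow> 'i \<Rightarrow> int \<Rightarrow> int \<Rightarrow> int \<Rightarrow> 'w) \<Rightarrow> 'i \<Rightarrow> 'i \<Rightarrow> 'i \<Rightarrow> int \<Rightarrow> int \<Rightarrow> int \<Rightarrow> 'w" where
  "lin23 c d F i k a p q b = F i k a p (q - 1) b - F i k a p q (b - 1) + hs c (F i k a p q b) + hs d (F i a k p q b)"

text \<open>\<open>(u - v) F - h F'\<close>\<close>

definition comb12 :: "('i \<Rightarrow> 'i \<Rightarrow> 'i \<Rightarrow> int \<Rightarrow> int \<Rightarrow> int \<Rightarrow> 'w) \<Rightarrow> ('i \<Rightarrow> 'i \<Rightarrow> 'i \<Rightarrow> int \<Rightarrow> int \<Rightarrow> int \<Rightarrow> 'w)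
    \<Rightarrow> 'i \<Rightarrow> 'i \<Rightarrow> 'i \<Rightarrow> int \<Rightarrow> int \<Rightarrow> int \<Rightarrow> 'w" where
  "comb12 F F' i k a p q b = F i k a (p - 1) q b - F i k a p (q - 1) b - hs 1 (F' i k a p q b)"

lemma lin13_comb12: "lin13 c d (comb12 F F') = comb12 (lin13 c d F) (lin13 c d F')"
  and lin23_comb12: "lin23 c d (comb12 F F') = comb12 (lin23 c d F) (lin23 c d F')"
  by (intro ext, simp add: lin13_def lin23_def comb12_def hs_simps hs_commute [of 1] algebra_simps)+

lemma lin13_lin23: "lin13 c 0 (lin23 c' d' F) = lin23 c' d' (lin13 c 0 F)"
  and lin13_lin12: "lin13 c 0 (lin12 c' d' F) = lin12 c' d' (lin13 c 0 F)"
  and lin23_lin12: "lin23 c 0 (lin12 c' d' F) = lin12 c' d' (lin23 c 0 F)"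
  and lin23_lin13: "lin23 c 0 (lin13 c' d' F) = lin13 c' d' (lin23 c 0 F)"
  by (intro ext, simp add: lin12_def lin13_def lin23_def hs_simps hs_commute algebra_simps)+

text \<open>
  The Yang-Baxter equation for \<open>u - v - h P\<^bsub>12\<^esub>\<close>, \<open>v - y + h P\<^bsub>23\<^esub>\<close> and \<open>u - y + h P\<^bsub>13\<^esub>\<close>.
\<close>

lemma Yang_Baxter: "lin12 0 (- 1) (lin23 0 1 (lin13 0 1 F)) = lin13 0 1 (lin23 0 1 (lin12 0 (- 1) F))"
  by (intro ext) (simp add: lin12_def lin13_def lin23_def hs_simps hs_neg algebra_simps)

lemma lin13_cancel:
  assumes "lin13 c 0 F = lin13 c 0 G"
    and "\<And>i k a p q b. b < 0 \<Longrightarrow> F i k a p q b = 0" "\<And>i k a p q b. b < 0 \<Longrightarrow> G i k a p q b = 0"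
  shows "F = G"
proof (intro ext)
  fix i k a p q b
  have eq: "lin13 c 0 F i k a p q b = lin13 c 0 G i k a p q b" for p b using assms(1) by simp
  have "F i k a p q b - G i k a p q b = 0"
  proof (rule cancel_right [where c = c and D = "\<lambda>p b. F i k a p q b - G i k a p q b"])
    fix p b
    show "(F i k a (p - 1) q b - G i k a (p - 1) q b) - (F i k a p q (b - 1) - G i k a p q (b - 1)) + hs c (F i k a p q b - G i k a p q b) = 0"
      using eq [of p b] by (simp add: lin13_def hs_simps algebra_simps)
  qed (simp add: assms(2,3))
  then show "F i k a p q b = G i k a p q b" by simp
qed

lemma lin23_cancel:
  assumes "lin23 c 0 F = lin23 c 0 G"
    and "\<And>i k a p q b. b < 0 \<Longrightarrow> F i k a p q b = 0" "\<And>i k a p q b. b < 0 \<Longrightarrow> G i k a p q b = 0"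
  shows "F = G"
proof (intro ext)
  fix i k a p q b
  have eq: "lin23 c 0 F i k a p q b = lin23 c 0 G i k a p q b" for q b using assms(1) by simp
  have "F i k a p q b - G i k a p q b = 0"
  proof (rule cancel_right [where c = c and D = "\<lambda>q b. F i k a p q b - G i k a p q b"])
    fix q b
    show "(F i k a p (q - 1) b - G i k a p (q - 1) b) - (F i k a p q (b - 1) - G i k a p q (b - 1)) + hs c (F i k a p q b - G i k a p q b) = 0"
      using eq [of q b] by (simp add: lin23_def hs_simps algebra_simps)
  qed (simp add: assms(2,3))
  then show "F i k a p q b = G i k a p q b" by simp
qed

end

section \<open>The operator series \<open>L(u)\<close>\<close>

locale L_operator = A_algebra +
  fixes L :: "'b \<Rightarrow> 'b \<Rightarrow> int \<Rightarrow> 'a \<Rightarrow> 'a"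
  assumes is_L: "is_L_operator R sc \<pi> L"
begin

lemma L_hom: "module_hom sc sc (L i j p)"
  using is_L unfolding is_L_operator_def by blast

lemma L_add: "L i j p (x + y) = L i j p x + L i j p y"
  and L_scale: "L i j p (sc c x) = sc c (L i j p x)"
  and L_diff: "L i j p (x - y) = L i j p x - L i j p y"
  and L_zero: "L i j p 0 = 0"
  by (rule module_hom.add [OF L_hom] module_hom.scale [OF L_hom] module_hom.diff [OF L_hom] module_hom.zero [OF L_hom])+

lemma L_hs: "L i j p (hs c x) = hs c (L i j p x)"
  by (simp add: hs_def L_scale)

lemma hs_mult: "hs c x * y = hs c (x * y)"
  by (simp add: hs_def scale_mult_left)

lemma L_Lplus:
  assumes "length I = n" "length J = n" "length e = n"
  shows "L i j p (Lplus \<pi> I J e)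
    = mser_lmul sc (Suc n) (R0_prod (matrix_inv R) (Suc n) (rev [1..<Suc n])) (Lplus \<pi>) (i # I) (j # J) (p # e)"
proof -
  have "length (i # I) = Suc n \<and> length (j # J) = Suc n \<and> length (p # e) = Suc n" using assms by simp
  then have "L (hd (i # I)) (hd (j # J)) (hd (p # e)) (Lplus \<pi> (tl (i # I)) (tl (j # J)) (tl (p # e)))
    = mser_lmul sc (Suc n) (mser_prod (Suc n) (map (\<lambda>j. R_at (matrix_inv R) 1 (-1) (Suc n) 0 j) (rev [1..<Suc n])))
          (Lplus \<pi>) (i # I) (j # J) (p # e)"
    using is_L unfolding is_L_operator_def by blast
  then show ?thesis by (simp add: R0_prod_def)
qed

lemma L_one: "L i j p 1 = l i j p"
  using L_Lplus [of "[]" 0 "[]" "[]" i j p] by (simp add: R0_prod_Nil mser_lmul_one Lplus_Nil Lplus_single)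

lemma lmul_snoc:
  assumes n: "0 < n" and js: "set js \<subseteq> {1..<n}" and len: "length I = n" "length J = n" "length e = n"
  shows "mser_lmul sc (Suc n) (R0_prod Rm (Suc n) js) (Lplus \<pi>) (I @ [k]) (J @ [m]) (e @ [b])
    = mser_lmul sc n (R0_prod Rm n js) (Lplus \<pi>) I J e * l k m b"
proof -
  let ?f = "\<lambda>(K, d). sc (R0_prod Rm (Suc n) js (I @ [k]) K d) (Lplus \<pi> K (J @ [m]) (map2 (-) (e @ [b]) d))"
  have "module_hom sc sc (\<lambda>x. x * l k m b)"
    by (simp add: module_hom_iff module_axioms distrib_right scale_mult_left)
  from has_hsum_hom [OF this lmul_has_hsum [OF tame_R0_prod [OF n js] taylor_Lplus n len(3)]]
  have "has_hsum sc (\<lambda>(K, d). sc (R0_prod Rm n js I K d) (Lplus \<pi> K J (map2 (-) e d) * l k m b)) (ix n)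
      (mser_lmul sc n (R0_prod Rm n js) (Lplus \<pi>) I J e * l k m b)"
    by (rule iffD1 [OF has_hsum_cong, rotated]) (auto simp: scale_mult_left)
  then have "hsum sc (\<lambda>(K, d). sc (R0_prod Rm n js I K d) (Lplus \<pi> K J (map2 (-) e d) * l k m b)) (ix n)
    = mser_lmul sc n (R0_prod Rm n js) (Lplus \<pi>) I J e * l k m b" by (rule hsum_eq)
  moreover have "hsum sc ?f (ix (Suc n)) = hsum sc (\<lambda>(K, d). ?f (K @ [k], d @ [0])) (ix n)"
  proof (rule hsum_snoc)
    fix K :: "'b list" and d :: "int list" and x :: 'b and y :: int
    assume "length K = n" "length d = n" "\<not> (x = k \<and> y = 0)"
    then show "?f (K @ [x], d @ [y]) = 0"
      using R0_prod_snoc [OF n js len(1), of K d Rm k x y] by auto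
  qed
  moreover have "hsum sc (\<lambda>(K, d). ?f (K @ [k], d @ [0])) (ix n)
    = hsum sc (\<lambda>(K, d). sc (R0_prod Rm n js I K d) (Lplus \<pi> K J (map2 (-) e d) * l k m b)) (ix n)"
  proof (rule hsum_cong)
    fix p :: "'b list \<times> int list" assume "p \<in> ix n"
    then obtain K d where p: "p = (K, d)" "length K = n" "length d = n" by auto
    show "(case p of (K, d) \<Rightarrow> ?f (K @ [k], d @ [0]))
      = (case p of (K, d) \<Rightarrow> sc (R0_prod Rm n js I K d) (Lplus \<pi> K J (map2 (-) e d) * l k m b))"
      using p len by (simp add: R0_prod_snoc [OF n js] Lplus_snoc [of _ n])
  qed
  ultimately show ?thesis by (simp add: mser_lmul_def)
qed

text \<open>
  \<open>(u - v + \<epsilon> h) L\<^sub>1(u) (X L\<^sub>2\<^sup>+(v)) = (u - v + h P) (L\<^sub>1(u) X) L\<^sub>2\<^sup>+(v)\<close>: the outermost factor of the product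
  of \<open>R\<close>-matrices defining \<open>L(u)\<close> on monomials belongs to the last factor of the monomial, and the
  remaining product defines \<open>L(u)\<close> on \<open>X\<close>.
\<close>

lemma L_snoc_monomial:
  assumes len: "length I = n" "length J = n" "length e = n"
  defines "X \<equiv> Lplus \<pi> I J e"
  shows "L i j (p - 1) (X * l k m b) - L i j p (X * l k m (b - 1)) + hs \<epsilon> (L i j p (X * l k m b))
    = L i j (p - 1) X * l k m b - L i j p X * l k m (b - 1) + hs 1 (L k j p X * l i m b)"
proof -
  let ?N = "Suc (Suc n)" and ?Ri = "matrix_inv R"
  let ?M' = "R0_prod ?Ri ?N (rev [1..<Suc n])"
  let ?M = "mser_lmul (*) ?N (R_at ?Ri 1 (-1) ?N 0 (Suc n)) ?M'"
  let ?I = "i # I @ [k]" and ?J = "j # J @ [m]" and ?e = "p # e @ [b]"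
  let ?lin = "\<lambda>sc c. lin_mult sc 1 (-1) c 0 (Suc n)"
  note den = signed_R_inverse_denominator [OF signed]
  have js: "set (rev [1..<Suc n]) \<subseteq> {1..<Suc n}" by auto
  have tM': "tame ?N ?M'" by (rule tame_R0_prod) auto
  have M: "R0_prod ?Ri ?N (rev [1..<?N]) = ?M"
    by (simp add: R0_prod_Cons)
  have tM: "tame ?N ?M" by (rule tame_mser_lmul [OF tame_R_at tM']) auto
  have lens: "length ?I = ?N" "length ?J = ?N" "length ?e = ?N" using len by auto
  have LM: "mser_lmul sc ?N ?M (Lplus \<pi>) (i # I @ [k]) (j # J @ [m]) (p # e @ [b]) = L i j p (X * l k m b)" for i k p b
    unfolding X_def using L_Lplus [of "I @ [k]" "Suc n" "J @ [m]" "e @ [b]" i j p] len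
    by (simp add: Lplus_snoc [OF len] R0_prod_Cons)
  have LM': "mser_lmul sc ?N ?M' (Lplus \<pi>) (i # I @ [k]) (j # J @ [m]) (p # e @ [b]) = L i j p X * l k m b" for i k p b
    unfolding X_def using lmul_snoc [of "Suc n" "rev [1..<Suc n]" "i # I" "j # J" "p # e" ?Ri k m b] js len
    by (simp add: L_Lplus [OF len])
  have upd: "?e[0 := ?e ! 0 - 1] = (p - 1) # e @ [b]" "?e[Suc n := ?e ! Suc n - 1] = p # e @ [b - 1]"
    "swap_at 0 (Suc n) ?I = k # I @ [i]"
    using len by (simp_all add: swap_at_def nth_append list_update_append)
  have "?lin sc (fps_const \<epsilon> * fps_X) (mser_lmul sc ?N ?M (Lplus \<pi>)) ?I ?J ?e
      = mser_lmul sc ?N (?lin (*) (fps_const \<epsilon> * fps_X) ?M) (Lplus \<pi>) ?I ?J ?e"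
    by (rule lin_mult_lmul [OF tM taylor_Lplus]) (use lens in auto)
  also have "\<dots> = mser_lmul sc ?N (\<lambda>I K d. ?lin (*) 0 ?M' I K d
      + fps_const 1 * fps_X * ?M' (swap_at 0 (Suc n) I) K d) (Lplus \<pi>) ?I ?J ?e"
    unfolding mser_lmul_def [of sc]
  proof (rule hsum_cong)
    fix p :: "'b list \<times> int list" assume "p \<in> ix ?N"
    then obtain K d where p: "p = (K, d)" "length K = ?N" "length d = ?N" by auto
    have "?lin (*) (fps_const \<epsilon> * fps_X) ?M ?I K d
        = ?lin (*) 0 ?M' ?I K d + fps_const 1 * fps_X * ?M' (swap_at 0 (Suc n) ?I) K d"
      by (rule series.R_at_mult [OF _ den]) (use lens p tame_taylor [OF tM'] in auto)
    then show "(case p of (K, d) \<Rightarrow> sc (?lin (*) (fps_const \<epsilon> * fps_X) ?M ?I K d) (Lplus \<pi> K ?J (map2 (-) ?e d)))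
      = (case p of (K, d) \<Rightarrow> sc (?lin (*) 0 ?M' ?I K d + fps_const 1 * fps_X * ?M' (swap_at 0 (Suc n) ?I) K d) (Lplus \<pi> K ?J (map2 (-) ?e d)))"
      unfolding p(1) prod.case by (simp only:)
  qed
  also have "\<dots> = ?lin sc 0 (mser_lmul sc ?N ?M' (Lplus \<pi>)) ?I ?J ?e
      + sc (fps_const 1 * fps_X) (mser_lmul sc ?N ?M' (Lplus \<pi>) (swap_at 0 (Suc n) ?I) ?J ?e)"
  proof (rule lmul_add)
    show "has_hsum sc (\<lambda>(K, d). sc (?lin (*) 0 ?M' ?I K d) (Lplus \<pi> K ?J (map2 (-) ?e d))) (ix ?N)
      (?lin sc 0 (mser_lmul sc ?N ?M' (Lplus \<pi>)) ?I ?J ?e)"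
      by (rule lin_mult_has_hsum [OF tM' taylor_Lplus]) (use lens in auto)
    have "has_hsum sc (\<lambda>x. sc (fps_const 1 * fps_X) (case x of (K, d) \<Rightarrow> sc (?M' (swap_at 0 (Suc n) ?I) K d) (Lplus \<pi> K ?J (map2 (-) ?e d)))) (ix ?N)
      (sc (fps_const 1 * fps_X) (mser_lmul sc ?N ?M' (Lplus \<pi>) (swap_at 0 (Suc n) ?I) ?J ?e))"
      by (intro has_hsum_scale lmul_has_hsum [OF tM' taylor_Lplus]) (use lens in auto)
    then show "has_hsum sc (\<lambda>(K, d). sc (fps_const 1 * fps_X * ?M' (swap_at 0 (Suc n) ?I) K d) (Lplus \<pi> K ?J (map2 (-) ?e d))) (ix ?N)
      (sc (fps_const 1 * fps_X) (mser_lmul sc ?N ?M' (Lplus \<pi>) (swap_at 0 (Suc n) ?I) ?J ?e))"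
      by (rule iffD1 [OF has_hsum_cong, rotated]) auto
  qed
  finally have "?lin sc (fps_const \<epsilon> * fps_X) (mser_lmul sc ?N ?M (Lplus \<pi>)) ?I ?J ?e
    = ?lin sc 0 (mser_lmul sc ?N ?M' (Lplus \<pi>)) ?I ?J ?e
      + sc (fps_const 1 * fps_X) (mser_lmul sc ?N ?M' (Lplus \<pi>) (swap_at 0 (Suc n) ?I) ?J ?e)" .
  then show ?thesis
    unfolding lin_mult_def upd LM LM' hs_def by (simp flip: fps_const_neg)
qed

lemma L_snoc:
  "L i j (p - 1) (X * l k m b) - L i j p (X * l k m (b - 1)) + hs \<epsilon> (L i j p (X * l k m b))
    = L i j (p - 1) X * l k m b - L i j p X * l k m (b - 1) + hs 1 (L k j p X * l i m b)"
proof -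
  define T where "T X = L i j (p - 1) (X * l k m b) - L i j p (X * l k m (b - 1)) + hs \<epsilon> (L i j p (X * l k m b))
    - (L i j (p - 1) X * l k m b - L i j p X * l k m (b - 1) + hs 1 (L k j p X * l i m b))" for X
  have "T X = 0"
  proof (rule monomials_dense [where T = T and x = X, OF _ hseparated_axioms])
    have "T (x + y) = T x + T y" for x y
      by (simp add: T_def distrib_right L_add hs_add algebra_simps)
    moreover have "T (sc c x) = sc c (T x)" for c x
    proof -
      have "hs d (sc c y) = sc c (hs d y)" for d y unfolding hs_def by (rule scale_left_commute)
      then show ?thesis
        by (simp add: T_def L_scale scale_mult_left scale_right_distrib scale_right_diff_distrib)
    qed
    ultimately show "module_hom sc sc T" by (simp add: module_hom_iff module_axioms)
    fix I J :: "'b list" and e :: "int list" and n assume "length I = n" "length J = n" "length e = n"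
    then show "T (Lplus \<pi> I J e) = 0" unfolding T_def by (simp add: L_snoc_monomial)
  qed
  then show ?thesis by (simp add: T_def)
qed

text \<open>
  The coefficients of \<open>(u - v - h P) L\<^sub>1(u) L\<^sub>2(v) X = L\<^sub>2(v) L\<^sub>1(u) (u - v - h P) X\<close>.
\<close>

definition RTT :: "'a \<Rightarrow> bool" where
  "RTT X \<longleftrightarrow> (\<forall>i j k m p q.
     L i j (p - 1) (L k m q X) - L i j p (L k m (q - 1) X) - sc fps_X (L k j p (L i m q X))
     = L k m q (L i j (p - 1) X) - L k m (q - 1) (L i j p X) - sc fps_X (L k j q (L i m p X)))"

subsection \<open>The relation on the vacuum vector\<close>

text \<open>
  Put \<open>x = u - v\<close> and \<open>S = L\<^sub>1\<^sup>+(u) L\<^sub>2\<^sup>+(v)\<close>. The left side of the RTT relation, multiplied by \<open>x + \<epsilon> h\<close>, is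
  \<open>(x - h P) (x + h P) S = (x + \<epsilon> h) (x - \<epsilon> h) S\<close>, and no negative powers of \<open>v\<close> occur. The right side,
  multiplied by \<open>x - \<epsilon> h\<close>, is \<open>(x - h P) L\<^sub>2\<^sup>+(v) L\<^sub>1\<^sup>+(u) (x - h P)\<close>, which the defining relation relates to
  \<open>S\<close>, and no negative powers of \<open>u\<close> occur. So both sides are \<open>(x - \<epsilon> h) S\<close>.
\<close>

lemma
  defines "S \<equiv> \<lambda>i j k m p q. l i j p * l k m q"
  shows vacuum_left: "lin2 0 (- 1) (\<lambda>i j k m p q. L i j p (l k m q)) = lin2 (- \<epsilon>) 0 S"
    and vacuum_right: "rlin2 (\<lambda>i j k m p q. L k m q (l i j p)) = lin2 (- \<epsilon>) 0 S"
proof -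
  define T where "T = (\<lambda>i j k m p q. l k m q * l i j p)"
  define E where "E = (\<lambda>i j k m p q. L i j p (l k m q))"
  define E' where "E' = (\<lambda>i j k m p q. L k m q (l i j p))"
  have S0: "p < 0 \<Longrightarrow> S i j k m p q = 0" "q < 0 \<Longrightarrow> S i j k m p q = 0" for i j k m p q
    by (auto simp: S_def lplus_negative)
  have E: "lin2 \<epsilon> 0 E = lin2 0 1 S"
  proof (intro ext)
    fix i j k m p q
    show "lin2 \<epsilon> 0 E i j k m p q = lin2 0 1 S i j k m p q"
      using L_snoc [of i j p 1 k m q] by (simp add: lin2_def E_def S_def L_one hs_zero_left)
  qed
  have E': "lin2 (- \<epsilon>) 0 E' = lin2 0 (- 1) T"
  proof (intro ext)
    fix i j k m p q
    have "E' i j k m p (q - 1) - E' i j k m (p - 1) q + hs \<epsilon> (E' i j k m p q)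
      = T i j k m p (q - 1) - T i j k m (p - 1) q + hs 1 (T k j i m p q)"
      using L_snoc [of k m q 1 i j p] by (simp add: E'_def T_def L_one)
    then have "- (E' i j k m p (q - 1) - E' i j k m (p - 1) q + hs \<epsilon> (E' i j k m p q))
      = - (T i j k m p (q - 1) - T i j k m (p - 1) q + hs 1 (T k j i m p q))" by simp
    then show "lin2 (- \<epsilon>) 0 E' i j k m p q = lin2 0 (- 1) T i j k m p q"
      by (simp add: lin2_def hs_zero_left hs_neg)
  qed
  obtain Q where Q1: "\<And>i j k m p q. - Q i j k m (p - 1) q + Q i j k m p (q - 1) - sc (fps_const \<epsilon> * fps_X) (Q i j k m p q)
      = - (l i j (p - 1) * l k m q) + l i j p * l k m (q - 1) - sc fps_X (l k j p * l i m q)"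
    and Q2: "\<And>i j k m p q. Q i j k m (p - 1) q - Q i j k m p (q - 1) - sc (fps_const \<epsilon> * fps_X) (Q i j k m p q)
      = l k m q * l i j (p - 1) - l k m (q - 1) * l i j p - sc fps_X (l k j q * l i m p)"
    using defining_relation by blast
  have QS: "lin2 \<epsilon> 0 Q = lin2 0 1 S"
  proof (intro ext)
    fix i j k m p q
    have "- Q i j k m (p - 1) q + Q i j k m p (q - 1) - hs \<epsilon> (Q i j k m p q)
      = - S i j k m (p - 1) q + S i j k m p (q - 1) - hs 1 (S k j i m p q)"
      using Q1 [of i j k m p q] unfolding S_def hs_one unfolding hs_def .
    then have neg_eq: "- (- Q i j k m (p - 1) q + Q i j k m p (q - 1) - hs \<epsilon> (Q i j k m p q))
      = - (- S i j k m (p - 1) q + S i j k m p (q - 1) - hs 1 (S k j i m p q))"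
      by (rule arg_cong)
    have neg: "- (- x + y - z) = x - y + z" for x y z :: 'a by simp
    show "lin2 \<epsilon> 0 Q i j k m p q = lin2 0 1 S i j k m p q"
      using neg_eq unfolding lin2_def hs_zero_left neg add_0_right .
  qed
  have QT: "lin2 (- \<epsilon>) 0 Q = rlin2 T"
  proof (intro ext)
    fix i j k m p q
    show "lin2 (- \<epsilon>) 0 Q i j k m p q = rlin2 T i j k m p q"
      using Q2 [of i j k m p q] by (simp add: lin2_def rlin2_def T_def hs_zero_left hs_one hs_neg) (simp add: hs_def)
  qed
  have "lin2 \<epsilon> 0 (lin2 0 (- 1) E) = lin2 \<epsilon> 0 (lin2 (- \<epsilon>) 0 S)"
    using lin2_commute [of \<epsilon> 0 0 "- 1" E] lin2_P_squared [OF \<epsilon>_cases, of S] E by simp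
  then show "lin2 0 (- 1) (\<lambda>i j k m p q. L i j p (l k m q)) = lin2 (- \<epsilon>) 0 S"
    unfolding E_def
    by (rule lin2_cancel_right) (simp_all add: lin2_def S0 lplus_negative L_zero hs_simps)
  have "lin2 \<epsilon> 0 (lin2 (- \<epsilon>) 0 (rlin2 E')) = lin2 \<epsilon> 0 (lin2 0 (- 1) (rlin2 T))"
    by (simp add: lin2_rlin2 E')
  also have "\<dots> = lin2 \<epsilon> 0 (lin2 (- \<epsilon>) 0 (lin2 0 (- 1) Q))"
    by (simp add: QT [symmetric] lin2_commute [of 0 "- 1"])
  also have "\<dots> = lin2 (- \<epsilon>) 0 (lin2 0 (- 1) (lin2 \<epsilon> 0 Q))"
    by (metis lin2_commute)
  also have "\<dots> = lin2 (- \<epsilon>) 0 (lin2 \<epsilon> 0 (lin2 (- \<epsilon>) 0 S))"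
    by (simp add: QS lin2_P_squared [OF \<epsilon>_cases])
  also have "\<dots> = lin2 \<epsilon> 0 (lin2 (- \<epsilon>) 0 (lin2 (- \<epsilon>) 0 S))"
    by (metis lin2_commute)
  finally have "lin2 (- \<epsilon>) 0 (rlin2 E') = lin2 (- \<epsilon>) 0 (lin2 (- \<epsilon>) 0 S)"
    by (rule lin2_cancel_left) (simp_all add: lin2_def rlin2_def S0 E'_def lplus_negative L_zero hs_simps)
  then show "rlin2 (\<lambda>i j k m p q. L k m q (l i j p)) = lin2 (- \<epsilon>) 0 S"
    unfolding E'_def
    by (rule lin2_cancel_left) (simp_all add: lin2_def rlin2_def S0 lplus_negative L_zero hs_simps)
qed

lemma RTT_one: "RTT 1"
  unfolding RTT_def
proof (intro allI)
  fix i j k m p q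
  have "lin2 0 (- 1) (\<lambda>i j k m p q. L i j p (l k m q)) i j k m p q = rlin2 (\<lambda>i j k m p q. L k m q (l i j p)) i j k m p q"
    unfolding vacuum_left vacuum_right ..
  then show "L i j (p - 1) (L k m q 1) - L i j p (L k m (q - 1) 1) - sc fps_X (L k j p (L i m q 1))
     = L k m q (L i j (p - 1) 1) - L k m (q - 1) (L i j p 1) - sc fps_X (L k j q (L i m p 1))"
    by (simp add: lin2_def rlin2_def L_one hs_zero_left hs_neg hs_one)
qed

subsection \<open>The relation on all monomials\<close>

text \<open>
  Let \<open>\<Lambda> = (u - y + \<epsilon> h) (v - y + \<epsilon> h)\<close>, with \<open>y\<close> the variable of the new factor. Moving \<open>L\<^sub>1(u) L\<^sub>2(v)\<close> past it gives
  \<open>\<Lambda> L\<^sub>1(u) L\<^sub>2(v) (X L\<^sub>3\<^sup>+(y)) = (v - y + h P\<^bsub>23\<^esub>) (u - y + h P\<^bsub>13\<^esub>) (L\<^sub>1(u) L\<^sub>2(v) X) L\<^sub>3\<^sup>+(y)\<close>, and the opposite order of the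
  operators gives the opposite order of the two factors. The Yang-Baxter equation exchanges these
  orders at the cost of moving \<open>u - v - h P\<^bsub>12\<^esub>\<close> to the inside, where the relation for \<open>X\<close> applies.
\<close>

lemma RTT_snoc:
  assumes X: "RTT X"
  shows "RTT (X * l a' n b')"
  unfolding RTT_def
proof (intro allI)
  fix i0 j k0 m p0 q0
  define G where "G = (\<lambda>j m i k a p q b. L i j p (L k m q (X * l a n b)))"
  define K where "K = (\<lambda>j m i k a p q b. L i j p (L k m q X * l a n b))"
  define F where "F = (\<lambda>j m i k a p q b. L i j p (L k m q X) * l a n b)"
  define G' where "G' = (\<lambda>j m i k a p q b. L k m q (L i j p (X * l a n b)))"
  define K' where "K' = (\<lambda>j m i k a p q b. L k m q (L i j p X * l a n b))"
  define F' where "F' = (\<lambda>j m i k a p q b. L k m q (L i j p X) * l a n b)"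
  have GK: "lin23 \<epsilon> 0 (G j m) = lin23 0 1 (K j m)" for j m
  proof (intro ext)
    fix i k a p q b
    show "lin23 \<epsilon> 0 (G j m) i k a p q b = lin23 0 1 (K j m) i k a p q b"
      using arg_cong [where f = "L i j p", OF L_snoc [of k m q X a n b]]
      by (simp add: lin23_def G_def K_def L_add L_diff L_hs hs_zero_left)
  qed
  have KF: "lin13 \<epsilon> 0 (K j m) = lin13 0 1 (F j m)" for j m
  proof (intro ext)
    fix i k a p q b
    show "lin13 \<epsilon> 0 (K j m) i k a p q b = lin13 0 1 (F j m) i k a p q b"
      using L_snoc [of i j p "L k m q X" a n b]
      by (simp add: lin13_def K_def F_def hs_zero_left)
  qed
  have GK': "lin13 \<epsilon> 0 (G' j m) = lin13 0 1 (K' j m)" for j m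
  proof (intro ext)
    fix i k a p q b
    show "lin13 \<epsilon> 0 (G' j m) i k a p q b = lin13 0 1 (K' j m) i k a p q b"
      using arg_cong [where f = "L k m q", OF L_snoc [of i j p X a n b]]
      by (simp add: lin13_def G'_def K'_def L_add L_diff L_hs hs_zero_left)
  qed
  have KF': "lin23 \<epsilon> 0 (K' j m) = lin23 0 1 (F' j m)" for j m
  proof (intro ext)
    fix i k a p q b
    show "lin23 \<epsilon> 0 (K' j m) i k a p q b = lin23 0 1 (F' j m) i k a p q b"
      using L_snoc [of k m q "L i j p X" a n b]
      by (simp add: lin23_def K'_def F'_def hs_zero_left)
  qed
  have GF': "lin23 \<epsilon> 0 (lin13 \<epsilon> 0 (G' j m)) = lin13 0 1 (lin23 0 1 (F' j m))" for j m
    by (simp add: GK' lin23_lin13 KF')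
  have IH: "lin12 0 (- 1) (F j m) = comb12 (F' j m) (F' m j)"
  proof (intro ext)
    fix i k a p q b
    have "L i j (p - 1) (L k m q X) - L i j p (L k m (q - 1) X) - hs 1 (L k j p (L i m q X))
     = L k m q (L i j (p - 1) X) - L k m (q - 1) (L i j p X) - hs 1 (L k j q (L i m p X))"
      using X unfolding RTT_def hs_one by blast
    from arg_cong [where f = "\<lambda>x. x * l a n b", OF this]
    show "lin12 0 (- 1) (F j m) i k a p q b = comb12 (F' j m) (F' m j) i k a p q b"
      by (simp add: lin12_def comb12_def F_def F'_def left_diff_distrib hs_mult hs_zero_left hs_neg)
  qed
  have "lin13 \<epsilon> 0 (lin23 \<epsilon> 0 (lin12 0 (- 1) (G j m))) = lin12 0 (- 1) (lin23 0 1 (lin13 0 1 (F j m)))"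
    by (simp only: lin23_lin12 GK lin13_lin12 lin13_lin23 KF)
  also have "\<dots> = lin13 0 1 (lin23 0 1 (comb12 (F' j m) (F' m j)))"
    by (simp only: Yang_Baxter IH)
  also have "\<dots> = lin13 \<epsilon> 0 (lin23 \<epsilon> 0 (comb12 (G' j m) (G' m j)))"
    by (simp only: lin13_lin23 lin13_comb12 lin23_comb12 GF')
  finally have "lin23 \<epsilon> 0 (lin12 0 (- 1) (G j m)) = lin23 \<epsilon> 0 (comb12 (G' j m) (G' m j))"
    by (rule lin13_cancel)
      (simp_all add: lin23_def lin12_def comb12_def G_def G'_def lplus_negative L_zero hs_simps)
  then have "lin12 0 (- 1) (G j m) = comb12 (G' j m) (G' m j)"
    by (rule lin23_cancel) (simp_all add: lin12_def comb12_def G_def G'_def lplus_negative L_zero hs_simps)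
  from fun_cong [OF fun_cong [OF fun_cong [OF fun_cong [OF fun_cong [OF fun_cong [OF this]]]]], of i0 k0 a' p0 q0 b']
  show "L i0 j (p0 - 1) (L k0 m q0 (X * l a' n b')) - L i0 j p0 (L k0 m (q0 - 1) (X * l a' n b'))
      - sc fps_X (L k0 j p0 (L i0 m q0 (X * l a' n b')))
     = L k0 m q0 (L i0 j (p0 - 1) (X * l a' n b')) - L k0 m (q0 - 1) (L i0 j p0 (X * l a' n b'))
      - sc fps_X (L k0 j q0 (L i0 m p0 (X * l a' n b')))"
    by (simp add: lin12_def comb12_def G_def G'_def hs_zero_left hs_neg hs_one)
qed

lemma RTT_monomial: "length I = n \<Longrightarrow> length J = n \<Longrightarrow> length e = n \<Longrightarrow> RTT (Lplus \<pi> I J e)"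
proof (induction n arbitrary: I J e)
  case 0
  then show ?case by (simp add: Lplus_Nil RTT_one)
next
  case (Suc n)
  obtain I' k where I: "I = I' @ [k]" "length I' = n" using Suc.prems(1) by (metis length_Suc_conv_rev)
  obtain J' m where J: "J = J' @ [m]" "length J' = n" using Suc.prems(2) by (metis length_Suc_conv_rev)
  obtain e' b where e: "e = e' @ [b]" "length e' = n" using Suc.prems(3) by (metis length_Suc_conv_rev)
  show ?case unfolding I(1) J(1) e(1) Lplus_snoc [OF I(2) J(2) e(2)]
    by (rule RTT_snoc [OF Suc.IH]) fact+
qed

theorem RTT: "RTT X"
  unfolding RTT_def
proof (intro allI)
  fix i j k m p q
  define T where "T X = L i j (p - 1) (L k m q X) - L i j p (L k m (q - 1) X) - sc fps_X (L k j p (L i m q X))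
     - (L k m q (L i j (p - 1) X) - L k m (q - 1) (L i j p X) - sc fps_X (L k j q (L i m p X)))" for X
  have "T X = 0"
  proof (rule monomials_dense [where T = T and x = X, OF _ hseparated_axioms])
    have "T (x + y) = T x + T y" for x y
      by (simp add: T_def L_add scale_right_distrib algebra_simps)
    moreover have "T (sc c x) = sc c (T x)" for c x
      by (simp add: T_def L_scale scale_right_diff_distrib mult.commute)
    ultimately show "module_hom sc sc T" by (simp add: module_hom_iff module_axioms)
    fix I J :: "'b list" and e :: "int list" and n assume "length I = n" "length J = n" "length e = n"
    then have "RTT (Lplus \<pi> I J e)" by (rule RTT_monomial)
    then show "T (Lplus \<pi> I J e) = 0" unfolding T_def RTT_def by simp
  qed
  then show "L i j (p - 1) (L k m q X) - L i j p (L k m (q - 1) X) - sc fps_X (L k j p (L i m q X))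
     = L k m q (L i j (p - 1) X) - L k m (q - 1) (L i j p X) - sc fps_X (L k j q (L i m p X))"
    by (simp add: T_def)
qed

end

section \<open>The two expansions of \<open>(1 + s)\<^sup>p\<close>\<close>

text \<open>The coefficient of \<open>s\<^sup>a\<close> in \<open>(1 + s)\<^sup>p\<close>, expanded in descending and in ascending powers of \<open>s\<close>.\<close>

definition desc_binom :: "int \<Rightarrow> int \<Rightarrow> complex" where
  "desc_binom p a = (if a \<le> p then of_int p gchoose nat (p - a) else 0)"

definition asc_binom :: "int \<Rightarrow> int \<Rightarrow> complex" where
  "asc_binom p a = (if 0 \<le> a then of_int p gchoose nat a else 0)"

text \<open>Multiplication by \<open>1 + s\<close>.\<close>

definition pascal :: "(int \<Rightarrow> complex) \<Rightarrow> int \<Rightarrow> complex" where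
  "pascal g a = g a + g (a - 1)"

lemma gbinomial_step: "(of_int (p + 1) :: complex) gchoose Suc k = (of_int p gchoose k) + (of_int p gchoose Suc k)"
  using gbinomial_Suc_Suc [of "of_int p :: complex" k] by simp

lemma pascal_desc: "pascal (desc_binom p) = desc_binom (p + 1)"
proof
  fix a :: int
  consider "a \<le> p" | "a = p + 1" | "a > p + 1" by linarith
  then show "pascal (desc_binom p) a = desc_binom (p + 1) a"
  proof cases
    case 1
    then have "nat (p - (a - 1)) = Suc (nat (p - a))" "nat (p + 1 - a) = Suc (nat (p - a))" by auto
    then show ?thesis using 1 by (simp add: pascal_def desc_binom_def gbinomial_step del: of_int_add)
  qed (auto simp: pascal_def desc_binom_def)
qed

lemma pascal_asc: "pascal (asc_binom p) = asc_binom (p + 1)"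
proof
  fix a :: int
  consider "a < 0" | "a = 0" | "a > 0" by linarith
  then show "pascal (asc_binom p) a = asc_binom (p + 1) a"
  proof cases
    case 3
    then have "nat a = Suc (nat (a - 1))" by auto
    then show ?thesis using 3 by (simp add: pascal_def asc_binom_def gbinomial_step del: of_int_add)
  qed (auto simp: pascal_def asc_binom_def)
qed

lemma desc_eq_asc: "0 \<le> p \<Longrightarrow> desc_binom p = asc_binom p"
proof
  fix a assume p: "0 \<le> p"
  then obtain n where n: "p = int n" by (metis zero_le_imp_eq_int)
  consider "a < 0" | "0 \<le> a" "a \<le> p" | "a > p" by linarith
  then show "desc_binom p a = asc_binom p a"
  proof cases
    case 1
    then have "n < nat (p - a)" using n by auto
    then show ?thesis using 1 p by (simp add: desc_binom_def asc_binom_def n flip: binomial_gbinomial)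
  next
    case 2
    then obtain k where k: "a = int k" "k \<le> n" using n by (metis of_nat_le_iff zero_le_imp_eq_int)
    then have "nat (p - a) = n - k" using n by auto
    then show ?thesis using 2 k by (simp add: desc_binom_def asc_binom_def n binomial_symmetric [of k n] flip: binomial_gbinomial)
  next
    case 3
    then have "n < nat a" using n by auto
    then show ?thesis using 3 p by (simp add: desc_binom_def asc_binom_def n flip: binomial_gbinomial)
  qed
qed

lemma desc_binom_above: "p < a \<Longrightarrow> desc_binom p a = 0"
  and desc_binom_diag: "desc_binom p p = 1"
  by (simp_all add: desc_binom_def)

lemma pascal_pow_desc: "(pascal ^^ r) (desc_binom p) = desc_binom (p + int r)"
  by (induction r) (simp_all add: pascal_desc add_ac)

lemma pascal_pow_asc: "(pascal ^^ r) (asc_binom p) = asc_binom (p + int r)"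
  by (induction r) (simp_all add: pascal_asc add_ac)

lemma pascal_pow_lincomb:
  "(pascal ^^ r) (\<lambda>a. c * f a + d * g a) = (\<lambda>a. c * (pascal ^^ r) f a + d * (pascal ^^ r) g a)"
proof (induction r)
  case (Suc r)
  then show ?case by (simp add: fun_eq_iff) (simp add: pascal_def algebra_simps)
qed simp

lemma pascal_pow_sum: "(pascal ^^ r) (\<lambda>a. \<Sum>p\<in>A. b p * g p a) = (\<lambda>a. \<Sum>p\<in>A. b p * (pascal ^^ r) (g p) a)"
proof (induction r)
  case (Suc r)
  then show ?case by (simp add: fun_eq_iff) (simp add: pascal_def sum.distrib algebra_simps)
qed simp

lemma pascal_pow_shift: "(pascal ^^ r) (\<lambda>a. g (a - 1)) = (\<lambda>a. (pascal ^^ r) g (a - 1))"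
proof (induction r)
  case (Suc r)
  then show ?case by (simp add: fun_eq_iff) (simp add: pascal_def)
qed simp

lemma pascal_pow_below: "(\<And>a. a < A \<Longrightarrow> g a = 0) \<Longrightarrow> a < A \<Longrightarrow> (pascal ^^ r) g a = 0"
  by (induction r arbitrary: a) (simp_all add: pascal_def)

lemma pascal_pow_above: "(\<And>a. A < a \<Longrightarrow> g a = 0) \<Longrightarrow> A + int r < a \<Longrightarrow> (pascal ^^ r) g a = 0"
  by (induction r arbitrary: a) (simp_all add: pascal_def)

lemma pascal_inj_below:
  assumes "\<And>a. pascal g a = 0" "\<And>a. a < A \<Longrightarrow> g a = 0"
  shows "g a = 0"
proof (cases "a < A")
  case False
  have "g (A + int n) = 0" for n
  proof (induction n)
    case 0
    then show ?case using assms(1) [of A] assms(2) [of "A - 1"] by (simp add: pascal_def)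
  next
    case (Suc n)
    then show ?case using assms(1) [of "A + int (Suc n)"] by (simp add: pascal_def add_ac)
  qed
  from this [of "nat (a - A)"] show ?thesis using False by simp
qed (rule assms(2))

lemma pascal_inj_above:
  assumes "\<And>a. pascal g a = 0" "\<And>a. A < a \<Longrightarrow> g a = 0"
  shows "g a = 0"
proof (cases "A < a")
  case False
  have "g (A - int n) = 0" for n
  proof (induction n)
    case 0
    then show ?case using assms(1) [of "A + 1"] assms(2) [of "A + 1"] by (simp add: pascal_def)
  next
    case (Suc n)
    then show ?case using assms(1) [of "A - int n"] by (simp add: pascal_def algebra_simps)
  qed
  from this [of "nat (A - a)"] show ?thesis using False by simp
qed (rule assms(2))

lemma pascal_pow_inj_below:
  assumes "\<And>a. (pascal ^^ r) g a = 0" "\<And>a. a < A \<Longrightarrow> g a = 0"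
  shows "g a = 0"
  using assms(1)
proof (induction r arbitrary: a)
  case (Suc r)
  have "(pascal ^^ r) g a = 0" for a
    by (rule pascal_inj_below [where A = A]) (use Suc.prems pascal_pow_below [of A g, OF assms(2)] in auto)
  then show ?case by (rule Suc.IH)
qed simp

lemma pascal_pow_inj_above:
  assumes "\<And>a. (pascal ^^ r) g a = 0" "\<And>a. A < a \<Longrightarrow> g a = 0"
  shows "g a = 0"
  using assms(1)
proof (induction r arbitrary: a)
  case (Suc r)
  have "(pascal ^^ r) g a = 0" for a
    by (rule pascal_inj_above [where A = "A + int r"]) (use Suc.prems pascal_pow_above [of A g, OF assms(2)] in auto)
  then show ?case by (rule Suc.IH)
qed simp

lemma desc_triangular:
  assumes sum: "\<And>a. (\<Sum>p\<in>{a..P}. d p * desc_binom p a) = 0" and above: "\<And>p. P < p \<Longrightarrow> d p = 0"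
  shows "d p = 0"
proof (cases "P < p")
  case False
  have "d (P - int n) = 0" for n
  proof (induction n rule: less_induct)
    case (less n)
    have zero: "d p = 0" if "p \<in> {P - int n..P} - {P - int n}" for p
      using less [of "nat (P - p)"] that by auto
    have "0 = (\<Sum>p\<in>{P - int n..P}. d p * desc_binom p (P - int n))" by (rule sum [symmetric])
    also have "\<dots> = (\<Sum>p\<in>{P - int n}. d p * desc_binom p (P - int n))"
      using zero by (intro sum.mono_neutral_right) auto
    finally show ?case by (simp add: desc_binom_diag)
  qed
  from this [of "nat (P - p)"] show ?thesis using False by simp
qed (rule above)

text \<open>
  Let \<open>b(t) = \<Sum> b\<^sub>p t\<^sup>p\<close> be bounded above and \<open>f(s)\<close> a power series. If \<open>t\<^sup>r b(t)\<close> at \<open>t = 1 + s\<close>, expanded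
  in descending powers of \<open>s\<close>, equals \<open>(1 + s)\<^sup>r f(s)\<close>, then \<open>b\<close> is a Laurent polynomial and \<open>f\<close> is
  its ascending expansion at \<open>t = 1 + s\<close>: the part of \<open>b\<close> below \<open>t\<^bsup>-r\<^esup>\<close> contributes only negative
  powers of \<open>s\<close> and the remaining difference only nonnegative ones.
\<close>

lemma ascending_expansion:
  assumes above: "\<And>p. P < p \<Longrightarrow> b p = 0" and below: "\<And>a. a < 0 \<Longrightarrow> f a = 0"
    and eq: "(pascal ^^ r) (\<lambda>a. \<Sum>p\<in>{a..P}. b p * desc_binom p a) = (pascal ^^ r) f"
  shows "p < - int r \<Longrightarrow> b p = 0"
    and "f a = (\<Sum>p\<in>{- int r..P}. b p * asc_binom p a)"
proof -
  define d where "d p = (if p < - int r then b p else 0)" for p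
  define g where "g a = (\<Sum>p\<in>{a..P}. d p * desc_binom p a)" for a
  define c where "c a = (\<Sum>p\<in>{- int r..P}. b p * desc_binom p a)" for a
  define c' where "c' a = (\<Sum>p\<in>{- int r..P}. b p * asc_binom p a)" for a
  have split: "(\<Sum>p\<in>{a..P}. b p * desc_binom p a) = 1 * g a + 1 * c a" for a
  proof -
    have "c a = (\<Sum>p\<in>{- int r..P} \<inter> {a..P}. b p * desc_binom p a)"
      unfolding c_def by (intro sum.mono_neutral_right) (auto intro: desc_binom_above)
    also have "\<dots> = (\<Sum>p\<in>{a..P}. (b p - d p) * desc_binom p a)"
      by (intro sum.mono_neutral_cong_left) (auto simp: d_def)
    finally show ?thesis by (simp add: g_def sum.distrib [symmetric] algebra_simps)
  qed
  have cc': "(pascal ^^ r) c = (pascal ^^ r) c'"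
    unfolding c_def c'_def pascal_pow_sum pascal_pow_desc pascal_pow_asc
    by (intro ext sum.cong) (simp_all add: desc_eq_asc)
  have sum0: "(pascal ^^ r) g a = (pascal ^^ r) (\<lambda>a. 1 * f a + (- 1) * c' a) a" for a
  proof -
    have "(pascal ^^ r) (\<lambda>a. 1 * g a + 1 * c a) = (pascal ^^ r) f" using eq unfolding split .
    from fun_cong [OF this, of a] show ?thesis
      unfolding pascal_pow_lincomb cc' by (simp add: eq_diff_eq)
  qed
  have g_above: "g a = 0" if "- int r - 1 < a" for a
    unfolding g_def using that by (intro sum.neutral) (auto simp: d_def)
  have c'_below: "1 * f a + (- 1) * c' a = 0" if "a < 0" for a
    using that below by (simp add: c'_def asc_binom_def)
  have z: "(pascal ^^ r) g a = 0" for a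
  proof (cases "a < 0")
    case True
    show ?thesis unfolding sum0 using c'_below True by (rule pascal_pow_below)
  next
    case False
    show ?thesis by (rule pascal_pow_above [of "- int r - 1"]) (use g_above False in auto)
  qed
  have "g a = 0" for a by (rule pascal_pow_inj_above [OF z g_above])
  then have d_sum: "(\<Sum>p\<in>{a..P}. d p * desc_binom p a) = 0" for a
    unfolding g_def [symmetric] .
  have "d p = 0" for p
    by (rule desc_triangular [OF d_sum]) (simp add: d_def above)
  then have "d p = 0" .
  then show "b p = 0" if "p < - int r"
    using that by (simp add: d_def)
  have "1 * f a + (- 1) * c' a = 0"
    by (rule pascal_pow_inj_below [of r "\<lambda>a. 1 * f a + (- 1) * c' a", OF _ c'_below]) (use z sum0 in simp)
  then show "f a = (\<Sum>p\<in>{- int r..P}. b p * asc_binom p a)" by (simp add: c'_def)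
qed

text \<open>
  Multiplication by a power of \<open>1 + s\<close> makes all exponents nonnegative; then the ascending expansions
  are the descending ones, which are triangular.
\<close>

lemma asc_independent:
  assumes fin: "finite A" and sum: "\<And>a. (\<Sum>q\<in>A. c q * asc_binom q a) = 0" and q: "q \<in> A"
  shows "c q = 0"
proof -
  obtain m where m: "\<And>q. q \<in> A \<Longrightarrow> \<bar>q\<bar> \<le> int m"
  proof -
    have "finite ((\<lambda>q. nat \<bar>q\<bar>) ` A)" using fin by simp
    then obtain m where "\<And>x. x \<in> (\<lambda>q. nat \<bar>q\<bar>) ` A \<Longrightarrow> x \<le> m" by (meson finite_nat_set_iff_bounded_le)
    then show ?thesis using that by (metis imageI nat_le_iff)
  qed
  define d where "d p = (if p - int m \<in> A then c (p - int m) else 0)" for p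
  have "(pascal ^^ m) (\<lambda>a. \<Sum>q\<in>A. c q * asc_binom q a) = (pascal ^^ m) (\<lambda>a. 0 * 0 + 0 * 0)"
    unfolding sum by simp
  then have shifted: "(\<Sum>q\<in>A. c q * asc_binom (q + int m) a) = 0" for a
    unfolding pascal_pow_sum pascal_pow_asc pascal_pow_lincomb by (simp add: fun_eq_iff)
  have img: "p \<in> (\<lambda>q. q + int m) ` A \<longleftrightarrow> p - int m \<in> A" for p
    by (auto simp: image_iff intro!: bexI [of _ "p - int m"])
  have "(\<Sum>p\<in>{a..2 * int m}. d p * desc_binom p a) = 0" for a
  proof -
    have "0 = (\<Sum>q\<in>A. c q * desc_binom (q + int m) a)"
      unfolding shifted [of a, symmetric] using m by (intro sum.cong) (force simp: desc_eq_asc)+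
    also have "\<dots> = (\<Sum>p\<in>(\<lambda>q. q + int m) ` A. d p * desc_binom p a)"
      by (subst sum.reindex) (auto simp: d_def inj_on_def)
    also have "\<dots> = (\<Sum>p\<in>(\<lambda>q. q + int m) ` A \<inter> {a..2 * int m}. d p * desc_binom p a)"
      using fin m by (intro sum.mono_neutral_right) (force intro: desc_binom_above)+
    also have "\<dots> = (\<Sum>p\<in>{a..2 * int m}. d p * desc_binom p a)"
      by (intro sum.mono_neutral_left) (auto simp: d_def img)
    finally show ?thesis by simp
  qed
  moreover have "d p = 0" if "2 * int m < p" for p
    using m [of "p - int m"] that by (auto simp: d_def)
  ultimately have "d (q + int m) = 0" by (rule desc_triangular)
  then show ?thesis using q by (simp add: d_def)
qed

lemma gbinomial_derivative: "of_nat (Suc k) * (x gchoose Suc k) = (x - of_nat k) * (x gchoose k)" for x :: complex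
  using gbinomial_mult_1 [of x k] by (simp add: algebra_simps)

text \<open>
  If \<open>G\<close> is invariant under simultaneous translation of its two variables, in the form of an
  Euler-type identity between its Taylor coefficients, then it is determined on one axis by its
  restriction to the other.
\<close>

lemma translation_determines:
  fixes n :: int
  assumes euler: "\<And>a c. of_nat (Suc a) * G (Suc a) c + of_nat (Suc c) * G a (Suc c)
      = (of_int n - of_nat a - of_nat c) * (G a c :: complex)"
    and G0: "\<And>a. G a 0 = (\<Sum>p\<in>A. b p * asc_binom p (int a))"
    and fin: "finite A" "finite A'" and out: "\<And>p. p \<notin> A \<Longrightarrow> b p = 0" "\<And>p. p \<notin> A' \<Longrightarrow> b' p = 0"
    and G0': "\<And>c. G 0 c = (\<Sum>q\<in>A'. b' q * asc_binom q (int c))"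
  shows "b p = b' (n - p)"
proof -
  have G: "G a c = (\<Sum>p\<in>A. b p * ((of_int p gchoose a) * (of_int (n - p) gchoose c)))" for a c
  proof (induction c arbitrary: a)
    case 0
    then show ?case by (simp add: G0 asc_binom_def)
  next
    case (Suc c)
    have "of_nat (Suc c) * G a (Suc c) = (of_int n - of_nat a - of_nat c) * G a c - of_nat (Suc a) * G (Suc a) c"
      using euler [of a c] by (simp add: algebra_simps)
    also have "\<dots> = (\<Sum>p\<in>A. b p * ((of_int n - of_nat a - of_nat c) * ((of_int p gchoose a) * (of_int (n - p) gchoose c))
        - (of_nat (Suc a) * (of_int p gchoose Suc a)) * (of_int (n - p) gchoose c)))"
      unfolding Suc.IH sum_distrib_left sum_subtractf [symmetric]
      by (intro sum.cong) (simp_all add: algebra_simps)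
    also have "\<dots> = (\<Sum>p\<in>A. b p * ((of_int p gchoose a) * (of_nat (Suc c) * (of_int (n - p) gchoose Suc c))))"
      unfolding gbinomial_derivative by (intro sum.cong) (simp_all add: algebra_simps)
    also have "\<dots> = of_nat (Suc c) * (\<Sum>p\<in>A. b p * ((of_int p gchoose a) * (of_int (n - p) gchoose Suc c)))"
      unfolding sum_distrib_left by (intro sum.cong) (simp_all add: mult_ac)
    finally show ?case by (simp only: mult_cancel_left of_nat_eq_0_iff) simp
  qed
  define Q where "Q = A' \<union> (\<lambda>p. n - p) ` A"
  have "(\<Sum>q\<in>Q. (b' q - b (n - q)) * asc_binom q a) = 0" for a
  proof (cases "a < 0")
    case False
    then obtain c where c: "a = int c" by (metis not_le zero_le_imp_eq_int)
    have "(\<Sum>q\<in>Q. b' q * asc_binom q a) = (\<Sum>q\<in>A'. b' q * asc_binom q a)"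
      using fin out by (intro sum.mono_neutral_right) (auto simp: Q_def)
    moreover have "(\<Sum>q\<in>Q. b (n - q) * asc_binom q a) = (\<Sum>q\<in>(\<lambda>p. n - p) ` A. b (n - q) * asc_binom q a)"
      using fin out by (intro sum.mono_neutral_right) (force simp: Q_def image_iff)+
    moreover have "\<dots> = (\<Sum>p\<in>A. b p * asc_binom (n - p) a)"
      by (subst sum.reindex) (auto simp: inj_on_def)
    ultimately show ?thesis
      using G0' [of c] G [of 0 c] by (simp add: left_diff_distrib sum_subtractf c asc_binom_def)
  qed (simp add: asc_binom_def)
  moreover have "finite Q" using fin by (simp add: Q_def)
  ultimately have "b' q - b (n - q) = 0" if "q \<in> Q" for q
    using asc_independent [of Q "\<lambda>q. b' q - b (n - q)"] that by blast
  moreover have "b' q - b (n - q) = 0" if "q \<notin> Q" for q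
  proof -
    have "q \<notin> A'" "n - q \<notin> A" using that by (auto simp: Q_def image_iff)
    then show ?thesis using out by simp
  qed
  ultimately have "b' (n - p) - b (n - (n - p)) = 0" by blast
  then show ?thesis by simp
qed

lemma pascal_pow_binomial: "(pascal ^^ r) g a = (\<Sum>i\<le>r. of_nat (r choose i) * g (a - int (r - i)))"
proof -
  have "(pascal ^^ r) g a = (\<Sum>j\<le>r. of_nat (r choose j) * g (a - int j))"
  proof (induction r arbitrary: a)
    case (Suc r)
    have "(pascal ^^ Suc r) g a = (\<Sum>j\<le>r. of_nat (r choose j) * g (a - int j)) + (\<Sum>j\<le>r. of_nat (r choose j) * g (a - 1 - int j))"
      by (simp add: pascal_def Suc.IH)
    also have "(\<Sum>j\<le>r. of_nat (r choose j) * g (a - int j)) = (\<Sum>j\<le>Suc r. of_nat (r choose j) * g (a - int j))"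
      by simp
    also have "\<dots> = g a + (\<Sum>j\<le>r. of_nat (r choose Suc j) * g (a - 1 - int j))"
      by (subst sum.atMost_Suc_shift) (simp add: diff_diff_eq)
    also have "\<dots> + (\<Sum>j\<le>r. of_nat (r choose j) * g (a - 1 - int j))
        = g a + (\<Sum>j\<le>r. of_nat (Suc r choose Suc j) * g (a - 1 - int j))"
      by (simp add: sum.distrib distrib_right add_ac)
    also have "\<dots> = (\<Sum>j\<le>Suc r. of_nat (Suc r choose j) * g (a - int j))"
      by (subst sum.atMost_Suc_shift) (simp add: diff_diff_eq)
    finally show ?case .
  qed simp
  also have "\<dots> = (\<Sum>i\<le>r. of_nat (r choose i) * g (a - int (r - i)))"
    by (rule sum.reindex_bij_witness [where i = "\<lambda>i. r - i" and j = "\<lambda>j. r - j"])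
      (auto simp: binomial_symmetric [symmetric])
  finally show ?thesis .
qed

section \<open>Functionals modulo \<open>h\<^sup>k\<close>\<close>

context hseparated
begin

text \<open>
  Complex linear functionals on \<open>W/h\<^sup>kW\<close>. They turn an \<open>h\<close>-adic sum into a finite sum and a congruence
  modulo \<open>h\<^sup>k\<close> into an equality of complex numbers.
\<close>

definition functional :: "nat \<Rightarrow> ('w \<Rightarrow> complex) \<Rightarrow> bool" where
  "functional k \<phi> \<longleftrightarrow> (\<forall>x y. \<phi> (x + y) = \<phi> x + \<phi> y) \<and> (\<forall>c x. \<phi> (sc (fps_const c) x) = c * \<phi> x) \<and> (\<forall>x\<in>hp k. \<phi> x = 0)"

lemma functional_add: "functional k \<phi> \<Longrightarrow> \<phi> (x + y) = \<phi> x + \<phi> y"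
  and functional_scale: "functional k \<phi> \<Longrightarrow> \<phi> (sc (fps_const c) x) = c * \<phi> x"
  and functional_hp: "functional k \<phi> \<Longrightarrow> x \<in> hp k \<Longrightarrow> \<phi> x = 0"
  by (auto simp: functional_def)

lemma functional_zero: "functional k \<phi> \<Longrightarrow> \<phi> 0 = 0"
  by (rule functional_hp) auto

lemma functional_diff: "functional k \<phi> \<Longrightarrow> \<phi> (x - y) = \<phi> x - \<phi> y"
  using functional_add [of k \<phi> "x - y" y] by simp

lemma functional_sum: "functional k \<phi> \<Longrightarrow> \<phi> (sum f A) = (\<Sum>i\<in>A. \<phi> (f i))"
  by (induction A rule: infinite_finite_induct) (simp_all add: functional_zero functional_add)

lemma functional_h: "functional k \<phi> \<Longrightarrow> functional k (\<lambda>x. \<phi> (hs c x))"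
proof -
  assume \<phi>: "functional k \<phi>"
  have "hs c (sc d x) = sc d (hs c x)" for d x unfolding hs_def by (rule scale_left_commute)
  then show ?thesis
    using \<phi> hs_hp [of _ k c] hp_antimono [of k "Suc k"]
    unfolding functional_def by (simp add: hs_add)
qed

lemma functionals_separate:
  assumes "\<And>k \<phi>. functional k \<phi> \<Longrightarrow> \<phi> x = 0"
  shows "x = 0"
proof (rule separated, rule ccontr)
  fix k assume x: "x \<notin> hp k"
  let ?s = "\<lambda>c. sc (fps_const c)"
  interpret v: vector_space ?s
    by standard (simp_all add: scale_right_distrib scale_left_distrib flip: fps_const_add)
  interpret p: vector_space_pair ?s "(*) :: complex \<Rightarrow> complex \<Rightarrow> complex"
    by standard (simp_all add: algebra_simps)
  have sub: "v.subspace (hp k)"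
    by (auto simp: v.subspace_def intro: hp_add hp_scale)
  obtain B where B: "B \<subseteq> hp k" "\<not> v.dependent B" "hp k \<subseteq> v.span B"
    using v.maximal_independent_subset [of "hp k"] by metis
  have "v.span B \<subseteq> hp k" using v.span_minimal [OF B(1) sub] .
  then have "x \<notin> v.span B" using x by blast
  then have ind: "\<not> v.dependent (insert x B)" using B(2) by (simp add: v.independent_insertI)
  obtain g where g: "Vector_Spaces.linear ?s (*) g" "\<forall>y\<in>insert x B. g y = (if y = x then 1 else 0)"
    using p.linear_independent_extend [OF ind, of "\<lambda>y. if y = x then 1 else 0"] by metis
  have "g y = 0" if "y \<in> B" for y using g(2) that B(1) x by auto
  then have "g y = 0" if "y \<in> hp k" for y
    using p.linear_eq_0_on_span [OF g(1), of B] B(3) that by blast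
  moreover have "g (y + z) = g y + g z" "g (?s c y) = c * g y" for y z c
    using g(1) by (simp_all add: p.linear_add p.linear_scale)
  ultimately have "functional k g" by (simp add: functional_def)
  then show False using assms g(2) by fastforce
qed

end

section \<open>The vertex operators of generators and quadratic monomials\<close>

lemma (in hcomplete) taylor_lmul:
  fixes M :: "('n::finite, complex fps) mser"
  assumes M: "tame n M" and X: "taylor n X"
  shows "taylor n (mser_lmul sc n M X)"
  unfolding taylor_def
proof (intro allI impI)
  fix I J :: "'n list" and e :: "int list"
  assume e: "length e = n" and "\<exists>m\<in>{1..<n}. e ! m < 0"
  then obtain m where m: "m \<in> {1..<n}" "e ! m < 0" by blast
  have "has_hsum sc (\<lambda>(K, d). sc (M I K d) (X K J (map2 (-) e d))) (ix n) 0"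
  proof (rule has_hsum_zero, clarify)
    fix K :: "'n list" and d :: "int list" assume d: "n = length K" "length d = length K"
    show "sc (M I K d) (X K J (map2 (-) e d)) = 0"
    proof (cases "M I K d = 0")
      case False
      then have "0 \<le> d ! m" using tame_support [OF M, of d I K] d m by auto
      then have "map2 (-) e d ! m < 0" "length (map2 (-) e d) = n" using m e d by auto
      then have "X K J (map2 (-) e d) = 0" using X m unfolding taylor_def by blast
      then show ?thesis by simp
    qed simp
  qed
  then show "mser_lmul sc n M X I J e = 0" unfolding mser_lmul_def by (rule hsum_eq)
qed

lemma binexp_1_1: "binexp 1 1 P (P - b) b = (if 0 \<le> b then of_int P gchoose nat b else 0)"
  by (simp add: binexp_def)

lemma gchoose_zero: "0 \<le> P \<Longrightarrow> P < b \<Longrightarrow> (of_int P :: complex) gchoose nat b = 0"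
proof -
  assume "0 \<le> P" "P < b"
  then obtain n where "P = int n" "n < nat b" by (metis nat_less_iff zero_le_imp_eq_int order_le_less_trans nat_mono_iff nat_int of_nat_0_le_iff zless_nat_conj)
  then show ?thesis by (simp flip: binomial_gbinomial)
qed

lemma gchoose_diag: "0 \<le> b \<Longrightarrow> (of_int b :: complex) gchoose nat b = 1"
  and gchoose_next: "0 \<le> b \<Longrightarrow> (of_int (b + 1) :: complex) gchoose nat b = of_int (b + 1)"
proof -
  assume "0 \<le> b"
  then obtain n where n: "b = int n" by (metis zero_le_imp_eq_int)
  show "(of_int b :: complex) gchoose nat b = 1" by (simp add: n flip: binomial_gbinomial)
  have "(of_nat (Suc n) :: complex) gchoose n = of_nat (Suc n choose n)" by (rule binomial_gbinomial [symmetric])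
  then show "(of_int (b + 1) :: complex) gchoose nat b = of_int (b + 1)"
    by (simp add: n add.commute)
qed

context L_operator
begin

lemma L_bracket_one: "L_bracket R sc L 1 w [i] [j] [p] = L i j p w"
  by (simp add: L_bracket_def R_bracket_def mser_prod_def mser_lmul_one)

text \<open>
  The prefactor \<open>R\<^bsub>12\<^esub>(u - v)\<close> cancels the factor \<open>R\<^bsub>12\<^esub>(u - v)\<^bsup>-1\<^esup>\<close> of \<open>L\<^sub>1(u) L\<^sub>2\<^sup>+(v)\<close>.
\<close>

lemma L_bracket_vacuum: "L_bracket R sc L 2 1 [i, k] [j, m] [p, q] = l i j p * l k m q"
proof -
  define E where "E I J e = L (I ! 0) (J ! 0) (e ! 0) (L (I ! 1) (J ! 1) (e ! 1) 1)" for I J :: "'b list" and e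
  let ?R = "R_at R 1 (-1) 2 0 1"
  have tE: "taylor 2 E"
    by (auto simp: taylor_def E_def L_one lplus_negative L_zero less_2_cases_iff)
  have tR: "tame 2 ?R" by (rule tame_R_at) auto
  define B where "B = (\<lambda>i j k m p q. mser_lmul sc 2 ?R E [i, k] [j, m] [p, q])"
  define S where "S = (\<lambda>i j k m p q. l i j p * l k m q)"
  have "lin2 (- \<epsilon>) 0 B = lin2 0 (- 1) (\<lambda>i j k m p q. L i j p (l k m q))"
  proof (intro ext)
    fix i j k m p q
    have "lin_mult sc 1 (-1) (fps_const (- \<epsilon>) * fps_X) 0 1 (mser_lmul sc 2 ?R E) [i, k] [j, m] [p, q]
      = lin_mult sc 1 (-1) 0 0 1 E [i, k] [j, m] [p, q] + sc (fps_const (-1) * fps_X) (E (swap_at 0 1 [i, k]) [j, m] [p, q])"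
      by (rule R_at_mult [OF _ signed_R_denominator [OF signed] _ _ tE]) auto
    then show "lin2 (- \<epsilon>) 0 B i j k m p q = lin2 0 (- 1) (\<lambda>i j k m p q. L i j p (l k m q)) i j k m p q"
      by (simp add: lin_mult_def lin2_def B_def E_def swap_at_def L_one hs_zero_left hs_def flip: fps_const_neg)
  qed
  also have "\<dots> = lin2 (- \<epsilon>) 0 S" unfolding S_def by (rule vacuum_left)
  finally have "B = S"
  proof (rule lin2_cancel_right)
    fix i j k m p and q :: int assume q: "q < 0"
    have "length [p, q] = 2" "\<exists>m\<in>{1..<2}. [p, q] ! m < 0" using q by (auto intro!: bexI [of _ 1])
    then show "B i j k m p q = 0"
      using taylor_lmul [OF tR tE] unfolding B_def taylor_def by blast
  qed (simp add: S_def lplus_negative)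
  moreover have "L_bracket R sc L 2 1 [i, k] [j, m] [p, q] = B i j k m p q"
    unfolding L_bracket_def B_def mser_lmul_def [of sc]
  proof (rule hsum_cong)
    fix x :: "'b list \<times> int list" assume "x \<in> ix 2"
    then obtain K d where x: "x = (K, d)" "length K = 2" "length d = 2" by auto
    have "R_bracket R 2 = mser_lmul (*) 2 ?R (mser_one 2)"
      by (simp add: R_bracket_def mser_prod_def numeral_2_eq_2)
    then have "R_bracket R 2 [i, k] K d = ?R [i, k] K d"
      using x mser_mult_one by metis
    moreover have "foldr (\<lambda>m'. L (K ! m') ([j, m] ! m') (map2 (-) [p, q] d ! m')) [0..<2] 1 = E K [j, m] (map2 (-) [p, q] d)"
      by (simp add: E_def numeral_2_eq_2)
    ultimately show "(case x of (K, d) \<Rightarrow> sc (R_bracket R 2 [i, k] K d)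
          (foldr (\<lambda>m'. L (K ! m') ([j, m] ! m') (map2 (-) [p, q] d ! m')) [0..<2] 1))
      = (case x of (K, d) \<Rightarrow> sc (?R [i, k] K d) (E K [j, m] (map2 (-) [p, q] d)))"
      by (simp only: x(1) prod.case)
  qed
  ultimately show ?thesis by (simp add: S_def)
qed

end

locale V_algebra = L_operator +
  fixes Y :: "'a \<Rightarrow> int \<Rightarrow> 'a \<Rightarrow> 'a"
  assumes Y_Lplus: "1 \<le> n \<Longrightarrow> length I = n \<Longrightarrow> length J = n \<Longrightarrow> length b = n \<Longrightarrow>
      Y (Lplus \<pi> I J b) c w =
        hsum sc (\<lambda>p. sc (fps_const (\<Prod>m<n. binexp 1 1 (p ! m) (p ! m - b ! m) (b ! m))) (L_bracket R sc L n w I J p))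
          {p. length p = n \<and> (\<Sum>m<n. p ! m - b ! m) = c}"
begin

lemma Y_generator: "Y (l i j 0) c w = L i j c w"
proof -
  have set: "{p :: int list. length p = 1 \<and> (\<Sum>m<1. p ! m - [0] ! m) = c} = {[c]}"
    by (auto simp: length_Suc_conv)
  have "Y (l i j 0) c w = hsum sc (\<lambda>p. sc (fps_const (\<Prod>m<1. binexp 1 1 (p ! m) (p ! m - [0] ! m) ([0] ! m)))
      (L_bracket R sc L 1 w [i] [j] p)) {p. length p = 1 \<and> (\<Sum>m<1. p ! m - [0] ! m) = c}"
    using Y_Lplus [of 1 "[i]" "[j]" "[0]" c w] by (simp add: Lplus_single)
  also have "\<dots> = L i j c w"
    unfolding set using has_hsum_finite [of "{[c]}" "{[c]}" "\<lambda>p. sc (fps_const (\<Prod>m<1. binexp 1 1 (p ! m) (p ! m - [0] ! m) ([0] ! m)))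
      (L_bracket R sc L 1 w [i] [j] p)"]
    by (simp add: hsum_eq L_bracket_one [simplified] binexp_def)
  finally show ?thesis .
qed

text \<open>
  \<open>L\<^sub>1\<^sup>+(z + x\<^sub>1) L\<^sub>2\<^sup>+(z + x\<^sub>2)\<close> is a Taylor series in \<open>z + x\<^sub>1\<close> and \<open>z + x\<^sub>2\<close>, so the coefficient of \<open>x\<^sub>1\<^sup>a x\<^sub>2\<^sup>b z\<^sup>c\<close>
  involves only finitely many of its terms; \<open>F\<close> contains their exponents.
\<close>

lemma Y_quadratic_vacuum:
  assumes a: "0 \<le> a" and b: "0 \<le> b"
    and F: "finite F" "\<And>p q. (p, q) \<in> F \<Longrightarrow> p - a + (q - b) = c"
      "\<And>p q. a \<le> p \<Longrightarrow> b \<le> q \<Longrightarrow> p - a + (q - b) = c \<Longrightarrow> (p, q) \<in> F"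
  shows "Y (l i j a * l k m b) c 1
    = (\<Sum>(p, q)\<in>F. sc (fps_const ((of_int p gchoose nat a) * (of_int q gchoose nat b))) (l i j p * l k m q))"
proof -
  let ?f = "\<lambda>p. sc (fps_const (\<Prod>m<2. binexp 1 1 (p ! m) (p ! m - [a, b] ! m) ([a, b] ! m))) (L_bracket R sc L 2 1 [i, k] [j, m] p)"
  let ?g = "\<lambda>(p, q). [p, q] :: int list"
  have f: "?f [p, q] = sc (fps_const ((of_int p gchoose nat a) * (of_int q gchoose nat b))) (l i j p * l k m q)" for p q
    using a b by (simp only: L_bracket_vacuum) (simp add: numeral_2_eq_2 binexp_1_1)
  have Y_hsum: "Y (l i j a * l k m b) c 1 = hsum sc ?f {p. length p = 2 \<and> (\<Sum>m<2. p ! m - [a, b] ! m) = c}"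
    using Y_Lplus [of 2 "[i, k]" "[j, m]" "[a, b]" c 1] by (simp add: Lplus_def)
  have has_sum: "has_hsum sc ?f {p. length p = 2 \<and> (\<Sum>m<2. p ! m - [a, b] ! m) = c} (sum ?f (?g ` F))"
  proof (rule has_hsum_finite)
    show "?g ` F \<subseteq> {p. length p = 2 \<and> (\<Sum>m<2. p ! m - [a, b] ! m) = c}"
      using F(2) by (auto simp: numeral_2_eq_2)
    fix x assume x: "x \<in> {p. length p = 2 \<and> (\<Sum>m<2. p ! m - [a, b] ! m) = c} - ?g ` F"
    then obtain p q where pq: "x = [p, q]" by (auto simp: numeral_2_eq_2 length_Suc_conv)
    then have "p - a + (q - b) = c" "(p, q) \<notin> F" using x by (auto simp: numeral_2_eq_2)
    then have "\<not> (a \<le> p \<and> b \<le> q)" using F(3) by blast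
    then have "?f [p, q] = 0"
      unfolding f using a b gchoose_zero [of p a] gchoose_zero [of q b]
      by (cases "p < 0 \<or> q < 0") (auto simp: lplus_negative)
    then show "?f x = 0" by (simp only: pq)
  qed (use F(1) in auto)
  have sum_eq: "sum ?f (?g ` F) = (\<Sum>(p, q)\<in>F. sc (fps_const ((of_int p gchoose nat a) * (of_int q gchoose nat b))) (l i j p * l k m q))"
    by (subst sum.reindex) (auto simp: inj_on_def f intro!: sum.cong simp del: prod.case_eq_if)
  show ?thesis unfolding Y_hsum hsum_eq [OF has_sum] by (rule sum_eq)
qed

lemma Y_quadratic_vacuum_negative:
  "0 \<le> a \<Longrightarrow> 0 \<le> b \<Longrightarrow> c < 0 \<Longrightarrow> Y (l i j a * l k m b) c 1 = 0"
  using Y_quadratic_vacuum [of a b "{}" c i j k m] by simp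

text \<open>The translation operator \<open>D\<close> acts on \<open>L\<^sub>1\<^sup>+(u) L\<^sub>2\<^sup>+(v)\<close> as \<open>\<partial>\<^sub>u + \<partial>\<^sub>v\<close>.\<close>

lemma Y_quadratic_vacuum_1:
  assumes "0 \<le> a" "0 \<le> b"
  shows "Y (l i j a * l k m b) 1 1
    = sc (fps_const (of_int (a + 1))) (l i j (a + 1) * l k m b) + sc (fps_const (of_int (b + 1))) (l i j a * l k m (b + 1))"
proof -
  have "Y (l i j a * l k m b) 1 1
    = (\<Sum>(p, q)\<in>{(a + 1, b), (a, b + 1)}. sc (fps_const ((of_int p gchoose nat a) * (of_int q gchoose nat b))) (l i j p * l k m q))"
    by (rule Y_quadratic_vacuum) (use assms in auto)
  then show ?thesis
    using assms gchoose_next [of a] gchoose_next [of b] by (simp add: gchoose_diag del: of_int_add)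
qed

end

section \<open>Modules\<close>

locale V_module = V_algebra + W: hcomplete scW for scW :: "complex fps \<Rightarrow> 'w::ab_group_add \<Rightarrow> 'w" +
  fixes YW :: "'a \<Rightarrow> int \<Rightarrow> 'w \<Rightarrow> 'w"
  assumes YW_field: "field_map sc scW YW" and YW_vacuum: "vacuum_acts_trivially YW 1"
    and YW_assoc: "\<exists>r. \<forall>a b. mult_binomial scW r (assoc_product scW YW u v w) a b
        - mult_binomial scW r (\<lambda>a b. YW (Y u a v) b w) a b \<in> hpow scW k"
begin

lemma YW_hom: "module_hom scW scW (YW v p)" and YW_hom_left: "module_hom sc scW (\<lambda>v. YW v p w)"
  and YW_laurent: "\<exists>M. \<forall>p<M. YW v p w \<in> hpow scW k"
  using YW_field unfolding field_map_def laurent_h_def by blast+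

lemma YW_add_left: "YW (u + v) p w = YW u p w + YW v p w"
  and YW_diff_left: "YW (u - v) p w = YW u p w - YW v p w"
  and YW_zero_left: "YW 0 p w = 0"
  and YW_scale_left: "YW (sc c u) p w = scW c (YW u p w)"
  by (rule module_hom.add [OF YW_hom_left] module_hom.diff [OF YW_hom_left] module_hom.zero [OF YW_hom_left] module_hom.scale [OF YW_hom_left])+

lemma YW_zero: "YW v p 0 = 0"
  by (rule module_hom.zero [OF YW_hom])

lemma YW_hs_left: "YW (hs c u) p w = W.hs c (YW u p w)"
  by (simp add: hs_def W.hs_def YW_scale_left)

lemma YW_hp: "w \<in> hpow scW k \<Longrightarrow> YW v p w \<in> hpow scW k"
  by (rule module_hom_hpow [OF YW_hom])

text \<open>
  In total degree \<open>n\<close>, put \<open>s = z\<^sub>0/z\<^sub>2\<close>: multiplication by \<open>(z\<^sub>0 + z\<^sub>2)\<^sup>r\<close> becomes multiplication by \<open>(1 + s)\<^sup>r\<close>.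
\<close>

lemma functional_mult_binomial:
  assumes \<phi>: "W.functional k \<phi>"
  shows "\<phi> (mult_binomial scW r F a (n + int r - a)) = (pascal ^^ r) (\<lambda>a. \<phi> (F a (n - a))) a"
proof -
  have "\<phi> (mult_binomial scW r F a (n + int r - a))
      = (\<Sum>i\<le>r. of_nat (r choose i) * \<phi> (F (a - int (r - i)) (n + int r - a - int i)))"
    unfolding mult_binomial_def W.functional_sum [OF \<phi>]
    by (intro sum.cong) (simp_all only: W.functional_scale [OF \<phi>] fps_of_nat [symmetric])
  also have "\<dots> = (\<Sum>i\<le>r. of_nat (r choose i) * \<phi> (F (a - int (r - i)) (n - (a - int (r - i)))))"
    by (intro sum.cong) (auto simp: of_nat_diff algebra_simps)
  finally show ?thesis by (simp add: pascal_pow_binomial)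
qed

text \<open>
  As \<open>z\<^sub>0 + z\<^sub>2\<close> is expanded in powers of \<open>z\<^sub>2\<close>, its powers contribute descending powers of \<open>s = z\<^sub>0/z\<^sub>2\<close>. The
  sum is finite because \<open>Y\<^sub>W(v, z\<^sub>2) w\<close> is bounded below modulo \<open>h\<^sup>k\<close>.
\<close>

lemma functional_assoc_product:
  assumes \<phi>: "W.functional k \<phi>" and Q: "\<And>p. p < Q \<Longrightarrow> YW v p w \<in> hpow scW k"
  shows "\<phi> (assoc_product scW YW u v w a (n - a))
    = (\<Sum>p\<in>{a..n - Q}. \<phi> (YW u p (YW v (n - p) w)) * desc_binom p a)"
proof -
  let ?f = "\<lambda>j. scW (fps_const (binexp 1 1 (a + j) a j)) (YW u (a + j) (YW v (n - a - j) w))"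
  have "finite {j \<in> {0..}. ?f j \<notin> hpow scW k'}" for k'
  proof -
    obtain M where M: "\<And>p. p < M \<Longrightarrow> YW v p w \<in> hpow scW k'" using YW_laurent by blast
    have "?f j \<in> hpow scW k'" if "n - a - M < j" for j
      using that by (intro W.hp_scale YW_hp M) auto
    then have "{j \<in> {0..}. ?f j \<notin> hpow scW k'} \<subseteq> {0..n - a - M}" by force
    then show ?thesis by (rule finite_subset) simp
  qed
  then obtain s where s: "has_hsum scW ?f {0..} s" by (rule W.has_hsum_exists)
  have "s - sum ?f {0..n - Q - a} \<in> hpow scW k"
  proof (rule W.has_hsum_tail [OF s])
    fix j assume "j \<in> {0..} - {0..n - Q - a}"
    then show "?f j \<in> hpow scW k" by (intro W.hp_scale YW_hp Q) auto
  qed auto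
  from W.functional_hp [OF \<phi> this] have "\<phi> s = \<phi> (sum ?f {0..n - Q - a})"
    by (simp add: W.functional_diff [OF \<phi>])
  also have "\<dots> = (\<Sum>j\<in>{0..n - Q - a}. binexp 1 1 (a + j) a j * \<phi> (YW u (a + j) (YW v (n - a - j) w)))"
    by (simp add: W.functional_sum [OF \<phi>] W.functional_scale [OF \<phi>])
  also have "\<dots> = (\<Sum>p\<in>{a..n - Q}. \<phi> (YW u p (YW v (n - p) w)) * desc_binom p a)"
    by (rule sum.reindex_bij_witness [where i = "\<lambda>p. p - a" and j = "\<lambda>j. a + j"])
      (auto simp: desc_binom_def binexp_def diff_diff_eq)
  finally show ?thesis
    unfolding assoc_product_def W.hsum_eq [OF s] .
qed

text \<open>
  The statement allows any larger \<open>r\<close> and any smaller \<open>Q\<close>, so that several instances can be combined.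
\<close>

lemma weak_associativity_functional:
  assumes \<phi>: "W.functional k \<phi>"
  shows "\<exists>r0 Q0. \<forall>r\<ge>r0. \<forall>Q\<le>Q0. \<forall>n.
    (\<forall>p>n - Q. \<phi> (YW u p (YW v (n - p) w)) = 0) \<and>
    (pascal ^^ r) (\<lambda>a. \<Sum>p\<in>{a..n - Q}. \<phi> (YW u p (YW v (n - p) w)) * desc_binom p a)
      = (pascal ^^ r) (\<lambda>a. \<phi> (YW (Y u a v) (n - a) w))"
proof -
  obtain r0 where r0: "\<And>a b. mult_binomial scW r0 (assoc_product scW YW u v w) a b
        - mult_binomial scW r0 (\<lambda>a b. YW (Y u a v) b w) a b \<in> hpow scW k"
    using YW_assoc by blast
  obtain Q0 where Q0: "\<And>p. p < Q0 \<Longrightarrow> YW v p w \<in> hpow scW k" using YW_laurent by blast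
  show ?thesis
  proof (intro exI allI impI conjI)
    fix r Q n p assume "r0 \<le> r" and Q: "Q \<le> Q0" and p: "n - Q < p"
    then show "\<phi> (YW u p (YW v (n - p) w)) = 0"
      by (intro W.functional_hp [OF \<phi>] YW_hp Q0) auto
  next
    fix r Q n assume r: "r0 \<le> r" and Q: "Q \<le> Q0"
    have 0: "(pascal ^^ r0) (\<lambda>a. \<Sum>p\<in>{a..n - Q}. \<phi> (YW u p (YW v (n - p) w)) * desc_binom p a)
      = (pascal ^^ r0) (\<lambda>a. \<phi> (YW (Y u a v) (n - a) w))"
    proof
      fix a
      have "\<phi> (mult_binomial scW r0 (assoc_product scW YW u v w) a (n + int r0 - a))
        = \<phi> (mult_binomial scW r0 (\<lambda>a b. YW (Y u a v) b w) a (n + int r0 - a))"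
        using W.functional_hp [OF \<phi> r0 [of a "n + int r0 - a"]] by (simp add: W.functional_diff [OF \<phi>])
      moreover have "\<phi> (assoc_product scW YW u v w a (n - a))
        = (\<Sum>p\<in>{a..n - Q}. \<phi> (YW u p (YW v (n - p) w)) * desc_binom p a)" for a
        using Q0 Q by (intro functional_assoc_product [OF \<phi>]) auto
      ultimately show "(pascal ^^ r0) (\<lambda>a. \<Sum>p\<in>{a..n - Q}. \<phi> (YW u p (YW v (n - p) w)) * desc_binom p a) a
        = (pascal ^^ r0) (\<lambda>a. \<phi> (YW (Y u a v) (n - a) w)) a"
        unfolding functional_mult_binomial [OF \<phi>] by simp
    qed
    have "pascal ^^ r = (pascal ^^ (r - r0)) \<circ> (pascal ^^ r0)"
      using r by (simp flip: funpow_add)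
    then show "(pascal ^^ r) (\<lambda>a. \<Sum>p\<in>{a..n - Q}. \<phi> (YW u p (YW v (n - p) w)) * desc_binom p a)
      = (pascal ^^ r) (\<lambda>a. \<phi> (YW (Y u a v) (n - a) w))"
      by (simp add: 0)
  qed
qed

text \<open>\<open>Y\<^sub>W(D v, z) = \<partial>\<^sub>z Y\<^sub>W(v, z)\<close>: weak associativity with the vacuum vector in the second place.\<close>

lemma functional_derivative:
  assumes \<phi>: "W.functional k \<phi>" and neg: "\<And>c. c < 0 \<Longrightarrow> Y v c 1 = 0"
  shows "\<phi> (YW (Y v 1 1) (m - 1) w) = of_int m * \<phi> (YW v m w)"
proof -
  define b where "b p = \<phi> (YW v p (YW 1 (m - p) w))" for p
  have b: "b p = (if p = m then \<phi> (YW v m w) else 0)" for p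
    using YW_vacuum by (simp add: b_def vacuum_acts_trivially_def YW_zero W.functional_zero [OF \<phi>])
  obtain r Q where rQ: "\<And>p. p > m - Q \<Longrightarrow> b p = 0"
    "(pascal ^^ r) (\<lambda>a. \<Sum>p\<in>{a..m - Q}. b p * desc_binom p a) = (pascal ^^ r) (\<lambda>a. \<phi> (YW (Y v a 1) (m - a) w))"
    using weak_associativity_functional [OF \<phi>, of v 1 w] unfolding b_def by blast
  have z: "\<phi> (YW (Y v a 1) (m - a) w) = 0" if "a < 0" for a
    using that by (simp add: neg YW_zero_left W.functional_zero [OF \<phi>])
  note exp = ascending_expansion [OF rQ(1) z rQ(2)]
  have "\<phi> (YW (Y v 1 1) (m - 1) w) = (\<Sum>p\<in>{- int r..m - Q}. b p * asc_binom p 1)"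
    by (rule exp(2))
  also have "\<dots> = (\<Sum>p\<in>{m}. b p * asc_binom p 1)"
  proof (rule sum.mono_neutral_cong)
    show "b p * asc_binom p 1 = 0" if "p \<in> {m} - {- int r..m - Q}" for p
      using that exp(1) [of m] rQ(1) [of m] by auto
    show "b p * asc_binom p 1 = 0" if "p \<in> {- int r..m - Q} - {m}" for p
      using that by (simp add: b)
  qed auto
  also have "\<dots> = of_int m * \<phi> (YW v m w)"
    by (simp add: b asc_binom_def)
  finally show ?thesis .
qed

text \<open>
  Put \<open>z\<^sub>0 = y\<^sub>1 - y\<^sub>2\<close>. The numbers \<open>b\<^sub>p\<close> are the coefficients, in total degree \<open>n\<close>, of
  \<open>\<sigma> z\<^sub>0 Y\<^sub>W(u, y\<^sub>1) Y\<^sub>W(v, y\<^sub>2) w - h Y\<^sub>W(u', y\<^sub>1) Y\<^sub>W(v', y\<^sub>2) w\<close>. Either side of the RTT relation has this form: the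
  left one with \<open>\<sigma> = 1\<close>, the right one with \<open>\<sigma> = -1\<close> and the two variables exchanged. Neither summand
  alone need satisfy the assumption on \<open>f\<close>, so weak associativity is combined before it is
  inverted.
\<close>

lemma pair_expansion:
  fixes \<sigma> :: complex and u v u' v' :: 'a and w :: 'w and n :: int
  assumes \<phi>: "W.functional k \<phi>"
  defines "b \<equiv> \<lambda>p. \<sigma> * (\<phi> (YW u (p - 1) (YW v (n - p) w)) - \<phi> (YW u p (YW v (n - 1 - p) w)))
      - \<phi> (W.hs 1 (YW u' p (YW v' (n - p) w)))"
    and "f \<equiv> \<lambda>a. \<sigma> * \<phi> (YW (Y u (a - 1) v) (n - a) w) - \<phi> (W.hs 1 (YW (Y u' a v') (n - a) w))"
  assumes below: "\<And>a. a < 0 \<Longrightarrow> f a = 0"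
  shows "\<exists>A. finite A \<and> (\<forall>p. p \<notin> A \<longrightarrow> b p = 0) \<and> (\<forall>a. f a = (\<Sum>p\<in>A. b p * asc_binom p a))"
proof -
  define \<beta> where "\<beta> p = \<phi> (YW u p (YW v (n - 1 - p) w))" for p
  define \<gamma> where "\<gamma> p = \<phi> (W.hs 1 (YW u' p (YW v' (n - p) w)))" for p
  obtain r1 Q1 where 1: "\<And>r Q n. r1 \<le> r \<Longrightarrow> Q \<le> Q1 \<Longrightarrow> (\<forall>p>n - Q. \<phi> (YW u p (YW v (n - p) w)) = 0) \<and>
    (pascal ^^ r) (\<lambda>a. \<Sum>p\<in>{a..n - Q}. \<phi> (YW u p (YW v (n - p) w)) * desc_binom p a)
      = (pascal ^^ r) (\<lambda>a. \<phi> (YW (Y u a v) (n - a) w))"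
    using weak_associativity_functional [OF \<phi>, of u v w] by blast
  obtain r2 Q2 where 2: "\<And>r Q n. r2 \<le> r \<Longrightarrow> Q \<le> Q2 \<Longrightarrow> (\<forall>p>n - Q. \<phi> (W.hs 1 (YW u' p (YW v' (n - p) w))) = 0) \<and>
    (pascal ^^ r) (\<lambda>a. \<Sum>p\<in>{a..n - Q}. \<phi> (W.hs 1 (YW u' p (YW v' (n - p) w))) * desc_binom p a)
      = (pascal ^^ r) (\<lambda>a. \<phi> (W.hs 1 (YW (Y u' a v') (n - a) w)))"
    using weak_associativity_functional [OF W.functional_h [OF \<phi>, of 1], of u' v' w] by blast
  define r where "r = max r1 r2"
  define P where "P = n - min Q1 Q2"
  have P1: "n - 1 - min Q1 Q2 = P - 1" by (simp add: P_def)
  have \<beta>: "\<And>p. p > P - 1 \<Longrightarrow> \<beta> p = 0" "(pascal ^^ r) (\<lambda>a. \<Sum>p\<in>{a..P - 1}. \<beta> p * desc_binom p a)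
      = (pascal ^^ r) (\<lambda>a. \<phi> (YW (Y u a v) (n - 1 - a) w))"
    using 1 [of r "min Q1 Q2" "n - 1"] by (auto simp: r_def P1 \<beta>_def)
  have \<gamma>: "\<And>p. p > P \<Longrightarrow> \<gamma> p = 0" "(pascal ^^ r) (\<lambda>a. \<Sum>p\<in>{a..P}. \<gamma> p * desc_binom p a)
      = (pascal ^^ r) (\<lambda>a. \<phi> (W.hs 1 (YW (Y u' a v') (n - a) w)))"
    using 2 [of r "min Q1 Q2" n] by (auto simp: r_def P_def \<gamma>_def)
  have b: "b p = \<sigma> * (\<beta> (p - 1) - \<beta> p) - \<gamma> p" for p
    by (simp add: b_def \<beta>_def \<gamma>_def)
  have shift: "(\<Sum>p\<in>{a..P}. (\<beta> (p - 1) - \<beta> p) * desc_binom p a) = (\<Sum>p\<in>{a - 1..P - 1}. \<beta> p * desc_binom p (a - 1))" for a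
  proof -
    have "(\<Sum>p\<in>{a..P}. \<beta> (p - 1) * desc_binom p a) = (\<Sum>p\<in>{a - 1..P - 1}. \<beta> p * desc_binom (p + 1) a)"
      by (rule sum.reindex_bij_witness [where i = "\<lambda>p. p + 1" and j = "\<lambda>p. p - 1"]) auto
    also have "\<dots> = (\<Sum>p\<in>{a - 1..P - 1}. \<beta> p * desc_binom p a) + (\<Sum>p\<in>{a - 1..P - 1}. \<beta> p * desc_binom p (a - 1))"
      unfolding pascal_desc [symmetric] by (simp add: pascal_def distrib_left sum.distrib)
    also have "(\<Sum>p\<in>{a - 1..P - 1}. \<beta> p * desc_binom p a) = (\<Sum>p\<in>{a..P - 1}. \<beta> p * desc_binom p a)"
      by (intro sum.mono_neutral_right) (auto intro: desc_binom_above)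
    also have "\<dots> = (\<Sum>p\<in>{a..P}. \<beta> p * desc_binom p a)"
      by (intro sum.mono_neutral_left) (auto simp: \<beta>(1))
    finally show ?thesis by (simp add: left_diff_distrib sum_subtractf)
  qed
  have eq: "(\<Sum>p\<in>{a..P}. b p * desc_binom p a)
      = \<sigma> * (\<Sum>p\<in>{a - 1..P - 1}. \<beta> p * desc_binom p (a - 1)) + (- 1) * (\<Sum>p\<in>{a..P}. \<gamma> p * desc_binom p a)" for a
    unfolding shift [symmetric] sum_distrib_left sum.distrib [symmetric]
    by (intro sum.cong) (simp_all add: b algebra_simps)
  have "(pascal ^^ r) (\<lambda>a. \<Sum>p\<in>{a..P}. b p * desc_binom p a)
      = (\<lambda>a. \<sigma> * (pascal ^^ r) (\<lambda>a. \<phi> (YW (Y u a v) (n - 1 - a) w)) (a - 1)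
        + (- 1) * (pascal ^^ r) (\<lambda>a. \<phi> (W.hs 1 (YW (Y u' a v') (n - a) w))) a)"
    unfolding eq pascal_pow_lincomb \<gamma>(2) \<beta>(2) [symmetric]
    by (subst pascal_pow_shift) simp
  also have "\<dots> = (pascal ^^ r) (\<lambda>a. \<sigma> * (\<lambda>a. \<phi> (YW (Y u (a - 1) v) (n - 1 - (a - 1)) w)) a
        + (- 1) * \<phi> (W.hs 1 (YW (Y u' a v') (n - a) w)))"
    unfolding pascal_pow_lincomb
    using pascal_pow_shift [of r "\<lambda>a. \<phi> (YW (Y u a v) (n - 1 - a) w)"] by simp
  also have "\<dots> = (pascal ^^ r) f" by (simp add: f_def)
  finally have eq: "(pascal ^^ r) (\<lambda>a. \<Sum>p\<in>{a..P}. b p * desc_binom p a) = (pascal ^^ r) f" .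
  have above: "b p = 0" if "P < p" for p using that by (simp add: b \<beta>(1) \<gamma>(1))
  show ?thesis
    using ascending_expansion [OF above below eq] above
    by (intro exI [of _ "{- int r..P}"]) (auto simp: not_le)
qed

text \<open>
  The identity for \<open>G\<close> in the proof below, from the identities for its three summands; \<open>N\<close> stands for
  \<open>n - a - c\<close>.
\<close>

lemma euler_combine:
  fixes a c N :: complex
  assumes "a * y0 + (c + 1) * y1 = N * y2" "(a + 1) * y3 + c * y0 = N * y4" "(a + 1) * z1 + (c + 1) * z2 = N * z0"
  shows "(a + 1) * (y0 - y3 + z1) + (c + 1) * (y1 - y0 + z2) = N * (y2 - y4 + z0)"
  unfolding distrib_left [of N] right_diff_distrib [of N] assms [symmetric] by (simp add: algebra_simps)

text \<open>
  In total degree \<open>n\<close> let \<open>b\<close> and \<open>b'\<close> be the coefficients of the left and right side, in powers of \<open>u\<close>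
  and of \<open>v\<close> respectively, and let \<open>G a c\<close> be the coefficient of \<open>x\<^sub>1\<^sup>a x\<^sub>2\<^sup>c\<close> in
  \<open>(x\<^sub>1 - x\<^sub>2 - \<epsilon> h) Y\<^sub>W(L\<^sub>1\<^sup>+(x\<^sub>1) L\<^sub>2\<^sup>+(x\<^sub>2) 1, z) w\<close>. The relations on the vacuum vector identify the ascending
  expansions of \<open>b\<close> and \<open>b'\<close> with the values of \<open>G\<close> on the two axes, and the derivative property of \<open>Y\<^sub>W\<close>
  gives the Euler-type identity for \<open>G\<close>.
\<close>

theorem module_RTT:
  fixes i j k m p q w
  defines "A \<equiv> \<lambda>i j. YW (l i j 0)"
  shows "A i j (p - 1) (A k m q w) - A i j p (A k m (q - 1) w) - scW fps_X (A k j p (A i m q w))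
    = A k m q (A i j (p - 1) w) - A k m (q - 1) (A i j p w) - scW fps_X (A k j q (A i m p w))"
proof -
  have "A i j (p - 1) (A k m q w) - A i j p (A k m (q - 1) w) - scW fps_X (A k j p (A i m q w))
    - (A k m q (A i j (p - 1) w) - A k m (q - 1) (A i j p w) - scW fps_X (A k j q (A i m p w))) = 0"
  proof (rule W.functionals_separate)
    fix K \<phi> assume \<phi>: "W.functional K \<phi>"
    define n where "n = p + q"
    define S where "S = (\<lambda>i j k m p q. l i j p * l k m q)"
    define s where "s \<psi> N a c = (\<psi> (YW (S i j k m a c) (N - a - c) w) :: complex)" for \<psi> N and a c :: int
    define G where "G a c = \<phi> (YW (lin2 (- \<epsilon>) 0 S i j k m a c) (n - a - c) w)" for a c
    \<comment> \<open>the summand of \<open>G\<close> with the factor \<open>- \<epsilon> h\<close> lies in total degree \<open>n\<close>, the other two in degree \<open>n - 1\<close>\<close>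
    define \<phi>' where "\<phi>' x = \<phi> (W.hs (- \<epsilon>) x)" for x
    have \<phi>': "W.functional K \<phi>'" unfolding \<phi>'_def by (rule W.functional_h [OF \<phi>])
    have S0: "S i j k m a c = 0" if "a < 0 \<or> c < 0" for a c using that by (auto simp: S_def lplus_negative)
    have euler: "of_int (a + 1) * s \<psi> N (a + 1) c + of_int (c + 1) * s \<psi> N a (c + 1) = of_int (N - a - c) * s \<psi> N a c"
      if \<psi>: "W.functional K \<psi>" for \<psi> N a c
    proof (cases "a < 0 \<or> c < 0")
      case True
      then have "a = - 1 \<or> a + 1 < 0 \<or> c < 0" "c = - 1 \<or> a < 0 \<or> c + 1 < 0" by auto
      then have "a = - 1 \<or> S i j k m (a + 1) c = 0" "c = - 1 \<or> S i j k m a (c + 1) = 0"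
        using S0 [of "a + 1" c] S0 [of a "c + 1"] by blast+
      then show ?thesis using S0 [OF True] by (auto simp: s_def YW_zero_left W.functional_zero [OF \<psi>])
    next
      case False
      then have ac: "0 \<le> a" "0 \<le> c" by auto
      have "\<psi> (YW (Y (S i j k m a c) 1 1) (N - a - c - 1) w) = of_int (N - a - c) * \<psi> (YW (S i j k m a c) (N - a - c) w)"
        by (rule functional_derivative [OF \<psi>]) (use ac in \<open>simp add: S_def Y_quadratic_vacuum_negative\<close>)
      moreover have "N - a - c - 1 = N - (a + 1) - c" by simp
      moreover have same: "N - a - (c + 1) = N - (a + 1) - c" by simp
      ultimately show ?thesis
        unfolding s_def same using ac by (simp add: S_def Y_quadratic_vacuum_1 YW_add_left YW_scale_left W.functional_add [OF \<psi>]
            W.functional_scale [OF \<psi>] del: of_int_add of_int_diff)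
    qed
    have G: "G a c = s \<phi> (n - 1) (a - 1) c - s \<phi> (n - 1) a (c - 1) + s \<phi>' n a c" for a c
      by (simp add: G_def s_def lin2_def hs_zero_left YW_add_left YW_diff_left YW_hs_left \<phi>'_def
          W.functional_add [OF \<phi>] W.functional_diff [OF \<phi>] diff_diff_eq add.commute)
    have euler_G: "of_int (a + 1) * G (a + 1) c + of_int (c + 1) * G a (c + 1) = of_int (n - a - c) * G a c" for a c
    proof -
      have "n - 1 - (a - 1) - c = n - a - c" "n - 1 - a - (c - 1) = n - a - c" by simp_all
      then show ?thesis
        using euler_combine [of "of_int a" "s \<phi> (n - 1) a c" "of_int c" "s \<phi> (n - 1) (a - 1) (c + 1)" "of_int (n - a - c)" "s \<phi> (n - 1) (a - 1) c"
            "s \<phi> (n - 1) (a + 1) (c - 1)" "s \<phi> (n - 1) a (c - 1)" "s \<phi>' n (a + 1) c" "s \<phi>' n a (c + 1)" "s \<phi>' n a c"]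
          euler [OF \<phi>, of "a - 1" "n - 1" c] euler [OF \<phi>, of a "n - 1" "c - 1"] euler [OF \<phi>', of a n c]
        unfolding G by simp
    qed
    have G_below: "G a c = 0" if "a < 0 \<or> c < 0" for a c
      unfolding G s_def using that by (auto simp: S0 YW_zero_left W.functional_zero [OF \<phi>] W.functional_zero [OF \<phi>'])
    define b where "b p = 1 * (\<phi> (A i j (p - 1) (A k m (n - p) w)) - \<phi> (A i j p (A k m (n - 1 - p) w)))
      - \<phi> (W.hs 1 (A k j p (A i m (n - p) w)))" for p
    define b' where "b' q = (- 1) * (\<phi> (A k m (q - 1) (A i j (n - q) w)) - \<phi> (A k m q (A i j (n - 1 - q) w)))
      - \<phi> (W.hs 1 (A k j q (A i m (n - q) w)))" for q
    have f: "1 * \<phi> (YW (Y (l i j 0) (a - 1) (l k m 0)) (n - a) w) - \<phi> (W.hs 1 (YW (Y (l k j 0) a (l i m 0)) (n - a) w)) = G a 0" for a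
      using fun_cong [OF fun_cong [OF fun_cong [OF fun_cong [OF fun_cong [OF fun_cong [OF vacuum_left]]]]], of i j k m a 0]
      unfolding G_def S_def
      by (simp add: lin2_def [of 0 "- 1"] Y_generator lplus_negative L_zero hs_zero_left hs_neg YW_diff_left YW_hs_left [symmetric]
          W.functional_diff [OF \<phi>, symmetric] YW_diff_left [symmetric])
    have f': "(- 1) * \<phi> (YW (Y (l k m 0) (a - 1) (l i j 0)) (n - a) w) - \<phi> (W.hs 1 (YW (Y (l k j 0) a (l i m 0)) (n - a) w)) = G 0 a" for a
    proof -
      have neg: "\<phi> (- x) = - \<phi> x" for x
        using W.functional_diff [OF \<phi>, of 0 x] W.functional_zero [OF \<phi>] by simp
      have right: "- L k m (a - 1) (l i j 0) - hs 1 (L k j a (l i m 0)) = lin2 (- \<epsilon>) 0 S i j k m 0 a"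
        using fun_cong [OF fun_cong [OF fun_cong [OF fun_cong [OF fun_cong [OF fun_cong [OF vacuum_right]]]]], of i j k m 0 a]
        by (simp add: rlin2_def S_def lplus_negative L_zero)
      show ?thesis
        unfolding G_def right [symmetric]
        by (simp add: Y_generator module_hom.neg [OF YW_hom_left] YW_diff_left YW_hs_left W.functional_diff [OF \<phi>] neg)
    qed
    obtain B where B: "finite B" "\<And>p. p \<notin> B \<Longrightarrow> b p = 0" "\<And>a. G a 0 = (\<Sum>p\<in>B. b p * asc_binom p a)"
      using pair_expansion [OF \<phi>, where \<sigma> = 1 and n = n and w = w and u = "l i j 0" and v = "l k m 0" and u' = "l k j 0" and v' = "l i m 0"] G_below
      unfolding f b_def A_def by blast
    obtain B' where B': "finite B'" "\<And>p. p \<notin> B' \<Longrightarrow> b' p = 0" "\<And>a. G 0 a = (\<Sum>p\<in>B'. b' p * asc_binom p a)"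
      using pair_expansion [OF \<phi>, where \<sigma> = "- 1" and n = n and w = w and u = "l k m 0" and v = "l i j 0" and u' = "l k j 0" and v' = "l i m 0"] G_below
      unfolding f' b'_def A_def by blast
    have "b p = b' (n - p)"
    proof (rule translation_determines [where G = "\<lambda>a c. G (int a) (int c)" and A = B and A' = B'])
      fix a c
      show "of_nat (Suc a) * G (int (Suc a)) (int c) + of_nat (Suc c) * G (int a) (int (Suc c))
        = (of_int n - of_nat a - of_nat c) * G (int a) (int c)"
        using euler_G [of "int a" "int c"] by (simp add: add.commute)
    qed (use B B' in auto)
    then show "\<phi> (A i j (p - 1) (A k m q w) - A i j p (A k m (q - 1) w) - scW fps_X (A k j p (A i m q w))
      - (A k m q (A i j (p - 1) w) - A k m (q - 1) (A i j p w) - scW fps_X (A k j q (A i m p w)))) = 0"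
      unfolding W.functional_diff [OF \<phi>]
      by (simp add: b_def b'_def n_def W.hs_one)
  qed
  then show ?thesis by simp
qed

end

section \<open>Representations of the Yangian from solutions of the RTT relation\<close>

lemma lookup_free_scale: "Poly_Mapping.lookup (free_scale c x) a = c * Poly_Mapping.lookup x a"
  unfolding free_scale_def
  by (induction x rule: poly_mapping_single_induct)
    (simp_all add: distrib_left lookup_add mult_single lookup_single when_def)

lemma hseparated_free: "hseparated free_scale"
proof
  fix x :: "'g free_alg" assume x: "\<And>k. x \<in> hpow free_scale k"
  have "Poly_Mapping.lookup x a = 0" for a
  proof (rule series.separated)
    fix k
    obtain y where "x = free_scale (fps_X ^ k) y" using x [of k] by (auto simp: hpow_def)
    then show "Poly_Mapping.lookup x a \<in> series.hp k" by (auto simp: lookup_free_scale series.hp_iff)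
  qed
  then show "x = 0" by (intro poly_mapping_eqI) simp
qed (simp_all add: free_scale_def distrib_left distrib_right single_add mult.assoc [symmetric] mult_single)

lemma Rhat_symmetric: "Rhat I J e = Rhat J I e"
  by (auto simp: Rhat_def Pmat_def)

lemma Rhat_pair:
  "Rhat [i, k] [a, b] d = (of_bool (d = [1, 0]) - of_bool (d = [0, 1])) * of_bool ([a, b] = [i, k])
    - fps_X * of_bool (d = [0, 0]) * of_bool ([a, b] = [k, i])"
proof -
  have "([i, k] = [a, b]) = ([a, b] = [i, k])" "((i, k) = prod.swap (a, b)) = ([a, b] = [k, i])"
    by auto
  then show ?thesis
    unfolding Rhat_def Pmat_def by (simp only: vec_lambda_beta nth_Cons_0 nth_Cons_Suc One_nat_def)
qed

lemma of_bool_combination_zero: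
  "\<not> (A \<and> C) \<Longrightarrow> \<not> (B \<and> C) \<Longrightarrow> \<not> (Z \<and> D) \<Longrightarrow>
    (of_bool A - of_bool B) * of_bool C - x * of_bool Z * of_bool D = (0 :: 'r::ring_1)"
  by (cases A; cases B; cases C; cases Z; cases D) simp_all

lemma (in hseparated) Rhat_lmul:
  fixes X :: "('n::finite, 'w) mser"
  shows "mser_lmul sc 2 Rhat X [i, k] [j, m] [p, q]
    = X [i, k] [j, m] [p - 1, q] - X [i, k] [j, m] [p, q - 1] - sc fps_X (X [k, i] [j, m] [p, q])"
proof -
  let ?f = "\<lambda>(K, d). sc (Rhat [i, k] K d) (X K [j, m] (map2 (-) [p, q] d))"
  let ?F = "{([i, k], [1, 0]), ([i, k], [0, 1]), ([k, i], [0, 0])} :: ('n list \<times> int list) set"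
  have "has_hsum sc ?f (ix 2) (sum ?f ?F)"
  proof (rule has_hsum_finite)
    fix x assume x: "x \<in> ix 2 - ?F"
    then obtain a b d d' where "x = ([a, b], [d, d'])"
      by (auto simp: numeral_2_eq_2 length_Suc_conv)
    then have x': "x = ([a, b], [d, d'])" .
    have "Rhat [i, k] [a, b] [d, d'] = 0"
      unfolding Rhat_pair by (rule of_bool_combination_zero) (use x x' in auto)
    then show "?f x = 0" by (simp add: x')
  qed auto
  moreover have "sum ?f ?F = X [i, k] [j, m] [p - 1, q] - X [i, k] [j, m] [p, q - 1] - sc fps_X (X [k, i] [j, m] [p, q])"
    by (simp add: Rhat_pair)
  ultimately show ?thesis unfolding mser_lmul_def using hsum_eq by simp
qed

locale RTT_solution = module scW for scW :: "complex fps \<Rightarrow> 'w::ab_group_add \<Rightarrow> 'w" +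
  fixes A :: "'n::finite \<Rightarrow> 'n \<Rightarrow> int \<Rightarrow> 'w \<Rightarrow> 'w"
  assumes A_hom: "module_hom scW scW (A i j p)"
    and A_RTT: "A i j (p - 1) (A k m q w) - A i j p (A k m (q - 1) w) - scW fps_X (A k j p (A i m q w))
      = A k m q (A i j (p - 1) w) - A k m (q - 1) (A i j p w) - scW fps_X (A k j q (A i m p w))"
begin

definition word_action :: "('n \<times> 'n \<times> int) list \<Rightarrow> 'w \<Rightarrow> 'w" where
  "word_action gs = foldr (\<lambda>(i, j, r). A i j (- r)) gs"

definition free_action :: "'n yang_free \<Rightarrow> 'w \<Rightarrow> 'w" where
  "free_action x w = (\<Sum>a\<in>Poly_Mapping.keys x. scW (Poly_Mapping.lookup x a) (word_action (letters a) w))"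

lemma word_action_hom: "module_hom scW scW (word_action gs)"
proof (induction gs)
  case Nil
  then show ?case by (simp add: word_action_def module_hom_iff module_axioms)
next
  case (Cons g gs)
  have "word_action (g # gs) = A (fst g) (fst (snd g)) (- snd (snd g)) \<circ> word_action gs"
    by (simp add: word_action_def case_prod_unfold fun_eq_iff)
  then show ?case using module_hom_compose [OF Cons A_hom] by (simp only:)
qed

lemma free_action_superset:
  assumes "finite S" "Poly_Mapping.keys x \<subseteq> S"
  shows "free_action x w = (\<Sum>a\<in>S. scW (Poly_Mapping.lookup x a) (word_action (letters a) w))"
  unfolding free_action_def
  using assms by (intro sum.mono_neutral_left) (auto simp: in_keys_iff)

lemma free_action_add: "free_action (x + y) w = free_action x w + free_action y w"
proof -
  let ?S = "Poly_Mapping.keys x \<union> Poly_Mapping.keys y"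
  have "Poly_Mapping.keys (x + y) \<subseteq> ?S" by (rule keys_add)
  then show ?thesis
    by (simp add: free_action_superset [of ?S] lookup_add scale_left_distrib sum.distrib)
qed

lemma free_action_zero: "free_action 0 w = 0"
  by (simp add: free_action_def)

lemma free_action_single: "free_action (Poly_Mapping.single a c) w = scW c (word_action (letters a) w)"
  by (cases "c = 0") (simp_all add: free_action_def)

lemma free_action_hom: "module_hom scW scW (free_action x)"
proof -
  have "free_action x (w + w') = free_action x w + free_action x w'" for w w'
    by (simp add: free_action_def module_hom.add [OF word_action_hom] scale_right_distrib sum.distrib)
  moreover have "free_action x (scW c w) = scW c (free_action x w)" for c w
    by (simp add: free_action_def module_hom.scale [OF word_action_hom] scale_sum_right mult.commute)
  ultimately show ?thesis by (simp add: module_hom_iff module_axioms)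
qed

lemma free_action_mult: "free_action (x * y) w = free_action x (free_action y w)"
proof (induction x rule: poly_mapping_single_induct)
  case (add a c x)
  have "free_action (Poly_Mapping.single a c * y) w = scW c (word_action (letters a) (free_action y w))"
  proof (induction y rule: poly_mapping_single_induct)
    case (add b d y)
    have "word_action (letters (a + b)) w = word_action (letters a) (word_action (letters b) w)"
      by (simp add: word_action_def plus_free_word_def)
    then show ?case
      using add by (simp add: distrib_left free_action_add mult_single free_action_single
          module_hom.add [OF word_action_hom] module_hom.scale [OF word_action_hom] scale_right_distrib)
  qed (simp add: free_action_zero module_hom.zero [OF word_action_hom])
  then show ?case using add by (simp add: distrib_right free_action_add free_action_single)
qed (simp add: free_action_zero)

lemma free_action_one: "free_action 1 w = w"
proof -
  have "(1 :: 'n yang_free) = Poly_Mapping.single 0 1" by simp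
  then show ?thesis
    using free_action_single [of 0 1 w] by (simp add: zero_free_word_def word_action_def)
qed

lemma free_action_scale: "free_action (free_scale c x) w = scW c (free_action x w)"
  unfolding free_scale_def free_action_mult free_action_single
  by (simp add: zero_free_word_def word_action_def)

lemma free_action_diff: "free_action (x - y) w = free_action x w - free_action y w"
  using free_action_add [of "x - y" y w] by simp

lemma free_action_lambda: "free_action (lambda_series i j p) w = A i j p w"
  by (simp add: lambda_series_def free_gen_def free_action_single word_action_def)

lemma free_action_relation:
  assumes "x \<in> yangian_relations"
  shows "free_action x w = 0"
proof -
  interpret f: hseparated "free_scale :: _ \<Rightarrow> 'n yang_free \<Rightarrow> _" by (rule hseparated_free)
  obtain I J e where x: "x = mser_lmul free_scale 2 Rhat (prod12 lambda_series) I J e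
      - mser_rmul free_scale 2 (prod21 lambda_series) Rhat I J e"
    and len: "length I = 2" "length J = 2" "length e = 2"
    using assms unfolding yangian_relations_def by blast
  obtain i k j m p q where IJe: "I = [i, k]" "J = [j, m]" "e = [p, q]"
    using len by (auto simp: numeral_2_eq_2 length_Suc_conv)
  have sym: "(\<lambda>I J. Rhat J I) = (Rhat :: ('n, complex fps) mser)" by (intro ext) (rule Rhat_symmetric)
  show ?thesis
    unfolding x IJe mser_rmul_transpose sym f.Rhat_lmul
    using A_RTT [of i j p k m q w]
    by (simp add: prod12_def prod21_def free_action_diff free_action_scale free_action_mult free_action_lambda)
qed

lemma free_action_ideal:
  assumes "x \<in> ideal_gen yangian_relations"
  shows "free_action x w = 0"
proof -
  let ?J = "{x. \<forall>w. free_action x w = 0}"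
  have "two_sided_ideal ?J"
    by (simp add: two_sided_ideal_def free_action_zero free_action_add free_action_mult module_hom.zero [OF free_action_hom])
  moreover have "yangian_relations \<subseteq> ?J" using free_action_relation by blast
  ultimately show ?thesis using assms unfolding ideal_gen_def by blast
qed

text \<open>
  The free algebra acts and the relations act by zero, so the action descends to the quotient; it is
  unique because the images of the words span the Yangian.
\<close>

theorem yangian_action:
  assumes "is_yangian scaleY \<pi>Y"
  shows "defines_yangian_action scaleY \<pi>Y scW A"
proof -
  have alg: "algebra_h scaleY" and hom: "module_hom free_scale scaleY \<pi>Y" and one: "\<pi>Y 1 = 1"
    and mult: "\<And>x y. \<pi>Y (x * y) = \<pi>Y x * \<pi>Y y" and surj: "surj \<pi>Y"
    and ker: "{x. \<pi>Y x = 0} = ideal_gen yangian_relations"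
    using assms unfolding is_yangian_def quotient_alg_def by auto
  interpret p: module_hom free_scale scaleY \<pi>Y by (rule hom)
  define \<rho> where "\<rho> y = free_action (SOME x. \<pi>Y x = y)" for y
  have \<rho>: "\<rho> (\<pi>Y x) w = free_action x w" for x w
  proof -
    define x' where "x' = (SOME x'. \<pi>Y x' = \<pi>Y x)"
    have "\<pi>Y x' = \<pi>Y x" unfolding x'_def by (rule someI [of _ x]) (rule refl)
    then have "\<pi>Y (x' - x) = 0" unfolding p.diff by simp
    then have "x' - x \<in> ideal_gen yangian_relations" unfolding ker [symmetric] by simp
    from free_action_ideal [OF this] have "free_action x' w = free_action x w"
      unfolding free_action_diff by simp
    then show ?thesis unfolding \<rho>_def x'_def .
  qed
  have ex: "\<exists>x. y = \<pi>Y x" for y using surj by (metis surjD)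
  have rep: "Defs.representation scaleY scW \<rho>"
    unfolding Defs.representation_def
  proof (intro conjI allI)
    fix y w
    show "module_hom scW scW (\<rho> y)" unfolding \<rho>_def by (rule free_action_hom)
    obtain x where x: "y = \<pi>Y x" using ex by blast
    have "\<rho> (y + y') w = \<rho> y w + \<rho> y' w" for y y'
    proof -
      obtain x x' where "y = \<pi>Y x" "y' = \<pi>Y x'" using ex by metis
      then show ?thesis by (simp only: p.add [symmetric] \<rho> free_action_add)
    qed
    moreover have "\<rho> (scaleY c y) w = scW c (\<rho> y w)" for c y
    proof -
      obtain x where "y = \<pi>Y x" using ex by blast
      then show ?thesis by (simp only: p.scale [symmetric] \<rho> free_action_scale)
    qed
    ultimately show "module_hom scaleY scW (\<lambda>y. \<rho> y w)"
      using alg by (simp add: module_hom_iff module_axioms algebra_h_def)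
    show "\<rho> 1 w = w" using \<rho> [of 1 w] by (simp only: one free_action_one)
    fix y'
    show "\<rho> (y * y') w = \<rho> y (\<rho> y' w)"
    proof -
      obtain x' where "y' = \<pi>Y x'" using ex by blast
      then show ?thesis by (simp only: x mult [symmetric] \<rho> free_action_mult)
    qed
  qed
  have gen: "\<rho> (yangian_gen \<pi>Y i j r) = A i j (- r)" for i j r
    by (rule ext) (simp add: yangian_gen_def \<rho> free_gen_def free_action_single word_action_def)
  have unique: "\<rho>' = \<rho>" if rep': "Defs.representation scaleY scW \<rho>'"
    and gen': "\<And>i j r. \<rho>' (yangian_gen \<pi>Y i j r) = A i j (- r)" for \<rho>'
  proof -
    have hom': "module_hom scaleY scW (\<lambda>x. \<rho>' x w)" for w
      using rep' unfolding Defs.representation_def by blast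
    have \<rho>'_add: "\<rho>' (y + y') w = \<rho>' y w + \<rho>' y' w" and \<rho>'_scale: "\<rho>' (scaleY c y) w = scW c (\<rho>' y w)"
      and \<rho>'_zero: "\<rho>' 0 w = 0" for y y' c w
      by (rule module_hom.add [OF hom'] module_hom.scale [OF hom'] module_hom.zero [OF hom'])+
    have \<rho>'_one: "\<rho>' 1 w = w" and \<rho>'_mult: "\<rho>' (y * y') w = \<rho>' y (\<rho>' y' w)" for y y' w
      using rep' unfolding Defs.representation_def by simp_all
    have word: "\<rho>' (\<pi>Y (Poly_Mapping.single (Free_Word gs) 1)) w = word_action gs w" for gs w
    proof (induction gs)
      case Nil
      have "Poly_Mapping.single (Free_Word []) 1 = (1 :: 'n yang_free)"
        by (simp flip: zero_free_word_def)
      then show ?case by (simp add: one \<rho>'_one word_action_def)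
    next
      case (Cons g gs)
      obtain i j r where g: "g = (i, j, r)" by (cases g)
      have "Poly_Mapping.single (Free_Word (g # gs)) 1
          = free_gen (i, j, r) * (Poly_Mapping.single (Free_Word gs) 1 :: 'n yang_free)"
        by (simp add: free_gen_def mult_single plus_free_word_def g)
      then have "\<rho>' (\<pi>Y (Poly_Mapping.single (Free_Word (g # gs)) 1)) w = A i j (- r) (word_action gs w)"
        using gen' [of i j r] by (simp add: mult \<rho>'_mult Cons.IH yangian_gen_def)
      then show ?case by (simp add: word_action_def g)
    qed
    have "\<rho>' (\<pi>Y x) w = free_action x w" for x w
    proof (induction x rule: poly_mapping_single_induct)
      case (add a c x)
      obtain gs where a: "a = Free_Word gs" by (cases a)
      have "Poly_Mapping.single a c = free_scale c (Poly_Mapping.single a 1)"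
        by (simp add: free_scale_def mult_single)
      then have "\<rho>' (\<pi>Y (Poly_Mapping.single a c)) w = scW c (word_action gs w)"
        by (simp add: p.scale \<rho>'_scale a word)
      then show ?case
        using add by (simp add: p.add \<rho>'_add free_action_add free_action_single a)
    qed (simp add: \<rho>'_zero free_action_zero)
    then show "\<rho>' = \<rho>" using ex \<rho> by (metis ext)
  qed
  show ?thesis
    unfolding defines_yangian_action_def using rep gen unique by (intro ex1I [of _ \<rho>]) blast+
qed

end

section \<open>The action on modules over \<open>V(R)\<close>\<close>

theorem corollary7p1:
  fixes Rbar :: "'n::finite rmat"
    and scaleY :: "complex fps \<Rightarrow> 'y::ring_1 \<Rightarrow> 'y"
    and \<pi>Y :: "'n yang_free \<Rightarrow> 'y"
    and scaleV :: "complex fps \<Rightarrow> 'a::ring_1 \<Rightarrow> 'a"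
    and \<pi>A :: "'n A_free \<Rightarrow> 'a"
    and Y :: "'a \<Rightarrow> int \<Rightarrow> 'a \<Rightarrow> 'a"
  assumes "CARD('n) \<ge> 2"
    and "Rbar = Rplus \<or> Rbar = Rminus"
    and "is_yangian scaleY \<pi>Y"
    and "is_V Rbar scaleV \<pi>A Y"
  shows "(\<forall>(scaleW :: complex fps \<Rightarrow> 'w::ab_group_add \<Rightarrow> 'w) YW.
            qva_module scaleV Y 1 scaleW YW \<longrightarrow>
              defines_yangian_action scaleY \<pi>Y scaleW (L_of_module \<pi>A YW) \<and>
              (\<forall>i j. in_Hom_laurent_h scaleW (L_of_module \<pi>A YW i j))) \<and>
         defines_yangian_action scaleY \<pi>Y scaleV (L_of_module \<pi>A Y)"
proof -
  obtain \<epsilon> where \<epsilon>: "signed_R \<epsilon> Rbar"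
    using assms(2) unfolding signed_R_def by blast
  have free: "topologically_free scaleV"
    and quot: "quotient_alg tfree_scale scaleV \<pi>A (tfree_ideal_gen (A_relations Rbar))"
    using assms(4) by (simp_all add: is_V_def is_A_def)
  obtain L where L: "is_L_operator Rbar scaleV \<pi>A L"
    and Y': "\<forall>n\<ge>1. \<forall>I J b c w. length I = n \<and> length J = n \<and> length b = n \<longrightarrow>
      Y (Lplus \<pi>A I J b) c w =
        hsum scaleV (\<lambda>p. scaleV (fps_const (\<Prod>m<n. binexp 1 1 (p ! m) (p ! m - b ! m) (b ! m))) (L_bracket Rbar scaleV L n w I J p))
          {p. length p = n \<and> (\<Sum>m<n. p ! m - b ! m) = c}"
    using assms(4) unfolding is_V_def by (elim conjE exE) (rule that)
  note Y = Y' [rule_format, OF _ conjI [OF _ conjI]]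
  interpret hcomplete scaleV by (rule hcomplete_topologically_free [OF free])
  have relation: "\<pi>A x = 0" if "x \<in> A_relations Rbar" for x
  proof -
    have "x \<in> tfree_ideal_gen (A_relations Rbar)" using that unfolding tfree_ideal_gen_def by blast
    then show ?thesis using quot unfolding quotient_alg_def by blast
  qed
  have \<pi>A: "algebra_h scaleV" "module_hom tfree_scale scaleV \<pi>A" "\<pi>A 1 = 1" "\<And>x y. \<pi>A (x * y) = \<pi>A x * \<pi>A y" "surj \<pi>A"
    using quot unfolding quotient_alg_def by blast+
  interpret V: V_algebra scaleV \<pi>A Rbar \<epsilon> L Y
    by (intro V_algebra.intro V_algebra_axioms.intro L_operator.intro L_operator_axioms.intro
        A_algebra.intro A_algebra_axioms.intro)
      (rule hcomplete_axioms \<pi>A relation \<epsilon> L Y; assumption)+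
  have "defines_yangian_action scaleY \<pi>Y scaleW (L_of_module \<pi>A YW) \<and>
      (\<forall>i j. in_Hom_laurent_h scaleW (L_of_module \<pi>A YW i j))"
    if W: "qva_module scaleV Y 1 scaleW YW" for scaleW :: "complex fps \<Rightarrow> 'w \<Rightarrow> 'w" and YW
  proof -
    interpret W: hcomplete scaleW
      by (rule hcomplete_topologically_free) (use W in \<open>simp add: qva_module_def\<close>)
    have axioms: "field_map scaleV scaleW YW" "vacuum_acts_trivially YW 1"
      "\<And>u v w k. \<exists>r. \<forall>a b. mult_binomial scaleW r (assoc_product scaleW YW u v w) a b
        - mult_binomial scaleW r (\<lambda>a b. YW (Y u a v) b w) a b \<in> hpow scaleW k"
      using W unfolding qva_module_def by blast+
    interpret M: V_module scaleV \<pi>A Rbar \<epsilon> L Y scaleW YW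
      by (intro V_module.intro V_module_axioms.intro) (rule V.V_algebra_axioms W.hcomplete_axioms axioms)+
    interpret S: RTT_solution scaleW "L_of_module \<pi>A YW"
      unfolding L_of_module_def
      by (intro RTT_solution.intro RTT_solution_axioms.intro) (rule W.module_axioms M.YW_hom M.module_RTT)+
    have "in_Hom_laurent_h scaleW (L_of_module \<pi>A YW i j)" for i j
      using M.YW_field unfolding in_Hom_laurent_h_def L_of_module_def field_map_def by blast
    then show ?thesis using S.yangian_action [OF assms(3)] by blast
  qed
  moreover have "defines_yangian_action scaleY \<pi>Y scaleV (L_of_module \<pi>A Y)"
  proof -
    have Y_L: "L_of_module \<pi>A Y = L"
      by (intro ext) (simp add: L_of_module_def V.Y_generator)
    interpret S: RTT_solution scaleV L
      by (intro RTT_solution.intro RTT_solution_axioms.intro)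
        (rule module_axioms V.L_hom V.RTT [unfolded V.RTT_def, rule_format])+
    show ?thesis unfolding Y_L by (rule S.yangian_action [OF assms(3)])
  qed
  ultimately show ?thesis by blast
qed

end
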